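(* Let $\alpha>0$, $q\in L^\infty(0,\alpha\pi)$, $r\in L^\infty(0,\pi)$ be real-valued, let $L=-\Delta+q(x)+r(y)$ with Dirichlet boundary conditions on the rectangle $\Omega=[0,\alpha\pi]\times[0,\pi]$, and fix $m_*,n_*\in\mathbb{N}=\{1,2,\dots\}$. With $\lambda_{mn}$, $\lambda_*=\lambda_{m_*n_*}$, the family $L_\sigma$, the eigenvalue curves $\gamma_k(\sigma)$, the Dirichlet-to-Neumann maps $\Lambda_\pm(\epsilon)$, and the notion of a lattice point giving rise to a negative eigenvalue as defined in the context, the following holds for all sufficiently small $\epsilon>0$ (with a threshold independent of $(m,n)$). For every $(m,n)\in\mathbb{N}^2$, the point $(m,n)$ gives rise to a negative eigenvalue of $\Lambda_+(\epsilon)+\Lambda_-(\epsilon)$ if and only if $\lambda_{mn}\le\lambda_*$ and either $m>m_*$ or $n>n_*$.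
   Context: Eigenvalues. Let $\lambda^x_1<\lambda^x_2<\cdots$ and $\lambda^y_1<\lambda^y_2<\cdots$ be the Dirichlet eigenvalues of $-\frac{d^2}{dx^2}+q(x)$ on $[0,\alpha\pi]$ and of $-\frac{d^2}{dy^2}+r(y)$ on $[0,\pi]$, respectively. The Dirichlet spectrum of $L$ is $\{\lambda_{mn}=\lambda^x_m+\lambda^y_n : m,n\in\mathbb{N}\}$. Put $\lambda_*=\lambda_{m_*n_*}$ (not assumed simple), let $u^x_{m_*}$, $u^y_{n_*}$ be eigenfunctions for $\lambda^x_{m_*}$, $\lambda^y_{n_*}$, and let $\phi_*(x,y)=u^x_{m_*}(x)\,u^y_{n_*}(y)$, with nodal set $\Gamma=\{p\in\operatorname{int}\Omega:\phi_*(p)=0\}$ and positive/negative nodal regions $\Omega_\pm=\{\pm\phi_*>0\}$. The family $L_\sigma$. For $\sigma\in[0,\infty)$, $L_\sigma$ is the selfadjoint operator on $L^2(\Omega)$ defined by the bilinear form $B_\sigma(u,v)=\int_\Omega[\nabla u\cdot\nabla v+(q(x)+r(y))uv]+\sigma\int_\Gamma uv$ on $H^1_0(\Omega)$, where the last integral is with respect to arclength on $\Gamma$. Thus $L_0=L$. Its eigenvalues, counted with multiplicity, are described by analytic eigenvalue branches (curves) $\{\gamma_k(\sigma)\}_{k\in\mathbb{N}}$, $\sigma\ge0$. One-dimensional families. Let $\{Z^x_i\}\subset(0,\alpha\pi)$ and $\{Z^y_j\}\subset(0,\pi)$ be the interior zeros of $u^x_{m_*}$ and $u^y_{n_*}$.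 For $\sigma\ge0$, $L^x_\sigma$ is the selfadjoint operator $-\frac{d^2}{dx^2}+q(x)$ on $[0,\alpha\pi]$ with conditions $u(0)=u(\alpha\pi)=0$, $u(Z^x_i-)=u(Z^x_i+)$ and $u'(Z^x_i+)-u'(Z^x_i-)=\sigma u(Z^x_i)$ for all $i$; $L^y_\sigma$ is defined analogously on $[0,\pi]$ using $r$ and $\{Z^y_j\}$. Their ordered eigenvalues, which are simple, are denoted $\lambda^x_m(\sigma)$ and $\lambda^y_n(\sigma)$, $m,n\in\mathbb{N}$, so $\lambda^x_m(0)=\lambda^x_m$ and $\lambda^y_n(0)=\lambda^y_n$. For $(m,n)\in\mathbb{N}^2$, $k(m,n)$ denotes the index of the eigenvalue curve of $L_\sigma$ given by $\gamma_{k(m,n)}(\sigma)=\lambda^x_m(\sigma)+\lambda^y_n(\sigma)$; in particular $\gamma_{k(m,n)}(0)=\lambda_{mn}$. Dirichlet-to-Neumann maps. For sufficiently small $\epsilon>0$ and $f$ the trace on $\Gamma$ of a function in $H^1_0(\Omega)$, let $u\in H^1_0(\Omega)$ be the unique function with $u|_\Gamma=f$ and $-\Delta u+(q(x)+r(y))u=(\lambda_*+\epsilon)u$ in $\Omega\setminus\Gamma$. Then $\Lambda_\pm(\epsilon)f=\frac{\partial u}{\partial\nu_\pm}\big|_\Gamma$ (in the weak sense), where the normal derivative is taken from within $\Omega_\pm$ and $\nu_\pm$ is the outward unit normal to $\Omega_\pm$. Giving rise to a negative eigenvalue. An eigenvalue curve $\gamma_k(\sigma)$ is said to give rise to a negative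 eigenvalue of $\Lambda_+(\epsilon)+\Lambda_-(\epsilon)$ if $\gamma_k(\sigma)=\lambda_*+\epsilon$ for some $\sigma>0$ (the negative eigenvalue being $-\sigma$). A lattice point $(m,n)\in\mathbb{N}^2$ is said to give rise to a negative eigenvalue of $\Lambda_+(\epsilon)+\Lambda_-(\epsilon)$ if the curve $\gamma_{k(m,n)}(\sigma)$ does. *)

theory Defs
  imports "HOL-Analysis.Analysis"
begin

section \<open>Function spaces\<close>

definition L2_on :: "'a::euclidean_space set \<Rightarrow> ('a \<Rightarrow> real) \<Rightarrow> bool" where
  "L2_on S f \<longleftrightarrow>
     f \<in> borel_measurable (lebesgue_on S) \<and> integrable (lebesgue_on S) (\<lambda>x. (f x)\<^sup>2)"

definition Linf_on :: "'a::euclidean_space set \<Rightarrow> ('a \<Rightarrow> real) \<Rightarrow> bool" where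
  "Linf_on S f \<longleftrightarrow>
     f \<in> borel_measurable (lebesgue_on S) \<and> (\<exists>C. AE x in lebesgue_on S. \<bar>f x\<bar> \<le> C)"

definition L2_lim_on :: "'a::euclidean_space set \<Rightarrow> (nat \<Rightarrow> 'a \<Rightarrow> real) \<Rightarrow> ('a \<Rightarrow> real) \<Rightarrow> bool" where
  "L2_lim_on S f g \<longleftrightarrow>
     (\<forall>j. L2_on S (f j)) \<and> L2_on S g \<and>
     (\<lambda>j. \<integral>x. (f j x - g x)\<^sup>2 \<partial>lebesgue_on S) \<longlonglongrightarrow> 0"


section \<open>One-dimensional operators with point interactions\<close>

text \<open>
  \<open>SL_operator a q Z \<sigma> u f\<close> is the graph of the selfadjoint operator
  \<open>u \<mapsto> f = - u'' + q u\<close> in \<open>L\<^sup>2(0,a)\<close> with Dirichlet conditions at \<open>0\<close> and \<open>a\<close>,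
  where \<open>u\<close> is continuous and \<open>u'(z+) - u'(z-) = \<sigma> u(z)\<close> at each \<open>z \<in> Z\<close>.
  The potential is only bounded and measurable, so the equation holds almost everywhere and
  \<open>u'\<close> is absolutely continuous between consecutive points of \<open>Z\<close>, i.e. there it is an
  indefinite Lebesgue integral of the integrable function \<open>u''\<close>.
  For \<open>Z = {}\<close> this is the ordinary Dirichlet operator.
\<close>

definition SL_operator ::
  "real \<Rightarrow> (real \<Rightarrow> real) \<Rightarrow> real set \<Rightarrow> real \<Rightarrow> (real \<Rightarrow> real) \<Rightarrow> (real \<Rightarrow> real) \<Rightarrow> bool" where
  "SL_operator a q Z \<sigma> u f \<longleftrightarrow>
     continuous_on {0..a} u \<and> u 0 = 0 \<and> u a = 0 \<and> L2_on {0..a} f \<and>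
     (\<exists>u' u''.
        (\<forall>x \<in> {0<..<a} - Z. (u has_real_derivative u' x) (at x)) \<and>
        integrable (lebesgue_on {0..a}) u'' \<and>
        (\<forall>s t. s \<le> t \<and> {s..t} \<subseteq> {0<..<a} - Z \<longrightarrow>
           u' t - u' s = (\<integral>x. u'' x \<partial>lebesgue_on {s..t})) \<and>
        (AE x in lebesgue_on {0..a}. - u'' x + q x * u x = f x) \<and>
        (\<forall>z \<in> Z. \<exists>l r. (u' \<longlongrightarrow> l) (at_left z) \<and> (u' \<longlongrightarrow> r) (at_right z) \<and>
           r - l = \<sigma> * u z))"

definition SL_eigenfunction ::
  "real \<Rightarrow> (real \<Rightarrow> real) \<Rightarrow> real set \<Rightarrow> real \<Rightarrow> real \<Rightarrow> (real \<Rightarrow> real) \<Rightarrow> bool" where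
  "SL_eigenfunction a q Z \<sigma> l u \<longleftrightarrow>
     SL_operator a q Z \<sigma> u (\<lambda>x. l * u x) \<and> (\<exists>x \<in> {0..a}. u x \<noteq> 0)"

definition SL_spectrum :: "real \<Rightarrow> (real \<Rightarrow> real) \<Rightarrow> real set \<Rightarrow> real \<Rightarrow> real set" where
  "SL_spectrum a q Z \<sigma> = {l. \<exists>u. SL_eigenfunction a q Z \<sigma> l u}"

text \<open>
  The \<open>m\<close>-th smallest eigenvalue, \<open>m = 1, 2, \<dots>\<close>.  Multiplicities need not be counted: all
  eigenvalues are simple when \<open>Z\<close> is finite.
\<close>

definition SL_eigenvalue :: "real \<Rightarrow> (real \<Rightarrow> real) \<Rightarrow> real set \<Rightarrow> real \<Rightarrow> nat \<Rightarrow> real" where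
  "SL_eigenvalue a q Z \<sigma> m =
     (THE l. l \<in> SL_spectrum a q Z \<sigma> \<and>
        finite {l' \<in> SL_spectrum a q Z \<sigma>. l' < l} \<and>
        card {l' \<in> SL_spectrum a q Z \<sigma>. l' < l} + 1 = m)"

abbreviation Dirichlet_eigenvalue :: "real \<Rightarrow> (real \<Rightarrow> real) \<Rightarrow> nat \<Rightarrow> real" where
  "Dirichlet_eigenvalue a q m \<equiv> SL_eigenvalue a q {} 0 m"

abbreviation Dirichlet_eigenfunction ::
  "real \<Rightarrow> (real \<Rightarrow> real) \<Rightarrow> real \<Rightarrow> (real \<Rightarrow> real) \<Rightarrow> bool" where
  "Dirichlet_eigenfunction a q l u \<equiv> SL_eigenfunction a q {} 0 l u"

definition interior_zeros :: "real \<Rightarrow> (real \<Rightarrow> real) \<Rightarrow> real set" where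
  "interior_zeros a u = {z \<in> {0<..<a}. u z = 0}"


section \<open>The Sobolev space on the rectangle and traces on the nodal set\<close>

text \<open>
  The nodal set \<open>\<Gamma>\<close> of \<open>(x,y) \<mapsto> u(x) v(y)\<close> in the open rectangle \<open>(0,a) \<times> (0,b)\<close> is the
  union of the segments \<open>{z} \<times> (0,b)\<close>, \<open>z \<in> Zx\<close>, and \<open>(0,a) \<times> {z}\<close>, \<open>z \<in> Zy\<close>, where
  \<open>Zx\<close>, \<open>Zy\<close> are the (finite) sets of interior zeros of \<open>u\<close>, \<open>v\<close>.  The segments meet in
  finitely many points, so integration by arclength over \<open>\<Gamma>\<close> is the following sum.
\<close>

definition nodal_integral ::
  "real \<Rightarrow> real \<Rightarrow> real set \<Rightarrow> real set \<Rightarrow> (real \<times> real \<Rightarrow> real) \<Rightarrow> real" where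
  "nodal_integral a b Zx Zy g =
     (\<Sum>z \<in> Zx. \<integral>y. g (z, y) \<partial>lebesgue_on {0..b}) +
     (\<Sum>z \<in> Zy. \<integral>x. g (x, z) \<partial>lebesgue_on {0..a})"

definition nodal_L2_lim ::
  "real \<Rightarrow> real \<Rightarrow> real set \<Rightarrow> real set \<Rightarrow> (nat \<Rightarrow> real \<times> real \<Rightarrow> real) \<Rightarrow> (real \<times> real \<Rightarrow> real) \<Rightarrow> bool"
where
  "nodal_L2_lim a b Zx Zy f t \<longleftrightarrow>
     (\<forall>z \<in> Zx. L2_lim_on {0..b} (\<lambda>j y. f j (z, y)) (\<lambda>y. t (z, y))) \<and>
     (\<forall>z \<in> Zy. L2_lim_on {0..a} (\<lambda>j x. f j (x, z)) (\<lambda>x. t (x, z)))"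

definition has_gradient ::
  "(real \<times> real \<Rightarrow> real) \<Rightarrow> (real \<times> real \<Rightarrow> real) \<Rightarrow> (real \<times> real \<Rightarrow> real) \<Rightarrow> bool" where
  "has_gradient f fx fy \<longleftrightarrow>
     (\<forall>p. (f has_derivative (\<lambda>h. fx p * fst h + fy p * snd h)) (at p))"

primrec C_k :: "nat \<Rightarrow> (real \<times> real \<Rightarrow> real) \<Rightarrow> bool" where
  "C_k 0 f = continuous_on UNIV f"
| "C_k (Suc n) f = (\<exists>fx fy. has_gradient f fx fy \<and> C_k n fx \<and> C_k n fy)"

definition test_function :: "real \<Rightarrow> real \<Rightarrow> (real \<times> real \<Rightarrow> real) \<Rightarrow> bool" where
  "test_function a b f \<longleftrightarrow>
     (\<forall>n. C_k n f) \<and>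
     (\<exists>K. compact K \<and> K \<subseteq> {0<..<a} \<times> {0<..<b} \<and> (\<forall>p. p \<notin> K \<longrightarrow> f p = 0))"

text \<open>
  \<open>H10 a b Zx Zy u ux uy t\<close>: the function \<open>u\<close> belongs to \<open>H\<^sup>1\<^sub>0\<close> of the rectangle, i.e. to the
  closure of the test functions in \<open>H\<^sup>1\<close>; its weak gradient is \<open>(ux, uy)\<close>, and its trace on the
  nodal set is \<open>t\<close>.  By the trace theorem the restrictions of the approximating test functions
  to the nodal set always converge in \<open>L\<^sup>2\<close>, so the last conjunct identifies \<open>t\<close> and does not
  restrict \<open>u\<close>.
\<close>

definition H10 ::
  "real \<Rightarrow> real \<Rightarrow> real set \<Rightarrow> real set \<Rightarrow>
   (real \<times> real \<Rightarrow> real) \<Rightarrow> (real \<times> real \<Rightarrow> real) \<Rightarrow> (real \<times> real \<Rightarrow> real) \<Rightarrow> (real \<times> real \<Rightarrow> real) \<Rightarrow> bool"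
where
  "H10 a b Zx Zy u ux uy t \<longleftrightarrow>
     (\<exists>f fx fy.
        (\<forall>j. test_function a b (f j) \<and> has_gradient (f j) (fx j) (fy j)) \<and>
        L2_lim_on ({0..a} \<times> {0..b}) f u \<and>
        L2_lim_on ({0..a} \<times> {0..b}) fx ux \<and>
        L2_lim_on ({0..a} \<times> {0..b}) fy uy \<and>
        nodal_L2_lim a b Zx Zy f t)"


section \<open>The operators on the rectangle and their eigenvalue curves\<close>

text \<open>
  \<open>L_operator a b q r Zx Zy \<sigma> u f\<close> is the graph of the selfadjoint operator associated with the
  form \<open>B\<^sub>\<sigma>(u,v) = \<integral> (\<nabla>u \<cdot> \<nabla>v + (q(x) + r(y)) u v) + \<sigma> \<integral>\<^sub>\<Gamma> u v\<close> on \<open>H\<^sup>1\<^sub>0\<close>: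
  \<open>u\<close> is in its domain and is mapped to \<open>f\<close> iff \<open>u \<in> H\<^sup>1\<^sub>0\<close>, \<open>f \<in> L\<^sup>2\<close> and
  \<open>B\<^sub>\<sigma>(u,v) = \<langle>f,v\<rangle>\<close> for all \<open>v \<in> H\<^sup>1\<^sub>0\<close>.
\<close>

definition L_operator ::
  "real \<Rightarrow> real \<Rightarrow> (real \<Rightarrow> real) \<Rightarrow> (real \<Rightarrow> real) \<Rightarrow> real set \<Rightarrow> real set \<Rightarrow> real \<Rightarrow>
   (real \<times> real \<Rightarrow> real) \<Rightarrow> (real \<times> real \<Rightarrow> real) \<Rightarrow> bool"
where
  "L_operator a b q r Zx Zy \<sigma> u f \<longleftrightarrow>
     L2_on ({0..a} \<times> {0..b}) f \<and>
     (\<exists>ux uy t. H10 a b Zx Zy u ux uy t \<and>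
        (\<forall>v vx vy s. H10 a b Zx Zy v vx vy s \<longrightarrow>
           (\<integral>p. ux p * vx p + uy p * vy p + (q (fst p) + r (snd p)) * u p * v p
              \<partial>lebesgue_on ({0..a} \<times> {0..b}))
           + \<sigma> * nodal_integral a b Zx Zy (\<lambda>p. t p * s p)
           = (\<integral>p. f p * v p \<partial>lebesgue_on ({0..a} \<times> {0..b}))))"

definition L_multiplicity ::
  "real \<Rightarrow> real \<Rightarrow> (real \<Rightarrow> real) \<Rightarrow> (real \<Rightarrow> real) \<Rightarrow> real set \<Rightarrow> real set \<Rightarrow> real \<Rightarrow> real \<Rightarrow> nat \<Rightarrow> bool"
where
  "L_multiplicity a b q r Zx Zy \<sigma> l N \<longleftrightarrow>
     (\<exists>e :: nat \<Rightarrow> real \<times> real \<Rightarrow> real.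
        (\<forall>i<N. L_operator a b q r Zx Zy \<sigma> (e i) (\<lambda>p. l * e i p)) \<and>
        (\<forall>c. (AE p in lebesgue_on ({0..a} \<times> {0..b}). (\<Sum>i<N. c i * e i p) = 0)
               \<longrightarrow> (\<forall>i<N. c i = (0::real))) \<and>
        (\<forall>w. L_operator a b q r Zx Zy \<sigma> w (\<lambda>p. l * w p) \<longrightarrow>
           (\<exists>c :: nat \<Rightarrow> real.
              AE p in lebesgue_on ({0..a} \<times> {0..b}). w p = (\<Sum>i<N. c i * e i p))))"

definition analytic_curve :: "(real \<Rightarrow> real) \<Rightarrow> bool" where
  "analytic_curve g \<longleftrightarrow>
     (\<exists>G. G analytic_on (complex_of_real ` {0..}) \<and>
          (\<forall>\<sigma>\<ge>0. G (complex_of_real \<sigma>) = complex_of_real (g \<sigma>)))"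

text \<open>
  The curves \<open>\<gamma> 1, \<gamma> 2, \<dots>\<close> are analytic on \<open>[0,\<infinity>)\<close> and for every \<open>\<sigma> \<ge> 0\<close> list the
  eigenvalues of the operator, each as often as its multiplicity (non-eigenvalues have
  multiplicity \<open>0\<close>).
\<close>

definition eigenvalue_curves ::
  "real \<Rightarrow> real \<Rightarrow> (real \<Rightarrow> real) \<Rightarrow> (real \<Rightarrow> real) \<Rightarrow> real set \<Rightarrow> real set \<Rightarrow> (nat \<Rightarrow> real \<Rightarrow> real) \<Rightarrow> bool"
where
  "eigenvalue_curves a b q r Zx Zy \<gamma> \<longleftrightarrow>
     (\<forall>k\<ge>1. analytic_curve (\<gamma> k)) \<and>
     (\<forall>\<sigma>\<ge>0. \<forall>l. finite {k. k \<ge> 1 \<and> \<gamma> k \<sigma> = l} \<and>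
        L_multiplicity a b q r Zx Zy \<sigma> l (card {k. k \<ge> 1 \<and> \<gamma> k \<sigma> = l}))"

text \<open>\<open>k m n\<close> is the index of the curve given by the sum of one-dimensional eigenvalues.\<close>

definition curve_index ::
  "real \<Rightarrow> real \<Rightarrow> (real \<Rightarrow> real) \<Rightarrow> (real \<Rightarrow> real) \<Rightarrow> real set \<Rightarrow> real set \<Rightarrow> (nat \<Rightarrow> real \<Rightarrow> real) \<Rightarrow>
   (nat \<Rightarrow> nat \<Rightarrow> nat) \<Rightarrow> bool"
where
  "curve_index a b q r Zx Zy \<gamma> k \<longleftrightarrow>
     (\<forall>m\<ge>1. \<forall>n\<ge>1. k m n \<ge> 1 \<and>
        (\<forall>\<sigma>\<ge>0. \<gamma> (k m n) \<sigma> = SL_eigenvalue a q Zx \<sigma> m + SL_eigenvalue b r Zy \<sigma> n))"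

text \<open>
  An eigenvalue curve \<open>g\<close> gives rise to a negative eigenvalue of the sum
  \<open>\<Lambda>\<^sub>+(\<epsilon>) + \<Lambda>\<^sub>-(\<epsilon>)\<close> of the Dirichlet-to-Neumann maps at energy \<open>l + \<epsilon>\<close> if it crosses
  \<open>l + \<epsilon>\<close> at some \<open>\<sigma> > 0\<close>; the negative eigenvalue is then \<open>- \<sigma>\<close>.  This is a definition in
  terms of the curve only: an eigenfunction of \<open>L_operator\<close> at parameter \<open>\<sigma>\<close> with eigenvalue
  \<open>l + \<epsilon>\<close> solves the equation off \<open>\<Gamma>\<close>, and the sum of its outward normal derivatives from both
  sides of \<open>\<Gamma>\<close> is \<open>- \<sigma>\<close> times its trace.
\<close>

definition curve_gives_rise :: "(real \<Rightarrow> real) \<Rightarrow> real \<Rightarrow> real \<Rightarrow> bool" where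
  "curve_gives_rise g l \<epsilon> \<longleftrightarrow> (\<exists>\<sigma>>0. g \<sigma> = l + \<epsilon>)"

definition point_gives_rise ::
  "(nat \<Rightarrow> real \<Rightarrow> real) \<Rightarrow> (nat \<Rightarrow> nat \<Rightarrow> nat) \<Rightarrow> real \<Rightarrow> real \<Rightarrow> nat \<Rightarrow> nat \<Rightarrow> bool" where
  "point_gives_rise \<gamma> k l \<epsilon> m n \<longleftrightarrow> curve_gives_rise (\<gamma> (k m n)) l \<epsilon>"

text \<open>Eigenvalues \<open>\<lambda>\<^sub>m\<^sub>n\<close> of \<open>- \<Delta> + q(x) + r(y)\<close> with Dirichlet conditions on the rectangle.\<close>

definition rect_eigenvalue ::
  "real \<Rightarrow> real \<Rightarrow> (real \<Rightarrow> real) \<Rightarrow> (real \<Rightarrow> real) \<Rightarrow> nat \<Rightarrow> nat \<Rightarrow> real" where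
  "rect_eigenvalue a b q r m n = Dirichlet_eigenvalue a q m + Dirichlet_eigenvalue b r n"

end

theory Submission
  imports Defs
begin

text \<open>
  On the rectangle every eigenvalue curve under consideration is a sum of two one-dimensional
  eigenvalues, so the question is how the eigenvalues of
  \<open>- d\<^sup>2 / dx\<^sup>2 + q\<close> move when repulsive point interactions of strength \<open>\<sigma>\<close> are placed at the zeros of
  the eigenfunction number \<open>m\<^sub>*\<close>.  The answer is: none of them ever lies below its value at \<open>\<sigma> = 0\<close>;
  the one with number \<open>m\<^sub>*\<close> is constant, because its eigenfunction does not feel interactions at its
  own zeros, so those with smaller number never exceed it; and as \<open>\<sigma>\<close> grows, the nodal intervals
  decouple into Dirichlet problems, each of which has \<open>\<lambda>\<^sub>m\<^sub>*\<close> as its lowest eigenvalue.  In the limit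
  the first \<open>m\<^sub>*\<close> eigenvalues therefore come arbitrarily close to \<open>\<lambda>\<^sub>m\<^sub>*\<close>, while all others exceed it by
  a fixed amount.  These facts are collected in \<open>nodal_interaction_eigenvalues\<close>.

  They imply the theorem.  If \<open>m \<le> m\<^sub>*\<close> and \<open>n \<le> n\<^sub>*\<close>, the curve never exceeds \<open>\<lambda>\<^sub>*\<close>.  If it starts above
  \<open>\<lambda>\<^sub>*\<close>, it stays above its starting value, and only finitely many starting values are at most
  \<open>\<lambda>\<^sub>* + 1\<close>, so these curves avoid a common neighbourhood of \<open>\<lambda>\<^sub>*\<close>.  If it starts at or below \<open>\<lambda>\<^sub>*\<close> and,
  say, \<open>m > m\<^sub>*\<close>, then for large \<open>\<sigma>\<close> its first summand exceeds \<open>\<lambda>\<^sub>m\<^sub>*\<close> by a fixed amount, and its second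
  summand falls short of \<open>\<lambda>\<^sub>n\<^sub>*\<close> by at most an arbitrarily small one; by continuity the curve
  crosses \<open>\<lambda>\<^sub>* + \<epsilon>\<close>.

  The one-dimensional facts are proved with the Pruefer angle \<open>\<theta>\<close>, defined by
  \<open>u = \<rho> sin \<theta>\<close>, \<open>u' = \<rho> cos \<theta>\<close>.  It solves the scalar equation
  \<open>\<theta>' = cos\<^sup>2 \<theta> + (l - q) sin\<^sup>2 \<theta>\<close>, increases with the energy \<open>l\<close>, and crosses multiples of \<open>\<pi>\<close>,
  that is zeros of \<open>u\<close>, only upwards.  The \<open>m\<close>-th eigenvalue is the energy at which the angle,
  started at \<open>0\<close>, ends at \<open>m \<pi>\<close> (\<open>SL_spectrum_iff\<close>, \<open>SL_eigenvalue_eqI\<close>).  A point interaction acts by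
  a \<open>jump\<close> of the angle that fixes the multiples of \<open>\<pi>\<close>, turns all other angles back if \<open>\<sigma> > 0\<close>, and
  for \<open>\<sigma> \<rightarrow> \<infinity>\<close> presses them down to the next lower multiple.  The comparison with \<open>\<sigma> = 0\<close>, the constancy of the
  eigenvalue number \<open>m\<^sub>*\<close> and the decoupling (\<open>total_angle_strong_interaction\<close>) are all read off from
  this description.
\<close>

section \<open>Primitives of bounded measurable functions\<close>

definition bounded_measurable :: "real \<Rightarrow> real \<Rightarrow> (real \<Rightarrow> real) \<Rightarrow> bool" where
  "bounded_measurable c d f \<longleftrightarrow>
     f \<in> borel_measurable (lebesgue_on {c..d}) \<and> (\<exists>M. \<forall>x\<in>{c..d}. \<bar>f x\<bar> \<le> M)"

text \<open>
  The potentials are merely bounded and measurable, so solutions of the differential equations below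
  are understood in integrated form: each unknown is an indefinite integral of a bounded measurable
  function.  Boundedness (rather than integrability) of the density makes every primitive Lipschitz.
\<close>

definition primitive :: "real \<Rightarrow> real \<Rightarrow> (real \<Rightarrow> real) \<Rightarrow> (real \<Rightarrow> real) \<Rightarrow> bool" where
  "primitive c d F f \<longleftrightarrow>
     bounded_measurable c d f \<and> (\<forall>x\<in>{c..d}. F x = F c + integral {c..x} f)"

lemma bounded_measurable_bound:
  assumes "bounded_measurable c d f"
  obtains M where "M \<ge> 0" "\<And>x. x \<in> {c..d} \<Longrightarrow> \<bar>f x\<bar> \<le> M"
proof -
  obtain M0 where "\<forall>x\<in>{c..d}. \<bar>f x\<bar> \<le> M0" using assms unfolding bounded_measurable_def by blast
  then show ?thesis by (intro that[of "max 0 M0"]) (auto intro: max.coboundedI2)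
qed

lemma bounded_measurable_integrable:
  assumes "bounded_measurable c d f" "{s..t} \<subseteq> {c..d}"
  shows "f integrable_on {s..t}"
proof -
  obtain M where M: "\<And>x. x \<in> {c..d} \<Longrightarrow> \<bar>f x\<bar> \<le> M"
    using bounded_measurable_bound[OF assms(1)] by blast
  have "f \<in> borel_measurable (lebesgue_on {s..t})"
    using assms measurable_restrict_mono unfolding bounded_measurable_def by blast
  then show ?thesis
    using subsetD[OF assms(2), THEN M]
    by (rule_tac measurable_bounded_by_integrable_imp_integrable[where g = "\<lambda>_. M"]) auto
qed

lemma bounded_measurable_lebesgue_integrable:
  assumes "bounded_measurable c d f"
  shows "integrable (lebesgue_on {c..d}) f"
proof -
  obtain M where M: "\<And>x. x \<in> {c..d} \<Longrightarrow> \<bar>f x\<bar> \<le> M"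
    using bounded_measurable_bound[OF assms(1)] by blast
  show ?thesis
    using M assms unfolding bounded_measurable_def
    by (rule_tac absolutely_integrable_imp_integrable[OF
          measurable_bounded_by_integrable_imp_absolutely_integrable[where g = "\<lambda>_. M"]]) auto
qed

lemma bounded_measurable_subset:
  "bounded_measurable c d f \<Longrightarrow> c \<le> c' \<Longrightarrow> d' \<le> d \<Longrightarrow> bounded_measurable c' d' f"
  using measurable_restrict_mono[of f lebesgue "{c..d}" borel "{c'..d'}"]
  unfolding bounded_measurable_def by (meson atLeastatMost_subset_iff subsetD)

lemma bounded_measurable_cong:
  "(\<And>x. x \<in> {c..d} \<Longrightarrow> f x = g x) \<Longrightarrow> bounded_measurable c d f = bounded_measurable c d g"
  unfolding bounded_measurable_def
  by (intro conj_cong measurable_cong) auto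

lemma bounded_measurable_const [simp, intro]: "bounded_measurable c d (\<lambda>_. k)"
  by (auto simp: bounded_measurable_def)

lemma bounded_measurable_continuous: 
  "continuous_on {c..d} f \<Longrightarrow> bounded_measurable c d f"
  using compact_imp_bounded[OF compact_continuous_image[of "{c..d}" f]]
  by (auto simp: bounded_measurable_def bounded_iff intro: continuous_imp_measurable_on_sets_lebesgue)

lemma bounded_measurable_add:
  assumes "bounded_measurable c d f" "bounded_measurable c d g"
  shows "bounded_measurable c d (\<lambda>x. f x + g x)"
proof -
  obtain M N where "\<forall>x\<in>{c..d}. \<bar>f x\<bar> \<le> M" "\<forall>x\<in>{c..d}. \<bar>g x\<bar> \<le> N"
    using assms by (auto simp: bounded_measurable_def)
  then have "\<forall>x\<in>{c..d}. \<bar>f x + g x\<bar> \<le> M + N" by (auto intro: order.trans[OF abs_triangle_ineq add_mono])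
  with assms show ?thesis by (auto simp: bounded_measurable_def)
qed

lemma bounded_measurable_mult:
  assumes "bounded_measurable c d f" "bounded_measurable c d g"
  shows "bounded_measurable c d (\<lambda>x. f x * g x)"
proof -
  obtain M N where "\<forall>x\<in>{c..d}. \<bar>f x\<bar> \<le> M" "\<forall>x\<in>{c..d}. \<bar>g x\<bar> \<le> N"
    using assms by (auto simp: bounded_measurable_def)
  then have "\<forall>x\<in>{c..d}. \<bar>f x * g x\<bar> \<le> M * N" 
    by (auto simp: abs_mult intro!: mult_mono intro: order.trans[OF abs_ge_zero])
  with assms show ?thesis by (auto simp: bounded_measurable_def)
qed

lemma bounded_measurable_minus:
  "bounded_measurable c d f \<Longrightarrow> bounded_measurable c d (\<lambda>x. - f x)"
  using bounded_measurable_mult[OF bounded_measurable_const, of c d f "-1"] by simp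

lemma bounded_measurable_diff:
  "bounded_measurable c d f \<Longrightarrow> bounded_measurable c d g \<Longrightarrow> bounded_measurable c d (\<lambda>x. f x - g x)"
  using bounded_measurable_add[OF _ bounded_measurable_minus] by force

lemma bounded_measurable_compose:
  assumes "bounded_measurable c d f" "h \<in> borel_measurable borel" "\<And>x. \<bar>h x\<bar> \<le> K"
  shows "bounded_measurable c d (\<lambda>x. h (f x))"
  using assms measurable_compose[of f _ borel h]
  by (auto simp: bounded_measurable_def)

lemmas bounded_measurable_intros =
  bounded_measurable_add bounded_measurable_mult bounded_measurable_minus bounded_measurable_diff
  bounded_measurable_const

lemma integral_bounded_measurable_bound:
  assumes "bounded_measurable s t f" "\<And>x. x \<in> {s..t} \<Longrightarrow> \<bar>f x\<bar> \<le> M" "s \<le> t"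
  shows "\<bar>integral {s..t} f\<bar> \<le> M * (t - s)"
proof -
  have "norm (integral {s..t} f) \<le> integral {s..t} (\<lambda>_. M)"
    using assms bounded_measurable_integrable[OF assms(1) order_refl]
    by (intro integral_norm_bound_integral) auto
  then show ?thesis using assms by (simp add: mult.commute)
qed

lemma primitive_bounded_measurable: "primitive c d F f \<Longrightarrow> bounded_measurable c d f"
  unfolding primitive_def by blast

lemma primitiveI:
  "bounded_measurable c d f \<Longrightarrow> (\<And>x. x \<in> {c..d} \<Longrightarrow> F x = F c + integral {c..x} f) \<Longrightarrow> primitive c d F f"
  unfolding primitive_def by blast

lemma primitive_eq: "primitive c d F f \<Longrightarrow> x \<in> {c..d} \<Longrightarrow> F x = F c + integral {c..x} f"
  unfolding primitive_def by blast

lemma primitive_diff: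
  assumes "primitive c d F f" "c \<le> s" "s \<le> t" "t \<le> d"
  shows "F t - F s = integral {s..t} f"
proof -
  have "f integrable_on {c..t}"
    using assms by (intro bounded_measurable_integrable[of c d]) (auto intro: primitive_bounded_measurable)
  from Henstock_Kurzweil_Integration.integral_combine[OF assms(2,3) this]
  have "integral {c..s} f + integral {s..t} f = integral {c..t} f" .
  moreover have "F t = F c + integral {c..t} f" "F s = F c + integral {c..s} f"
    using assms by (auto intro!: primitive_eq)
  ultimately show ?thesis by simp
qed

lemma primitive_continuous_on: 
  assumes "primitive c d F f" shows "continuous_on {c..d} F"
proof -
  have "continuous_on {c..d} (\<lambda>x. F c + integral {c..x} f)"
    using assms
    by (intro continuous_intros indefinite_integral_continuous_1 bounded_measurable_integrable[of c d])
       (auto intro: primitive_bounded_measurable)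
  then show ?thesis
    by (rule continuous_on_cong[THEN iffD1, rotated 2]) (auto intro: primitive_eq[OF assms, symmetric])
qed

lemma primitive_subset:
  assumes "primitive c d F f" "c \<le> c'" "d' \<le> d"
  shows "primitive c' d' F f"
  unfolding primitive_def
proof (intro conjI ballI)
  show "bounded_measurable c' d' f"
    using assms bounded_measurable_subset unfolding primitive_def by blast
  show "F x = F c' + integral {c'..x} f" if "x \<in> {c'..d'}" for x
    using primitive_diff[OF assms(1,2), of x] that assms(3) by simp
qed

lemma primitive_cong:
  assumes "\<And>x. x \<in> {c..d} \<Longrightarrow> F x = G x" "\<And>x. x \<in> {c..d} \<Longrightarrow> f x = g x"
  shows "primitive c d F f = primitive c d G g"
  unfolding primitive_def
proof (intro conj_cong bounded_measurable_cong ball_cong refl assms)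
  fix x assume x: "x \<in> {c..d}"
  have "integral {c..x} f = integral {c..x} g"
    using x assms by (intro integral_cong) auto
  then show "(F x = F c + integral {c..x} f) = (G x = G c + integral {c..x} g)"
    using x assms by auto
qed

lemma primitive_integral:
  "bounded_measurable c d f \<Longrightarrow> primitive c d (\<lambda>x. k + integral {c..x} f) f"
  by (auto simp: primitive_def)

lemma primitive_lipschitz:
  assumes "primitive c d F f"
  obtains M where "M \<ge> 0" "\<And>x. x \<in> {c..d} \<Longrightarrow> \<bar>f x\<bar> \<le> M"
    "\<And>s t. s \<in> {c..d} \<Longrightarrow> t \<in> {c..d} \<Longrightarrow> \<bar>F t - F s\<bar> \<le> M * \<bar>t - s\<bar>"
proof -
  obtain M where M: "M \<ge> 0" "\<And>x. x \<in> {c..d} \<Longrightarrow> \<bar>f x\<bar> \<le> M"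
    using bounded_measurable_bound[OF primitive_bounded_measurable[OF assms]] by blast
  have *: "\<bar>F t - F s\<bar> \<le> M * (t - s)" if "c \<le> s" "s \<le> t" "t \<le> d" for s t
    unfolding primitive_diff[OF assms that]
  proof (intro integral_bounded_measurable_bound M(2))
    show "bounded_measurable s t f"
      using bounded_measurable_subset[OF primitive_bounded_measurable[OF assms]] that by blast
  qed (use that in auto)
  show ?thesis
  proof (rule that[OF M])
    show "\<bar>F t - F s\<bar> \<le> M * \<bar>t - s\<bar>" if "s \<in> {c..d}" "t \<in> {c..d}" for s t
      using *[of s t] *[of t s] that by (cases "s \<le> t") (auto simp: abs_minus_commute)
  qed
qed

text \<open>
  The tool behind the calculus rules for primitives.  An error of order \<open>(t - s)\<^sup>2\<close> on every
  subinterval means that \<open>F\<close> minus the integral has derivative \<open>0\<close> at every point, hence is constant.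
  So a rule can be verified by freezing coefficients at an end point of a short interval, without
  differentiating anything almost everywhere.
\<close>

lemma primitive_if_quadratic_error:
  assumes f: "bounded_measurable c d f"
    and K: "\<And>s t. c \<le> s \<Longrightarrow> s \<le> t \<Longrightarrow> t \<le> d \<Longrightarrow> \<bar>F t - F s - integral {s..t} f\<bar> \<le> K * (t - s)\<^sup>2"
  shows "primitive c d F f"
proof -
  define G where "G = (\<lambda>x. F x - integral {c..x} f)"
  have G: "\<bar>G t - G s\<bar> \<le> K * (t - s)\<^sup>2" if "c \<le> s" "s \<le> t" "t \<le> d" for s t
  proof -
    have "integral {c..s} f + integral {s..t} f = integral {c..t} f"
      using that by (intro Henstock_Kurzweil_Integration.integral_combine
            bounded_measurable_integrable[OF f]) auto
    then have "G t - G s = F t - F s - integral {s..t} f" by (simp add: G_def)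
    then show ?thesis using K that by metis
  qed
  have "(G has_field_derivative 0) (at x within {c..d})" if x: "x \<in> {c..d}" for x
    unfolding has_field_derivative_iff
  proof (rule Lim_null_comparison)
    show "((\<lambda>y. K * \<bar>y - x\<bar>) \<longlongrightarrow> 0) (at x within {c..d})"
      by (rule tendsto_eq_intros refl | simp)+
    have "norm ((G y - G x) / (y - x)) \<le> K * \<bar>y - x\<bar>" if "y \<in> {c..d}" "y \<noteq> x" for y
    proof -
      have "\<bar>G y - G x\<bar> \<le> K * (y - x)\<^sup>2"
        using G[of x y] G[of y x] x that
        by (cases "x \<le> y") (auto simp: abs_minus_commute power2_commute)
      also have "\<dots> = K * \<bar>y - x\<bar> * \<bar>y - x\<bar>" by (simp add: power2_eq_square mult.assoc)
      finally show ?thesis using that by (simp add: abs_divide divide_le_eq)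
    qed
    then show "\<forall>\<^sub>F y in at x within {c..d}. norm ((G y - G x) / (y - x)) \<le> K * \<bar>y - x\<bar>"
      by (auto simp: eventually_at_filter)
  qed
  from has_field_derivative_zero_constant[OF _ this]
  obtain k where k: "\<And>x. x \<in> {c..d} \<Longrightarrow> G x = k" by auto
  have "F x = F c + integral {c..x} f" if "x \<in> {c..d}" for x
    using k[OF that] k[of c] that by (auto simp: G_def)
  with f show ?thesis unfolding primitive_def by blast
qed

lemma primitive_const: "primitive c d (\<lambda>_. k) (\<lambda>_. 0)"
  by (auto simp: primitive_def)

lemma primitive_add:
  assumes F: "primitive c d F f" and G: "primitive c d G g"
  shows "primitive c d (\<lambda>x. F x + G x) (\<lambda>x. f x + g x)"
proof -
  note bm = primitive_bounded_measurable[OF F] primitive_bounded_measurable[OF G]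
  have "F x + G x = F c + G c + integral {c..x} (\<lambda>x. f x + g x)" if "x \<in> {c..d}" for x
    using primitive_eq[OF F that] primitive_eq[OF G that] that
    by (subst Henstock_Kurzweil_Integration.integral_add)
       (auto intro!: bounded_measurable_integrable bm)
  then show ?thesis
    by (intro primitiveI bounded_measurable_add bm)
qed

lemma primitive_cmult:
  assumes F: "primitive c d F f"
  shows "primitive c d (\<lambda>x. k * F x) (\<lambda>x. k * f x)"
proof -
  have "k * F x = k * F c + integral {c..x} (\<lambda>x. k * f x)" if "x \<in> {c..d}" for x
    using primitive_eq[OF F that] by (simp add: distrib_left)
  then show ?thesis
    by (intro primitiveI bounded_measurable_intros primitive_bounded_measurable[OF F])
qed

lemma primitive_diff_fun:
  assumes "primitive c d F f" "primitive c d G g"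
  shows "primitive c d (\<lambda>x. F x - G x) (\<lambda>x. f x - g x)"
  using primitive_add[OF assms(1) primitive_cmult[OF assms(2), of "-1"]] by simp

text \<open>
  Freezing \<open>G\<close> at the right and \<open>F\<close> at the left end point makes the rule exact; as both functions
  are Lipschitz, unfreezing them costs \<open>O(t - s)\<close> under an integral of length \<open>t - s\<close>.
\<close>

lemma primitive_mult:
  assumes F: "primitive c d F f" and G: "primitive c d G g"
  shows "primitive c d (\<lambda>x. F x * G x) (\<lambda>x. f x * G x + F x * g x)"
proof -
  obtain M where M: "M \<ge> 0" "\<And>x. x \<in> {c..d} \<Longrightarrow> \<bar>f x\<bar> \<le> M"
    "\<And>s t. s \<in> {c..d} \<Longrightarrow> t \<in> {c..d} \<Longrightarrow> \<bar>F t - F s\<bar> \<le> M * \<bar>t - s\<bar>"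
    using primitive_lipschitz[OF F] by blast
  obtain N where N: "N \<ge> 0" "\<And>x. x \<in> {c..d} \<Longrightarrow> \<bar>g x\<bar> \<le> N"
    "\<And>s t. s \<in> {c..d} \<Longrightarrow> t \<in> {c..d} \<Longrightarrow> \<bar>G t - G s\<bar> \<le> N * \<bar>t - s\<bar>"
    using primitive_lipschitz[OF G] by blast
  have f: "bounded_measurable c d f" and g: "bounded_measurable c d g"
    using F G by (auto intro: primitive_bounded_measurable)
  have cF: "bounded_measurable c d F" and cG: "bounded_measurable c d G"
    using F G by (auto intro: bounded_measurable_continuous primitive_continuous_on)
  show ?thesis
  proof (rule primitive_if_quadratic_error)
    show bm: "bounded_measurable c d (\<lambda>x. f x * G x + F x * g x)"
      by (intro bounded_measurable_intros f g cF cG)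
    fix s t assume st: "c \<le> s" "s \<le> t" "t \<le> d"
    then have sub: "{s..t} \<subseteq> {c..d}" by auto
    \<comment> \<open>the error made by freezing the coefficients\<close>
    let ?e = "\<lambda>x. f x * (G t - G x) + (F s - F x) * g x"
    have bme: "bounded_measurable c d ?e"
      by (intro bounded_measurable_intros f g cF cG)
    have "integral {s..t} (\<lambda>x. f x * G x + F x * g x) + integral {s..t} ?e
        = integral {s..t} (\<lambda>x. G t * f x + F s * g x)"
      unfolding Henstock_Kurzweil_Integration.integral_add[OF bounded_measurable_integrable[OF bm sub]
          bounded_measurable_integrable[OF bme sub], symmetric]
      by (intro Henstock_Kurzweil_Integration.integral_cong) (simp add: algebra_simps)
    also have "\<dots> = G t * integral {s..t} f + F s * integral {s..t} g"
      using bounded_measurable_integrable[OF f sub] bounded_measurable_integrable[OF g sub]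
      by (subst Henstock_Kurzweil_Integration.integral_add) (auto intro: integrable_on_mult_right)
    also have "\<dots> = G t * (F t - F s) + F s * (G t - G s)"
      using primitive_diff[OF F st] primitive_diff[OF G st] by simp
    finally have "F t * G t - F s * G s - integral {s..t} (\<lambda>x. f x * G x + F x * g x) = integral {s..t} ?e"
      by (simp add: algebra_simps)
    also have "\<bar>\<dots>\<bar> \<le> (2 * M * N * (t - s)) * (t - s)"
    proof (intro integral_bounded_measurable_bound)
      show "bounded_measurable s t ?e" using bme st bounded_measurable_subset by blast
      fix x assume x: "x \<in> {s..t}"
      have "\<bar>f x * (G t - G x)\<bar> \<le> M * (N * (t - s))"
        unfolding abs_mult
        using N(3)[of x t] M(2)[of x] x st M(1) N(1)
        by (intro mult_mono order.trans[OF N(3)]) (auto intro!: mult_left_mono)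
      moreover have "\<bar>(F s - F x) * g x\<bar> \<le> (M * (t - s)) * N"
        unfolding abs_mult
        using N(2)[of x] x st M(1) N(1)
        by (intro mult_mono order.trans[OF M(3)]) (auto intro!: mult_left_mono)
      ultimately have "\<bar>?e x\<bar> \<le> M * (N * (t - s)) + M * (t - s) * N"
        by (intro order.trans[OF abs_triangle_ineq add_mono])
      also have "\<dots> = 2 * M * N * (t - s)" by (simp add: algebra_simps)
      finally show "\<bar>?e x\<bar> \<le> 2 * M * N * (t - s)" .
    qed (use st in auto)
    finally show "\<bar>F t * G t - F s * G s - integral {s..t} (\<lambda>x. f x * G x + F x * g x)\<bar> \<le> (2 * M * N) * (t - s)\<^sup>2"
      by (simp add: power2_eq_square mult_ac)
  qed
qed

text \<open>
  The mean value theorem gives the increment of \<open>H \<circ> F\<close> with \<open>H'\<close> frozen at an intermediate value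
  \<open>z\<close>; since \<open>H'\<close> is Lipschitz on the range of \<open>F\<close>, replacing \<open>H' z\<close> by \<open>H' (F x)\<close> is again a
  quadratic error.
\<close>

lemma primitive_chain:
  assumes F: "primitive c d F f"
    and H: "\<And>x. (H has_real_derivative H' x) (at x)" and H': "\<And>x. (H' has_real_derivative H'' x) (at x)"
    and "continuous_on UNIV H''"
  shows "primitive c d (\<lambda>x. H (F x)) (\<lambda>x. H' (F x) * f x)"
proof -
  obtain M where M: "M \<ge> 0" "\<And>x. x \<in> {c..d} \<Longrightarrow> \<bar>f x\<bar> \<le> M"
    "\<And>s t. s \<in> {c..d} \<Longrightarrow> t \<in> {c..d} \<Longrightarrow> \<bar>F t - F s\<bar> \<le> M * \<bar>t - s\<bar>"
    using primitive_lipschitz[OF F] by blast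
  have f: "bounded_measurable c d f" using F by (rule primitive_bounded_measurable)
  have contF: "continuous_on {c..d} F" by (rule primitive_continuous_on[OF F])
  have contH': "continuous_on UNIV H'"
    using H' by (auto intro!: continuous_at_imp_continuous_on DERIV_isCont)
  have bmH': "bounded_measurable c d (\<lambda>x. H' (F x))"
    by (intro bounded_measurable_continuous continuous_on_compose2[OF contH' contF]) auto
  obtain B where B: "\<And>x. x \<in> {c..d} \<Longrightarrow> \<bar>F x\<bar> \<le> B"
    using bounded_measurable_bound[OF bounded_measurable_continuous[OF contF]] by blast
  obtain K0 where K0: "\<And>x. x \<in> {-B..B} \<Longrightarrow> \<bar>H'' x\<bar> \<le> K0"
    using bounded_measurable_bound[OF bounded_measurable_continuous[OF continuous_on_subset[OF assms(4) subset_UNIV]]]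
    by blast
  define K where "K = max 0 K0"
  have K: "K \<ge> 0" "\<And>x. x \<in> {-B..B} \<Longrightarrow> \<bar>H'' x\<bar> \<le> K"
    using K0 by (auto simp: K_def intro: max.coboundedI2)
  have LipH': "\<bar>H' y - H' x\<bar> \<le> K * \<bar>y - x\<bar>" if "x \<in> {-B..B}" "y \<in> {-B..B}" for x y
    using field_differentiable_bound[of "{-B..B}" H' H'' K y x] H' K that
    by (auto intro: has_field_derivative_at_within)
  have between: "\<exists>z. (z \<in> {min x y..max x y}) \<and> H y - H x = H' z * (y - x)" for x y
  proof (cases x y rule: linorder_cases)
    case less
    then obtain z where "z > x" "z < y" "H y - H x = (y - x) * H' z"
      using MVT2[of x y H H'] H by auto
    then show ?thesis by (intro exI[of _ z]) (auto simp: mult.commute)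
  next
    case equal then show ?thesis by (intro exI[of _ x]) auto
  next
    case greater
    then obtain z where "z > y" "z < x" "H x - H y = (x - y) * H' z"
      using MVT2[of y x H H'] H by auto
    then show ?thesis by (intro exI[of _ z]) (auto simp: algebra_simps)
  qed
  show ?thesis
  proof (rule primitive_if_quadratic_error)
    show bm: "bounded_measurable c d (\<lambda>x. H' (F x) * f x)"
      by (intro bounded_measurable_intros f bmH')
    fix s t assume st: "c \<le> s" "s \<le> t" "t \<le> d"
    then have sub: "{s..t} \<subseteq> {c..d}" by auto
    obtain z where z: "z \<in> {min (F s) (F t)..max (F s) (F t)}" 
      "H (F t) - H (F s) = H' z * (F t - F s)" using between by blast
    have zB: "z \<in> {-B..B}" using z(1) B[of s] B[of t] st by (auto simp: min_def max_def split: if_splits)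
    \<comment> \<open>the error made by freezing \<open>H'\<close>\<close>
    let ?e = "\<lambda>x. (H' z - H' (F x)) * f x"
    have bme: "bounded_measurable c d ?e"
      by (intro bounded_measurable_intros f bmH')
    have "integral {s..t} (\<lambda>x. H' (F x) * f x) + integral {s..t} ?e
        = integral {s..t} (\<lambda>x. H' z * f x)"
      unfolding Henstock_Kurzweil_Integration.integral_add[OF bounded_measurable_integrable[OF bm sub]
          bounded_measurable_integrable[OF bme sub], symmetric]
      by (intro Henstock_Kurzweil_Integration.integral_cong) (simp add: algebra_simps)
    also have "\<dots> = H (F t) - H (F s)"
      using primitive_diff[OF F st] z by simp
    finally have "H (F t) - H (F s) - integral {s..t} (\<lambda>x. H' (F x) * f x) = integral {s..t} ?e"
      by (simp add: algebra_simps)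
    also have "\<bar>\<dots>\<bar> \<le> (K * (2 * M * (t - s)) * M) * (t - s)"
    proof (intro integral_bounded_measurable_bound)
      show "bounded_measurable s t ?e" using bme st bounded_measurable_subset by blast
      fix x assume x: "x \<in> {s..t}"
      have "\<bar>z - F x\<bar> \<le> \<bar>F t - F x\<bar> + \<bar>F s - F x\<bar>" using z(1) by (auto simp: min_def max_def split: if_splits)
      also have "\<dots> \<le> M * \<bar>t - x\<bar> + M * \<bar>s - x\<bar>"
        using x st by (intro add_mono M(3)) auto
      also have "\<dots> \<le> M * (t - s) + M * (t - s)"
        using x st M(1) by (intro add_mono mult_left_mono) auto
      finally have "\<bar>z - F x\<bar> \<le> 2 * M * (t - s)" by simp
      moreover have "\<bar>H' z - H' (F x)\<bar> \<le> K * \<bar>z - F x\<bar>"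
        using zB B[of x] x st by (intro LipH') (auto simp: abs_le_iff)
      ultimately have "\<bar>H' z - H' (F x)\<bar> \<le> K * (2 * M * (t - s))"
        using K(1) by (meson mult_left_mono order.trans)
      then show "\<bar>?e x\<bar> \<le> K * (2 * M * (t - s)) * M"
        unfolding abs_mult using M(1) K(1) x st by (intro mult_mono M(2)) auto
    qed (use st in auto)
    finally show "\<bar>H (F t) - H (F s) - integral {s..t} (\<lambda>x. H' (F x) * f x)\<bar> \<le> (2 * K * M * M) * (t - s)\<^sup>2"
      by (simp add: power2_eq_square mult_ac)
  qed
qed

lemma primitive_sin: "primitive c d F f \<Longrightarrow> primitive c d (\<lambda>x. sin (F x)) (\<lambda>x. cos (F x) * f x)"
  by (rule primitive_chain[where H'' = "\<lambda>x. - sin x"])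
     (auto intro!: derivative_eq_intros continuous_intros)

lemma primitive_cos: "primitive c d F f \<Longrightarrow> primitive c d (\<lambda>x. cos (F x)) (\<lambda>x. - sin (F x) * f x)"
  by (rule primitive_chain[where H'' = "\<lambda>x. - cos x"])
     (auto intro!: derivative_eq_intros continuous_intros)

lemma primitive_exp: "primitive c d F f \<Longrightarrow> primitive c d (\<lambda>x. exp (F x)) (\<lambda>x. exp (F x) * f x)"
  by (rule primitive_chain[where H'' = exp])
     (auto intro!: derivative_eq_intros continuous_intros)

section \<open>Scalar differential equations with measurable coefficients\<close>

text \<open>
  Variation of constants.  All uniqueness, comparison and continuity statements for the angle below
  are instances: the sign or size of the inhomogeneity \<open>h\<close> is read off the integral.
\<close>

lemma primitive_linear_ode:
  assumes F: "primitive c d F f" and m: "bounded_measurable c d m" and h: "bounded_measurable c d h"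
    and eq: "\<And>x. x \<in> {c..d} \<Longrightarrow> f x = m x * F x + h x" and x: "x \<in> {c..d}"
  shows "F x * exp (- integral {c..x} m) = F c + integral {c..x} (\<lambda>t. h t * exp (- integral {c..t} m))"
proof -
  let ?E = "\<lambda>x. exp (- integral {c..x} m)"
  have "primitive c d (\<lambda>x. - 1 * (0 + integral {c..x} m)) (\<lambda>x. -1 * m x)"
    by (intro primitive_cmult primitive_integral m)
  then have "primitive c d ?E (\<lambda>x. ?E x * - m x)"
    using primitive_exp by fastforce
  from primitive_mult[OF F this]
  have "primitive c d (\<lambda>x. F x * ?E x) (\<lambda>x. h x * ?E x)"
    by (rule primitive_cong[THEN iffD1, rotated 2]) (simp_all add: eq algebra_simps)
  from primitive_eq[OF this x] show ?thesis by simp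
qed

text \<open>
  Banach's fixed point theorem for the integral equation, in the unknown
  \<open>h t = exp (- k * (t - c)) * \<theta> t\<close>.  The exponential weight with \<open>k = 2 * L\<close> makes the integral
  operator a contraction with factor \<open>1 / 2\<close> on an interval of any length.  The argument is clamped
  to \<open>{c..d}\<close> so that \<open>h\<close> is a bounded continuous function on the whole line.
\<close>

lemma ode_solution_exists:
  fixes f :: "real \<Rightarrow> real \<Rightarrow> real"
  assumes cd: "c \<le> d" and L: "L > 0"
    and lip: "\<And>t x y. t \<in> {c..d} \<Longrightarrow> \<bar>f t x - f t y\<bar> \<le> L * \<bar>x - y\<bar>"
    and meas: "\<And>g. continuous_on {c..d} g \<Longrightarrow> bounded_measurable c d (\<lambda>t. f t (g t))"
  obtains \<theta> where "\<theta> c = \<theta>0" "primitive c d \<theta> (\<lambda>t. f t (\<theta> t))"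
proof -
  define k where "k = 2 * L"
  have k: "k > 0" using L by (simp add: k_def)
  define clamp where "clamp = (\<lambda>x. max c (min d x))"
  have clamp: "clamp x \<in> {c..d}" for x using cd by (auto simp: clamp_def)
  have clamp_id: "clamp x = x" if "x \<in> {c..d}" for x using that by (auto simp: clamp_def)
  define N where "N = (\<lambda>h s. exp (- k * (s - c)) * (\<theta>0 + integral {c..s} (\<lambda>t. f t (exp (k * (t - c)) * h t))))"
  define T where "T = (\<lambda>h. Bcontfun (\<lambda>x. N (apply_bcontfun h) (clamp x)))"
  have bm: "bounded_measurable c d (\<lambda>t. f t (exp (k * (t - c)) * apply_bcontfun h t))" for h
    by (intro meas continuous_intros continuous_on_apply_bcontfun)
  have contN: "continuous_on {c..d} (N (apply_bcontfun h))" for h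
    unfolding N_def
    by (intro continuous_intros indefinite_integral_continuous_1 bounded_measurable_integrable[OF bm]) auto
  have "continuous_on UNIV clamp" unfolding clamp_def by (intro continuous_intros)
  then have cont: "continuous_on UNIV (\<lambda>x. N (apply_bcontfun h) (clamp x))" for h
    using clamp by (intro continuous_on_compose2[OF contN]) auto
  have "bounded (range (\<lambda>x. N (apply_bcontfun h) (clamp x)))" for h
    using compact_imp_bounded[OF compact_continuous_image[OF contN compact_Icc]]
    by (rule bounded_subset) (use clamp in auto)
  with cont have T: "apply_bcontfun (T h) x = N (apply_bcontfun h) (clamp x)" for h x
    unfolding T_def by (subst Bcontfun_inverse) (auto simp: bcontfun_def)
  have contraction: "dist (T h1) (T h2) \<le> 1 / 2 * dist h1 h2" for h1 h2
  proof (rule dist_bound)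
    fix x
    define s where "s = clamp x"
    have s: "s \<in> {c..d}" using clamp s_def by simp
    then have sub: "{c..s} \<subseteq> {c..d}" by auto
    let ?f = "\<lambda>h t. f t (exp (k * (t - c)) * apply_bcontfun h t)"
    let ?D = "dist h1 h2"
    have int: "?f h integrable_on {c..s}" for h
      by (rule bounded_measurable_integrable[OF bm sub])
    have hi: "((\<lambda>t. L * ?D * exp (k * (t - c))) has_integral
        (L * ?D / k * exp (k * (s - c)) - L * ?D / k * exp (k * (c - c)))) {c..s}"
      using s k
      by (intro fundamental_theorem_of_calculus)
         (auto intro!: derivative_eq_intros simp flip: has_real_derivative_iff_has_vector_derivative)
    have "\<bar>integral {c..s} (?f h1) - integral {c..s} (?f h2)\<bar> = norm (integral {c..s} (\<lambda>t. ?f h1 t - ?f h2 t))"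
      by (simp add: Henstock_Kurzweil_Integration.integral_diff[OF int int])
    also have "\<dots> \<le> integral {c..s} (\<lambda>t. L * ?D * exp (k * (t - c)))"
    proof (rule integral_norm_bound_integral)
      fix t assume t: "t \<in> {c..s}"
      have "\<bar>?f h1 t - ?f h2 t\<bar> \<le> L * \<bar>exp (k * (t - c)) * apply_bcontfun h1 t - exp (k * (t - c)) * apply_bcontfun h2 t\<bar>"
        using t sub by (intro lip) auto
      also have "\<dots> = L * (exp (k * (t - c)) * dist (apply_bcontfun h1 t) (apply_bcontfun h2 t))"
        by (simp add: dist_real_def abs_mult flip: right_diff_distrib)
      also have "\<dots> \<le> L * (exp (k * (t - c)) * ?D)"
        using L by (intro mult_left_mono dist_bounded) auto
      finally show "norm (?f h1 t - ?f h2 t) \<le> L * ?D * exp (k * (t - c))" by (simp add: mult_ac)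
    qed (use hi int in \<open>auto intro: Henstock_Kurzweil_Integration.integrable_diff has_integral_integrable\<close>)
    also have "\<dots> = L * ?D / k * exp (k * (s - c)) - L * ?D / k"
      unfolding integral_unique[OF hi] by simp
    also have "\<dots> \<le> L * ?D / k * exp (k * (s - c))" using L k by simp
    finally have *: "\<bar>integral {c..s} (?f h1) - integral {c..s} (?f h2)\<bar> \<le> L * ?D / k * exp (k * (s - c))" .
    have "dist (apply_bcontfun (T h1) x) (apply_bcontfun (T h2) x)
        = exp (- k * (s - c)) * \<bar>integral {c..s} (?f h1) - integral {c..s} (?f h2)\<bar>"
      unfolding T N_def s_def[symmetric] dist_real_def right_diff_distrib[symmetric] abs_mult by simp
    also have "\<dots> \<le> exp (- k * (s - c)) * (L * ?D / k * exp (k * (s - c)))"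
      using * by (intro mult_left_mono) auto
    also have "\<dots> = 1 / 2 * ?D" using L by (simp add: k_def exp_minus)
    finally show "dist (apply_bcontfun (T h1) x) (apply_bcontfun (T h2) x) \<le> 1 / 2 * ?D" .
  qed
  have "\<exists>!h. T h = h"
    using contraction by (intro banach_fix_type[of "1/2"]) auto
  then obtain h where h: "T h = h" by blast
  define \<theta> where "\<theta> = (\<lambda>t. exp (k * (t - c)) * apply_bcontfun h t)"
  have eq: "\<theta> x = \<theta>0 + integral {c..x} (\<lambda>t. f t (\<theta> t))" if "x \<in> {c..d}" for x
  proof -
    have "apply_bcontfun h x = N (apply_bcontfun h) x" using T[of h x] h clamp_id[OF that] by simp
    then show ?thesis by (simp add: \<theta>_def N_def exp_minus)
  qed
  show ?thesis
  proof (rule that)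
    show c: "\<theta> c = \<theta>0" using eq[of c] cd by simp
    show "primitive c d \<theta> (\<lambda>t. f t (\<theta> t))"
      using eq c bm[of h] by (intro primitiveI) (auto simp: \<theta>_def)
  qed
qed

section \<open>The Pruefer angle of a planar linear system\<close>

text \<open>
  A solution of the planar system \<open>U' = A P\<close>, \<open>P' = - B U\<close>, written as
  \<open>U = \<rho> sin \<theta>\<close>, \<open>P = \<rho> cos \<theta>\<close>, has a Pruefer angle \<open>\<theta>\<close> that solves the scalar equation
  \<open>\<theta>' = A cos\<^sup>2 \<theta> + B sin\<^sup>2 \<theta>\<close>.  The case \<open>A = 1\<close>, \<open>B = l - q\<close> is the equation
  \<open>- u'' + q u = l u\<close>; the case \<open>A = 0\<close>, \<open>B = - \<sigma>\<close> on the unit interval turns out to be a point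
  interaction of strength \<open>\<sigma>\<close>.  Treating both as one system means that monotonicity, continuity and
  shift invariance are proved once.
\<close>

definition angular_velocity :: "(real \<Rightarrow> real) \<Rightarrow> (real \<Rightarrow> real) \<Rightarrow> (real \<Rightarrow> real) \<Rightarrow> real \<Rightarrow> real" where
  "angular_velocity A B \<theta> t = A t * (cos (\<theta> t))\<^sup>2 + B t * (sin (\<theta> t))\<^sup>2"

definition prufer_flow :: "(real \<Rightarrow> real) \<Rightarrow> (real \<Rightarrow> real) \<Rightarrow> real \<Rightarrow> real \<Rightarrow> real \<Rightarrow> real" where
  "prufer_flow A B c d \<theta>0 =
     (THE y. \<exists>\<theta>. \<theta> c = \<theta>0 \<and> \<theta> d = y \<and> primitive c d \<theta> (angular_velocity A B \<theta>))"

lemma angular_velocity_diff: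
  "angular_velocity A B \<theta>2 t - angular_velocity A B \<theta>1 t
     = (B t - A t) * sin (\<theta>2 t - \<theta>1 t) * sin (\<theta>1 t + \<theta>2 t)"
proof -
  have "sin (\<theta>2 t - \<theta>1 t) * sin (\<theta>1 t + \<theta>2 t) = (sin (\<theta>2 t))\<^sup>2 - (sin (\<theta>1 t))\<^sup>2"
    unfolding sin_add sin_diff by (simp add: algebra_simps cos_squared_eq flip: power2_eq_square power_mult_distrib)
       (simp add: power_mult_distrib cos_squared_eq algebra_simps)
  then have "(B t - A t) * (sin (\<theta>2 t - \<theta>1 t) * sin (\<theta>1 t + \<theta>2 t))
      = (B t - A t) * ((sin (\<theta>2 t))\<^sup>2 - (sin (\<theta>1 t))\<^sup>2)" by simp
  then show ?thesis by (simp add: angular_velocity_def cos_squared_eq algebra_simps)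
qed

lemma bounded_measurable_angular_velocity:
  assumes "bounded_measurable c d A" "bounded_measurable c d B" "continuous_on {c..d} \<theta>"
  shows "bounded_measurable c d (angular_velocity A B \<theta>)"
  unfolding angular_velocity_def[abs_def]
  by (intro bounded_measurable_intros assms bounded_measurable_continuous continuous_intros)

text \<open>
  The angular velocity depends on \<open>\<theta>\<close> through \<open>sin\<^sup>2 \<theta>\<close>, so the difference of two angles satisfies a
  linear equation whose coefficient contains \<open>sin (\<theta>2 - \<theta>1) / (\<theta>2 - \<theta>1)\<close> and is bounded by \<open>K\<close>.  The
  positive factor \<open>E\<close> is the integrating factor of that equation.  The additional term \<open>h\<close>
  accommodates different coefficients \<open>B\<close> and constant angles used as barriers.
\<close>

lemma primitive_angle_difference:
  assumes A: "bounded_measurable c d A" and B: "bounded_measurable c d B" and h: "bounded_measurable c d h"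
    and \<theta>1: "primitive c d \<theta>1 g1" and \<theta>2: "primitive c d \<theta>2 g2"
    and eq: "\<And>x. x \<in> {c..d} \<Longrightarrow>
      g2 x - g1 x = angular_velocity A B \<theta>2 x - angular_velocity A B \<theta>1 x + h x"
    and K: "\<And>x. x \<in> {c..d} \<Longrightarrow> \<bar>B x - A x\<bar> \<le> K"
  obtains E where "continuous_on {c..d} E"
    "\<And>x. x \<in> {c..d} \<Longrightarrow> exp (- K * (x - c)) \<le> E x \<and> E x \<le> exp (K * (x - c))"
    "\<And>x. x \<in> {c..d} \<Longrightarrow> (\<theta>2 x - \<theta>1 x) * E x = \<theta>2 c - \<theta>1 c + integral {c..x} (\<lambda>t. h t * E t)"
proof -
  \<comment> \<open>At coincident angles the quotient is \<open>0 / 0 = 0\<close>; the product with \<open>\<theta>2 - \<theta>1 = 0\<close> is still right.\<close>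
  define m where "m = (\<lambda>x. (B x - A x) * (sin (\<theta>2 x - \<theta>1 x) / (\<theta>2 x - \<theta>1 x)) * sin (\<theta>1 x + \<theta>2 x))"
  have c1: "continuous_on {c..d} \<theta>1" and c2: "continuous_on {c..d} \<theta>2"
    using \<theta>1 \<theta>2 by (auto intro: primitive_continuous_on)
  have sinc: "\<bar>sin y / y\<bar> \<le> 1" for y :: real
    using abs_sin_x_le_abs_x[of y] by (simp add: abs_divide divide_le_eq)
  have "bounded_measurable c d (\<lambda>x. sin (\<theta>2 x - \<theta>1 x) / (\<theta>2 x - \<theta>1 x))"
    by (rule bounded_measurable_compose[where h = "\<lambda>y. sin y / y" and K = 1])
       (auto intro!: bounded_measurable_continuous continuous_intros c1 c2 simp del: abs_divide simp: sinc)
  then have m: "bounded_measurable c d m"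
    unfolding m_def
    by (intro bounded_measurable_intros A B) (auto intro!: bounded_measurable_continuous continuous_intros c1 c2)
  have mK: "\<bar>m x\<bar> \<le> K" if "x \<in> {c..d}" for x
  proof -
    have "\<bar>m x\<bar> \<le> K * 1 * 1"
      unfolding m_def abs_mult using K[OF that] sinc by (intro mult_mono) (auto intro: order.trans[OF abs_ge_zero])
    then show ?thesis by simp
  qed
  have intK: "\<bar>integral {c..x} m\<bar> \<le> K * (x - c)" if "x \<in> {c..d}" for x
    using bounded_measurable_subset[OF m order_refl, of x] mK that
    by (intro integral_bounded_measurable_bound) auto
  let ?E = "\<lambda>x. exp (- integral {c..x} m)"
  show ?thesis
  proof (rule that)
    show "continuous_on {c..d} ?E"
      by (intro continuous_intros indefinite_integral_continuous_1 bounded_measurable_integrable[OF m]) auto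
    show "exp (- K * (x - c)) \<le> ?E x \<and> ?E x \<le> exp (K * (x - c))" if "x \<in> {c..d}" for x
      using intK[OF that] by auto
    show "(\<theta>2 x - \<theta>1 x) * ?E x = \<theta>2 c - \<theta>1 c + integral {c..x} (\<lambda>t. h t * ?E t)" if "x \<in> {c..d}" for x
    proof (rule primitive_linear_ode[OF primitive_diff_fun[OF \<theta>2 \<theta>1] m h _ that])
      show "g2 y - g1 y = m y * (\<theta>2 y - \<theta>1 y) + h y" if "y \<in> {c..d}" for y
        unfolding eq[OF that] angular_velocity_diff m_def by simp
    qed
  qed
qed

locale prufer_system =
  fixes A B :: "real \<Rightarrow> real" and c d :: real
  assumes A: "bounded_measurable c d A" and B: "bounded_measurable c d B" and cd: "c \<le> d"
begin

text \<open>
  Flows over adjacent intervals are composed, so most facts are needed on subintervals as well.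
\<close>

lemma subsystem: "c \<le> c' \<Longrightarrow> c' \<le> d' \<Longrightarrow> d' \<le> d \<Longrightarrow> prufer_system A B c' d'"
  using A B by unfold_locales (auto intro: bounded_measurable_subset)

lemma bound:
  obtains K where "K \<ge> 0" "\<And>x. x \<in> {c..d} \<Longrightarrow> \<bar>B x - A x\<bar> \<le> K"
  using bounded_measurable_bound[OF bounded_measurable_diff[OF B A]] by blast

lemma solution_exists:
  obtains \<theta> where "\<theta> c = \<theta>0" "primitive c d \<theta> (angular_velocity A B \<theta>)"
proof -
  obtain K where K: "K \<ge> 0" "\<And>x. x \<in> {c..d} \<Longrightarrow> \<bar>B x - A x\<bar> \<le> K" using bound by blast
  have "\<bar>angular_velocity A B (\<lambda>_. x) t - angular_velocity A B (\<lambda>_. y) t\<bar> \<le> (K + 1) * \<bar>x - y\<bar>"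
    if "t \<in> {c..d}" for t x y
  proof -
    have "\<bar>angular_velocity A B (\<lambda>_. x) t - angular_velocity A B (\<lambda>_. y) t\<bar> \<le> (K + 1) * \<bar>x - y\<bar> * 1"
      unfolding angular_velocity_diff abs_mult using K(1) K(2)[OF that]
      by (intro mult_mono abs_sin_x_le_abs_x) (auto intro!: mult_nonneg_nonneg)
    then show ?thesis by simp
  qed
  note lip = this
  have eq: "angular_velocity A B (\<lambda>_. g t) t = angular_velocity A B g t" for g t
    by (simp add: angular_velocity_def)
  show ?thesis
  proof (rule ode_solution_exists[OF cd])
    show "0 < K + 1" using K(1) by simp
    show "\<bar>angular_velocity A B (\<lambda>_. x) t - angular_velocity A B (\<lambda>_. y) t\<bar> \<le> (K + 1) * \<bar>x - y\<bar>"
      if "t \<in> {c..d}" for t x y using lip[OF that] .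
    show "bounded_measurable c d (\<lambda>t. angular_velocity A B (\<lambda>_. g t) t)" if "continuous_on {c..d} g" for g
      unfolding eq using bounded_measurable_angular_velocity[OF A B that] .
    show thesis if "\<theta> c = \<theta>0" "primitive c d \<theta> (\<lambda>t. angular_velocity A B (\<lambda>_. \<theta> t) t)" for \<theta>
      using that \<open>\<And>\<theta>. \<theta> c = \<theta>0 \<Longrightarrow> primitive c d \<theta> (angular_velocity A B \<theta>) \<Longrightarrow> thesis\<close>
      unfolding eq by blast
  qed
qed

lemma solution_unique:
  assumes "primitive c d \<theta>1 (angular_velocity A B \<theta>1)" "primitive c d \<theta>2 (angular_velocity A B \<theta>2)"
    "\<theta>1 c = \<theta>2 c" "x \<in> {c..d}"
  shows "\<theta>1 x = \<theta>2 x"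
proof -
  obtain K where K: "K \<ge> 0" "\<And>x. x \<in> {c..d} \<Longrightarrow> \<bar>B x - A x\<bar> \<le> K" using bound by blast
  have "bounded_measurable c d (\<lambda>_. 0)" by (rule bounded_measurable_const)
  then show ?thesis
  proof (rule primitive_angle_difference[OF A B _ assms(1,2) _ K(2)])
    fix E
    assume *: "\<And>x. x \<in> {c..d} \<Longrightarrow> exp (- K * (x - c)) \<le> E x \<and> E x \<le> exp (K * (x - c))"
      "\<And>x. x \<in> {c..d} \<Longrightarrow> (\<theta>2 x - \<theta>1 x) * E x = \<theta>2 c - \<theta>1 c + integral {c..x} (\<lambda>t. 0 * E t)"
    have "E x > 0" using *(1)[OF assms(4)] by (auto intro: less_le_trans[OF exp_gt_zero])
    moreover have "(\<theta>2 x - \<theta>1 x) * E x = 0" using *(2)[OF assms(4)] assms(3) by simp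
    ultimately show "\<theta>1 x = \<theta>2 x" by simp
  qed simp_all
qed

lemma flow_eqI:
  assumes "primitive c d \<theta> (angular_velocity A B \<theta>)"
  shows "prufer_flow A B c d (\<theta> c) = \<theta> d"
  unfolding prufer_flow_def
proof (rule the_equality)
  show "y = \<theta> d" if "\<exists>\<theta>'. \<theta>' c = \<theta> c \<and> \<theta>' d = y \<and> primitive c d \<theta>' (angular_velocity A B \<theta>')" for y
    using that solution_unique[OF assms, of _ d] cd by auto
qed (use assms in auto)

lemma flow_solution:
  assumes "primitive c d \<theta> (angular_velocity A B \<theta>)" "x \<in> {c..d}"
  shows "prufer_flow A B c x (\<theta> c) = \<theta> x"
proof -
  interpret s: prufer_system A B c x using assms(2) by (intro subsystem) auto
  show ?thesis by (rule s.flow_eqI) (use assms in \<open>auto intro: primitive_subset\<close>)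
qed

lemma flow_primitive:
  "primitive c d (\<lambda>x. prufer_flow A B c x \<theta>0) (angular_velocity A B (\<lambda>x. prufer_flow A B c x \<theta>0))"
proof -
  obtain \<theta> where \<theta>: "\<theta> c = \<theta>0" "primitive c d \<theta> (angular_velocity A B \<theta>)" using solution_exists .
  have eq: "prufer_flow A B c x \<theta>0 = \<theta> x" if "x \<in> {c..d}" for x
    using flow_solution[OF \<theta>(2) that] \<theta>(1) by simp
  show ?thesis
    by (rule primitive_cong[THEN iffD1, OF _ _ \<theta>(2)]) (auto simp: eq angular_velocity_def)
qed

lemma flow_start [simp]: "prufer_flow A B c c \<theta>0 = \<theta>0"
proof -
  obtain \<theta> where \<theta>: "\<theta> c = \<theta>0" "primitive c d \<theta> (angular_velocity A B \<theta>)" using solution_exists .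
  show ?thesis using flow_solution[OF \<theta>(2), of c] \<theta>(1) cd by simp
qed

lemma flow_continuous_on: "continuous_on {c..d} (\<lambda>x. prufer_flow A B c x \<theta>0)"
  by (rule primitive_continuous_on[OF flow_primitive])

lemma flow_compose:
  assumes "e \<in> {c..d}"
  shows "prufer_flow A B e d (prufer_flow A B c e \<theta>0) = prufer_flow A B c d \<theta>0"
proof -
  interpret s: prufer_system A B e d using assms by (intro subsystem) auto
  show ?thesis
    by (rule s.flow_eqI) (use assms in \<open>auto intro: primitive_subset[OF flow_primitive]\<close>)
qed

text \<open>
  The velocity is \<open>\<pi>\<close>-periodic in the angle: \<open>(U, P)\<close> and \<open>(- U, - P)\<close> satisfy the same system.
\<close>

lemma flow_shift: "prufer_flow A B c d (\<theta>0 + of_int k * pi) = prufer_flow A B c d \<theta>0 + of_int k * pi"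
proof -
  let ?\<theta> = "\<lambda>x. prufer_flow A B c x \<theta>0"
  have "(cos (x + of_int k * pi))\<^sup>2 = (cos x)\<^sup>2 \<and> (sin (x + of_int k * pi))\<^sup>2 = (sin x)\<^sup>2" for x
  proof -
    have s: "sin (of_int k * pi) = 0" by (auto simp: sin_zero_iff_int2)
    then have "(cos (of_int k * pi))\<^sup>2 = 1" by (simp add: cos_squared_eq)
    then show ?thesis by (simp add: cos_add sin_add s power_mult_distrib)
  qed
  then have "angular_velocity A B (\<lambda>x. ?\<theta> x + of_int k * pi) t = angular_velocity A B ?\<theta> t" for t
    by (simp add: angular_velocity_def)
  then have "primitive c d (\<lambda>x. ?\<theta> x + of_int k * pi) (angular_velocity A B (\<lambda>x. ?\<theta> x + of_int k * pi))"
    using primitive_add[OF flow_primitive primitive_const] by (auto cong: primitive_cong)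
  from flow_eqI[OF this] show ?thesis by simp
qed

lemma flow_difference:
  assumes B': "bounded_measurable c d B'"
    and K: "\<And>x. x \<in> {c..d} \<Longrightarrow> \<bar>B x - A x\<bar> \<le> K"
  obtains E where "continuous_on {c..d} E"
    "\<And>x. x \<in> {c..d} \<Longrightarrow> exp (- K * (x - c)) \<le> E x \<and> E x \<le> exp (K * (x - c))"
    "\<And>x. x \<in> {c..d} \<Longrightarrow> (prufer_flow A B' c x \<theta>' - prufer_flow A B c x \<theta>) * E x
       = \<theta>' - \<theta> + integral {c..x} (\<lambda>t. (B' t - B t) * (sin (prufer_flow A B' c t \<theta>'))\<^sup>2 * E t)"
proof -
  interpret B': prufer_system A B' c d using A B' cd by unfold_locales
  have h: "bounded_measurable c d (\<lambda>t. (B' t - B t) * (sin (prufer_flow A B' c t \<theta>'))\<^sup>2)"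
    by (intro bounded_measurable_intros B B' bounded_measurable_continuous continuous_intros B'.flow_continuous_on)
  show ?thesis
    by (rule primitive_angle_difference[OF A B h flow_primitive[of \<theta>] B'.flow_primitive[of \<theta>'] _ K])
       (use that in \<open>auto simp: angular_velocity_def algebra_simps\<close>)
qed

lemma flow_mono:
  assumes B': "bounded_measurable c d B'" and BB': "\<And>x. x \<in> {c..d} \<Longrightarrow> B x \<le> B' x" and "\<theta> \<le> \<theta>'"
  shows "prufer_flow A B c d \<theta> \<le> prufer_flow A B' c d \<theta>'"
proof -
  interpret B': prufer_system A B' c d using A B' cd by unfold_locales
  obtain K where K: "K \<ge> 0" "\<And>x. x \<in> {c..d} \<Longrightarrow> \<bar>B x - A x\<bar> \<le> K" using bound by blast
  obtain E where E: "continuous_on {c..d} E"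
    "\<And>x. x \<in> {c..d} \<Longrightarrow> exp (- K * (x - c)) \<le> E x \<and> E x \<le> exp (K * (x - c))"
    "\<And>x. x \<in> {c..d} \<Longrightarrow> (prufer_flow A B' c x \<theta>' - prufer_flow A B c x \<theta>) * E x
       = \<theta>' - \<theta> + integral {c..x} (\<lambda>t. (B' t - B t) * (sin (prufer_flow A B' c t \<theta>'))\<^sup>2 * E t)"
    using flow_difference[OF B' K(2)] by blast
  have E0: "E x > 0" if "x \<in> {c..d}" for x
    using E(2)[OF that] exp_gt_zero[of "- K * (x - c)"] by linarith
  have "integral {c..d} (\<lambda>t. (B' t - B t) * (sin (prufer_flow A B' c t \<theta>'))\<^sup>2 * E t) \<ge> 0"
    using E0 BB'
    by (intro Henstock_Kurzweil_Integration.integral_nonneg bounded_measurable_integrable[of c d]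
          bounded_measurable_intros B B' bounded_measurable_continuous continuous_intros B'.flow_continuous_on E(1))
       (auto intro!: mult_nonneg_nonneg intro: less_imp_le)
  then have "(prufer_flow A B' c d \<theta>' - prufer_flow A B c d \<theta>) * E d \<ge> 0"
    using E(3)[of d] assms(3) cd by auto
  then show ?thesis using E0[of d] cd by (simp add: zero_le_mult_iff)
qed

lemma flow_strict_mono:
  assumes "\<theta> < \<theta>'"
  shows "prufer_flow A B c d \<theta> < prufer_flow A B c d \<theta>'"
proof -
  obtain K where K: "K \<ge> 0" "\<And>x. x \<in> {c..d} \<Longrightarrow> \<bar>B x - A x\<bar> \<le> K" using bound by blast
  obtain E where E: 
    "\<And>x. x \<in> {c..d} \<Longrightarrow> exp (- K * (x - c)) \<le> E x \<and> E x \<le> exp (K * (x - c))"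
    "\<And>x. x \<in> {c..d} \<Longrightarrow> (prufer_flow A B c x \<theta>' - prufer_flow A B c x \<theta>) * E x
       = \<theta>' - \<theta> + integral {c..x} (\<lambda>t. (B t - B t) * (sin (prufer_flow A B c t \<theta>'))\<^sup>2 * E t)"
    using flow_difference[OF B K(2)] by blast
  have "(prufer_flow A B c d \<theta>' - prufer_flow A B c d \<theta>) * E d > 0"
    using E(2)[of d] cd assms by simp
  moreover have "E d > 0" using E(1)[of d] cd by (auto intro: less_le_trans[OF exp_gt_zero])
  ultimately show ?thesis by (simp add: zero_less_mult_iff)
qed

lemma flow_lipschitz:
  assumes B': "bounded_measurable c d B'" and \<delta>: "\<And>x. x \<in> {c..d} \<Longrightarrow> \<bar>B' x - B x\<bar> \<le> \<delta>"
    and K: "\<And>x. x \<in> {c..d} \<Longrightarrow> \<bar>B x - A x\<bar> \<le> K"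
  shows "\<bar>prufer_flow A B' c d \<theta>' - prufer_flow A B c d \<theta>\<bar>
    \<le> exp (K * (d - c)) * (\<bar>\<theta>' - \<theta>\<bar> + \<delta> * exp (K * (d - c)) * (d - c))"
proof -
  interpret B': prufer_system A B' c d using A B' cd by unfold_locales
  have K0: "K \<ge> 0" using K[of c] cd by auto
  have \<delta>0: "\<delta> \<ge> 0" using \<delta>[of c] cd by auto
  obtain E where E: "continuous_on {c..d} E"
    "\<And>x. x \<in> {c..d} \<Longrightarrow> exp (- K * (x - c)) \<le> E x \<and> E x \<le> exp (K * (x - c))"
    "\<And>x. x \<in> {c..d} \<Longrightarrow> (prufer_flow A B' c x \<theta>' - prufer_flow A B c x \<theta>) * E x
       = \<theta>' - \<theta> + integral {c..x} (\<lambda>t. (B' t - B t) * (sin (prufer_flow A B' c t \<theta>'))\<^sup>2 * E t)"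
    using flow_difference[OF B' K] by blast
  let ?I = "integral {c..d} (\<lambda>t. (B' t - B t) * (sin (prufer_flow A B' c t \<theta>'))\<^sup>2 * E t)"
  let ?D = "prufer_flow A B' c d \<theta>' - prufer_flow A B c d \<theta>"
  have "\<bar>?I\<bar> \<le> (\<delta> * 1 * exp (K * (d - c))) * (d - c)"
  proof (intro integral_bounded_measurable_bound cd)
    show "bounded_measurable c d (\<lambda>t. (B' t - B t) * (sin (prufer_flow A B' c t \<theta>'))\<^sup>2 * E t)"
      by (intro bounded_measurable_intros B B' bounded_measurable_continuous continuous_intros
          B'.flow_continuous_on E(1))
    fix x assume x: "x \<in> {c..d}"
    have "0 \<le> E x" using E(2)[OF x] exp_gt_zero[of "- K * (x - c)"] by linarith
    moreover have "exp (K * (x - c)) \<le> exp (K * (d - c))" using x K0 by (simp add: mult_left_mono)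
    then have "E x \<le> exp (K * (d - c))" using E(2)[OF x] by linarith
    ultimately show "\<bar>(B' x - B x) * (sin (prufer_flow A B' c x \<theta>'))\<^sup>2 * E x\<bar> \<le> \<delta> * 1 * exp (K * (d - c))"
      unfolding abs_mult using \<delta>[OF x] \<delta>0
      by (intro mult_mono) (auto simp: abs_square_le_1)
  qed
  then have 1: "\<bar>?D * E d\<bar> \<le> \<bar>\<theta>' - \<theta>\<bar> + \<delta> * exp (K * (d - c)) * (d - c)"
    using E(3)[of d] cd by auto
  have Ed: "exp (- K * (d - c)) \<le> E d" using E(2)[of d] cd by auto
  have "\<bar>?D\<bar> = exp (K * (d - c)) * (\<bar>?D\<bar> * exp (- K * (d - c)))" by (simp add: exp_minus)
  also have "\<dots> \<le> exp (K * (d - c)) * (\<bar>?D\<bar> * E d)"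
    using Ed by (intro mult_left_mono) auto
  also have "\<bar>?D\<bar> * E d = \<bar>?D * E d\<bar>"
    using order.trans[OF exp_ge_zero Ed] by (simp add: abs_mult)
  also have "exp (K * (d - c)) * \<bar>?D * E d\<bar> \<le> exp (K * (d - c)) * (\<bar>\<theta>' - \<theta>\<bar> + \<delta> * exp (K * (d - c)) * (d - c))"
    using 1 by (intro mult_left_mono) auto
  finally show ?thesis .
qed

text \<open>
  Converse to the derivation of the angular equation: starting from the angle, the component of
  \<open>(U, P)\<close> orthogonal to \<open>(sin \<theta>, cos \<theta>)\<close> satisfies a homogeneous linear equation and starts at \<open>0\<close>,
  so it vanishes; the parallel component \<open>\<rho>\<close> satisfies a homogeneous linear equation too, so it either
  vanishes identically or never.  Consequently, if \<open>R \<noteq> 0\<close>, the zeros of \<open>U\<close> are exactly the points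
  where the angle is a multiple of \<open>\<pi>\<close>.
\<close>

lemma polar_coordinates:
  assumes U: "primitive c d U (\<lambda>t. A t * P t)" and P: "primitive c d P (\<lambda>t. - (B t * U t))"
    and start: "U c = R * sin \<theta>0" "P c = R * cos \<theta>0"
  obtains \<rho> where "\<And>x. x \<in> {c..d} \<Longrightarrow>
    U x = \<rho> x * sin (prufer_flow A B c x \<theta>0) \<and> P x = \<rho> x * cos (prufer_flow A B c x \<theta>0) \<and> (\<rho> x = 0 \<longleftrightarrow> R = 0)"
proof -
  define \<theta> where "\<theta> = (\<lambda>x. prufer_flow A B c x \<theta>0)"
  have \<theta>: "primitive c d \<theta> (angular_velocity A B \<theta>)" and \<theta>c: "\<theta> c = \<theta>0"
    using flow_primitive[of \<theta>0] by (auto simp: \<theta>_def)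
  define m where "m = (\<lambda>t. (A t - B t) * (sin (\<theta> t) * cos (\<theta> t)))"
  have m: "bounded_measurable c d m" unfolding m_def
    by (intro bounded_measurable_intros A B bounded_measurable_continuous continuous_intros
        primitive_continuous_on[OF \<theta>])
  define W where "W = (\<lambda>x. U x * cos (\<theta> x) - P x * sin (\<theta> x))"
  define \<rho> where "\<rho> = (\<lambda>x. U x * sin (\<theta> x) + P x * cos (\<theta> x))"
  have v: "angular_velocity A B \<theta> t = A t - (A t - B t) * (sin (\<theta> t))\<^sup>2"
     "angular_velocity A B \<theta> t = B t + (A t - B t) * (cos (\<theta> t))\<^sup>2" for t
    by (simp_all add: angular_velocity_def cos_squared_eq algebra_simps)
  have W: "primitive c d W (\<lambda>t. (A t * P t) * cos (\<theta> t) + U t * (- sin (\<theta> t) * angular_velocity A B \<theta> t)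
      - (- (B t * U t) * sin (\<theta> t) + P t * (cos (\<theta> t) * angular_velocity A B \<theta> t)))"
    unfolding W_def
    by (intro primitive_diff_fun primitive_mult U P primitive_sin primitive_cos \<theta>)
  \<comment> \<open>\<open>W' = - m W\<close>\<close>
  have W0: "W x = 0" if "x \<in> {c..d}" for x
  proof -
    have "W x * exp (- integral {c..x} (\<lambda>t. - m t)) = W c + integral {c..x} (\<lambda>t. 0 * exp (- integral {c..t} (\<lambda>t. - m t)))"
    proof (rule primitive_linear_ode[OF W _ _ _ that])
      fix t
      have "(A t * P t) * cos (\<theta> t) + U t * (- sin (\<theta> t) * angular_velocity A B \<theta> t)
        - (- (B t * U t) * sin (\<theta> t) + P t * (cos (\<theta> t) * angular_velocity A B \<theta> t))
        = P t * cos (\<theta> t) * (A t - angular_velocity A B \<theta> t) + U t * sin (\<theta> t) * (B t - angular_velocity A B \<theta> t)"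
        by (simp add: algebra_simps)
      also have "\<dots> = P t * cos (\<theta> t) * ((A t - B t) * (sin (\<theta> t))\<^sup>2) + U t * sin (\<theta> t) * (- ((A t - B t) * (cos (\<theta> t))\<^sup>2))"
      proof -
        have 1: "A t - angular_velocity A B \<theta> t = (A t - B t) * (sin (\<theta> t))\<^sup>2" using v(1)[of t] by simp
        have 2: "B t - angular_velocity A B \<theta> t = - ((A t - B t) * (cos (\<theta> t))\<^sup>2)" using v(2)[of t] by simp
        show ?thesis unfolding 1 2 ..
      qed
      also have "\<dots> = - m t * W t + 0" by (simp add: m_def W_def algebra_simps power2_eq_square)
      finally show "(A t * P t) * cos (\<theta> t) + U t * (- sin (\<theta> t) * angular_velocity A B \<theta> t)
        - (- (B t * U t) * sin (\<theta> t) + P t * (cos (\<theta> t) * angular_velocity A B \<theta> t)) = - m t * W t + 0" .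
    qed (intro bounded_measurable_intros m)+
    moreover have "W c = 0" using start by (simp add: W_def \<theta>c)
    ultimately show ?thesis by simp
  qed
  have UP: "U x = \<rho> x * sin (\<theta> x) \<and> P x = \<rho> x * cos (\<theta> x)" if "x \<in> {c..d}" for x
  proof -
    have 1: "U x * cos (\<theta> x) = P x * sin (\<theta> x)" using W0[OF that] by (simp add: W_def)
    have "\<rho> x * sin (\<theta> x) = U x * (sin (\<theta> x))\<^sup>2 + (P x * sin (\<theta> x)) * cos (\<theta> x)"
      by (simp add: \<rho>_def algebra_simps power2_eq_square)
    also have "\<dots> = U x * ((sin (\<theta> x))\<^sup>2 + (cos (\<theta> x))\<^sup>2)"
      unfolding 1[symmetric] by (simp only: distrib_left power2_eq_square mult.assoc)
    finally have 2: "\<rho> x * sin (\<theta> x) = U x" by simp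
    have "\<rho> x * cos (\<theta> x) = (U x * cos (\<theta> x)) * sin (\<theta> x) + P x * (cos (\<theta> x))\<^sup>2"
      by (simp add: \<rho>_def algebra_simps power2_eq_square)
    also have "\<dots> = P x * ((sin (\<theta> x))\<^sup>2 + (cos (\<theta> x))\<^sup>2)"
      unfolding 1 by (simp only: distrib_left power2_eq_square mult.assoc)
    finally show ?thesis using 2 by simp
  qed
  have \<rho>: "primitive c d \<rho> (\<lambda>t. (A t * P t) * sin (\<theta> t) + U t * (cos (\<theta> t) * angular_velocity A B \<theta> t)
      + (- (B t * U t) * cos (\<theta> t) + P t * (- sin (\<theta> t) * angular_velocity A B \<theta> t)))"
    unfolding \<rho>_def
    by (intro primitive_add primitive_mult U P primitive_sin primitive_cos \<theta>)
  \<comment> \<open>\<open>\<rho>' = m \<rho>\<close>\<close>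
  have \<rho>R: "\<rho> x * exp (- integral {c..x} m) = R" if "x \<in> {c..d}" for x
  proof -
    have "\<rho> x * exp (- integral {c..x} m) = \<rho> c + integral {c..x} (\<lambda>t. 0 * exp (- integral {c..t} m))"
    proof (rule primitive_linear_ode[OF \<rho> m _ _ that])
      fix t assume t: "t \<in> {c..d}"
      have "(A t * P t) * sin (\<theta> t) + U t * (cos (\<theta> t) * angular_velocity A B \<theta> t)
        + (- (B t * U t) * cos (\<theta> t) + P t * (- sin (\<theta> t) * angular_velocity A B \<theta> t))
        = P t * sin (\<theta> t) * (A t - angular_velocity A B \<theta> t) + U t * cos (\<theta> t) * (angular_velocity A B \<theta> t - B t)"
        by (simp add: algebra_simps)
      also have "A t - angular_velocity A B \<theta> t = (A t - B t) * (sin (\<theta> t))\<^sup>2" using v(1)[of t] by simp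
      also have "angular_velocity A B \<theta> t - B t = (A t - B t) * (cos (\<theta> t))\<^sup>2" using v(2)[of t] by simp
      also have "P t * sin (\<theta> t) * ((A t - B t) * (sin (\<theta> t))\<^sup>2) + U t * cos (\<theta> t) * ((A t - B t) * (cos (\<theta> t))\<^sup>2)
         = m t * \<rho> t * ((sin (\<theta> t))\<^sup>2 + (cos (\<theta> t))\<^sup>2)"
        unfolding UP[OF t, THEN conjunct1] UP[OF t, THEN conjunct2] m_def distrib_left
        by (simp only: mult_ac)
      finally show "(A t * P t) * sin (\<theta> t) + U t * (cos (\<theta> t) * angular_velocity A B \<theta> t)
        + (- (B t * U t) * cos (\<theta> t) + P t * (- sin (\<theta> t) * angular_velocity A B \<theta> t)) = m t * \<rho> t + 0" by simp
    qed (rule bounded_measurable_const)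
    moreover have "\<rho> c = R * ((sin \<theta>0)\<^sup>2 + (cos \<theta>0)\<^sup>2)"
      unfolding \<rho>_def \<theta>c start by (simp only: distrib_left power2_eq_square mult_ac)
    ultimately show ?thesis by simp
  qed
  show ?thesis
  proof (rule that[of \<rho>])
    fix x assume x: "x \<in> {c..d}"
    have "\<rho> x = 0 \<longleftrightarrow> R = 0" using \<rho>R[OF x] by auto
    then show "U x = \<rho> x * sin (prufer_flow A B c x \<theta>0) \<and> P x = \<rho> x * cos (prufer_flow A B c x \<theta>0) \<and> (\<rho> x = 0 \<longleftrightarrow> R = 0)"
      using UP[OF x] by (simp add: \<theta>_def)
  qed
qed

lemma system_solution_exists:
  obtains U P where "primitive c d U (\<lambda>t. A t * P t)" "primitive c d P (\<lambda>t. - (B t * U t))" "U c = u0" "P c = p0"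
proof -
  obtain R \<theta>0 where R: "u0 = R * sin \<theta>0" "p0 = R * cos \<theta>0"
    using polar_Ex[of p0 u0] by (auto simp: mult.commute)
  define \<theta> where "\<theta> = (\<lambda>x. prufer_flow A B c x \<theta>0)"
  have \<theta>: "primitive c d \<theta> (angular_velocity A B \<theta>)" and \<theta>c: "\<theta> c = \<theta>0"
    using flow_primitive[of \<theta>0] by (auto simp: \<theta>_def)
  define m where "m = (\<lambda>t. (A t - B t) * (sin (\<theta> t) * cos (\<theta> t)))"
  have m: "bounded_measurable c d m" unfolding m_def
    by (intro bounded_measurable_intros A B bounded_measurable_continuous continuous_intros
        primitive_continuous_on[OF \<theta>])
  define \<rho> where "\<rho> = (\<lambda>x. R * exp (0 + integral {c..x} m))"
  have \<rho>: "primitive c d \<rho> (\<lambda>t. R * (exp (0 + integral {c..t} m) * m t))"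
    unfolding \<rho>_def by (intro primitive_cmult primitive_exp primitive_integral m)
  define U where "U = (\<lambda>x. \<rho> x * sin (\<theta> x))"
  define P where "P = (\<lambda>x. \<rho> x * cos (\<theta> x))"
  have v: "angular_velocity A B \<theta> t = A t - (A t - B t) * (sin (\<theta> t))\<^sup>2"
     "angular_velocity A B \<theta> t = B t + (A t - B t) * (cos (\<theta> t))\<^sup>2" for t
    by (simp_all add: angular_velocity_def cos_squared_eq algebra_simps)
  have "primitive c d U (\<lambda>t. (R * (exp (0 + integral {c..t} m) * m t)) * sin (\<theta> t) + \<rho> t * (cos (\<theta> t) * angular_velocity A B \<theta> t))"
    unfolding U_def by (intro primitive_mult \<rho> primitive_sin \<theta>)
  then have U: "primitive c d U (\<lambda>t. A t * P t)"
    by (rule primitive_cong[THEN iffD1, rotated 2])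
       (simp_all add: v(1) \<rho>_def P_def m_def algebra_simps power2_eq_square)
  have "primitive c d P (\<lambda>t. (R * (exp (0 + integral {c..t} m) * m t)) * cos (\<theta> t) + \<rho> t * (- sin (\<theta> t) * angular_velocity A B \<theta> t))"
    unfolding P_def by (intro primitive_mult \<rho> primitive_cos \<theta>)
  then have P: "primitive c d P (\<lambda>t. - (B t * U t))"
    by (rule primitive_cong[THEN iffD1, rotated 2])
       (simp_all add: v(2) \<rho>_def U_def m_def algebra_simps power2_eq_square)
  show ?thesis
    by (rule that[OF U P]) (simp_all add: U_def P_def \<rho>_def \<theta>c R)
qed

end

section \<open>The angle map of a point interaction\<close>

lemma primitive_increment_ge:
  assumes "primitive c d F f" "c \<le> s" "s \<le> t" "t \<le> d" "\<And>x. x \<in> {s..t} \<Longrightarrow> m \<le> f x"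
  shows "m * (t - s) \<le> F t - F s"
proof -
  have "integral {s..t} (\<lambda>_. m) \<le> integral {s..t} f"
    using assms bounded_measurable_integrable[OF primitive_bounded_measurable[OF assms(1)], of s t]
    by (intro integral_le) auto
  then show ?thesis using primitive_diff[OF assms(1-4)] assms(3) by (simp add: mult.commute)
qed

lemma sin_ge_sin_margin:
  assumes "0 < e" "e \<le> x" "x \<le> pi - e"
  shows "sin e \<le> sin x"
proof (cases "x \<le> pi / 2")
  case True then show ?thesis using assms by (intro sin_monotone_2pi_le) auto
next
  case False
  then have "sin e \<le> sin (pi - x)" using assms by (intro sin_monotone_2pi_le) auto
  then show ?thesis by simp
qed

text \<open>
  Over the unit interval the system \<open>U' = 0\<close>, \<open>P' = \<sigma> U\<close> carries \<open>(u, p)\<close> to \<open>(u, p + \<sigma> u)\<close>, which is the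
  transfer map of a point interaction.  This is a definition of the angle map
  \<open>cot (jump \<sigma> \<theta>) = cot \<theta> + \<sigma>\<close> without choosing branches of the cotangent.
\<close>

definition jump :: "real \<Rightarrow> real \<Rightarrow> real" where
  "jump \<sigma> \<theta> = prufer_flow (\<lambda>_. 0) (\<lambda>_. - \<sigma>) 0 1 \<theta>"

lemma jump_system: "prufer_system (\<lambda>_. 0) (\<lambda>_. - \<sigma>) 0 1"
  by unfold_locales auto

lemma jump_shift: "jump \<sigma> (\<theta> + of_int k * pi) = jump \<sigma> \<theta> + of_int k * pi"
  unfolding jump_def by (rule prufer_system.flow_shift[OF jump_system])

lemma jump_strict_mono: "\<theta> < \<theta>' \<Longrightarrow> jump \<sigma> \<theta> < jump \<sigma> \<theta>'"
  unfolding jump_def by (rule prufer_system.flow_strict_mono[OF jump_system])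

lemma jump_mono: "\<theta> \<le> \<theta>' \<Longrightarrow> jump \<sigma> \<theta> \<le> jump \<sigma> \<theta>'"
  using jump_strict_mono[of \<theta> \<theta>' \<sigma>] by (cases "\<theta> = \<theta>'") auto

lemma jump_zero: "jump 0 \<theta> = \<theta>"
proof -
  have "angular_velocity (\<lambda>_. 0) (\<lambda>_. - 0) (\<lambda>_. \<theta>) = (\<lambda>_. 0)" by (simp add: angular_velocity_def fun_eq_iff)
  then have "primitive 0 1 (\<lambda>_. \<theta>) (angular_velocity (\<lambda>_. 0) (\<lambda>_. - 0) (\<lambda>_. \<theta>))"
    by (simp only: primitive_const)
  from prufer_system.flow_eqI[OF jump_system this] show ?thesis by (simp add: jump_def)
qed

lemma jump_le:
  assumes "\<sigma> \<ge> 0"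
  shows "jump \<sigma> \<theta> \<le> \<theta>"
proof -
  interpret prufer_system "\<lambda>_. 0" "\<lambda>_. - \<sigma>" 0 1 by (rule jump_system)
  have "jump \<sigma> \<theta> \<le> jump 0 \<theta>"
    unfolding jump_def by (rule flow_mono) (use assms in auto)
  then show ?thesis by (simp add: jump_zero)
qed

text \<open>
  A point interaction is invisible to functions that vanish at that point.
\<close>

lemma jump_of_int_pi [simp]: "jump \<sigma> (of_int k * pi) = of_int k * pi"
proof -
  have "angular_velocity (\<lambda>_. 0) (\<lambda>_. - \<sigma>) (\<lambda>_. 0) = (\<lambda>_. 0)" by (simp add: angular_velocity_def fun_eq_iff)
  then have "primitive 0 1 (\<lambda>_. 0) (angular_velocity (\<lambda>_. 0) (\<lambda>_. - \<sigma>) (\<lambda>_. 0))"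
    by (simp only: primitive_const)
  from prufer_system.flow_eqI[OF jump_system this] have "jump \<sigma> 0 = 0" by (simp add: jump_def)
  then show ?thesis using jump_shift[of \<sigma> 0 k] by simp
qed

lemma jump_continuous: "isCont (jump \<sigma>) \<theta>"
  unfolding isCont_def
proof (rule LIM_zero_cancel, rule Lim_null_comparison)
  interpret prufer_system "\<lambda>_. 0" "\<lambda>_. - \<sigma>" 0 1 by (rule jump_system)
  let ?K = "exp (\<bar>\<sigma>\<bar> * (1 - 0))"
  show "\<forall>\<^sub>F x in at \<theta>. norm (jump \<sigma> x - jump \<sigma> \<theta>) \<le> ?K * (\<bar>x - \<theta>\<bar> + 0 * ?K * (1 - 0))"
    unfolding jump_def real_norm_def
    by (intro always_eventually allI flow_lipschitz) auto
  show "((\<lambda>x. ?K * (\<bar>x - \<theta>\<bar> + 0 * ?K * (1 - 0))) \<longlongrightarrow> 0) (at \<theta>)"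
    by (auto intro!: tendsto_eq_intros)
qed

text \<open>
  Along the flow \<open>\<theta>' = - \<sigma> sin\<^sup>2 \<theta>\<close> the angle decreases.  As long as it stays in the range
  \<open>{e..pi - e}\<close>, it does so at rate at least \<open>\<sigma> sin\<^sup>2 e\<close>, and more than \<open>\<pi>\<close> cannot be lost in this
  range.  Hence, for large \<open>\<sigma>\<close>, every angle below \<open>\<pi> - \<delta>\<close> is pressed down to nearly \<open>0\<close> or
  below: an infinitely strong interaction is a Dirichlet condition.
\<close>

lemma jump_large:
  assumes "\<eta> > 0" "\<delta> > 0"
  shows "\<exists>\<sigma>0\<ge>0. \<forall>\<sigma>\<ge>\<sigma>0. \<forall>\<theta>\<le>pi - \<delta>. jump \<sigma> \<theta> \<le> \<eta>"
proof (cases "\<eta> < pi - \<delta>")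
  case False
  then show ?thesis using jump_le order.trans by (intro exI[of _ 0]) (auto, smt (verit))
next
  case True
  define e where "e = min \<eta> \<delta>"
  have e: "e > 0" "e \<le> \<eta>" "e \<le> \<delta>" "e < pi" using assms True by (auto simp: e_def)
  have se: "(sin e)\<^sup>2 > 0" using sin_gt_zero[of e] e by auto
  \<comment> \<open>strong enough to turn the angle back by \<open>\<pi>\<close> in unit time\<close>
  define \<sigma>0 where "\<sigma>0 = pi / (sin e)\<^sup>2"
  show ?thesis
  proof (intro exI[of _ \<sigma>0] conjI allI impI)
    show "0 \<le> \<sigma>0" using se by (simp add: \<sigma>0_def)
    fix \<sigma> \<theta> assume \<sigma>: "\<sigma>0 \<le> \<sigma>" and \<theta>: "\<theta> \<le> pi - \<delta>"
    have \<sigma>pos: "\<sigma> \<ge> 0" using \<sigma> \<open>0 \<le> \<sigma>0\<close> by simp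
    interpret prufer_system "\<lambda>_. 0" "\<lambda>_. - \<sigma>" 0 1 by (rule jump_system)
    define f where "f = (\<lambda>x. prufer_flow (\<lambda>_. 0) (\<lambda>_. - \<sigma>) 0 x \<theta>)"
    have f: "primitive 0 1 f (\<lambda>t. - \<sigma> * (sin (f t))\<^sup>2)"
      using flow_primitive[of \<theta>] unfolding f_def angular_velocity_def[abs_def] by simp
    have g: "primitive 0 1 (\<lambda>x. -1 * f x) (\<lambda>t. -1 * (- \<sigma> * (sin (f t))\<^sup>2))"
      by (rule primitive_cmult[OF f])
    have f0: "f 0 = \<theta>" by (simp add: f_def)
    have dec: "f t \<le> f s" if "0 \<le> s" "s \<le> t" "t \<le> 1" for s t
      using primitive_increment_ge[OF g that, of 0] \<sigma>pos by simp
    show "jump \<sigma> \<theta> \<le> \<eta>"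
    proof (rule ccontr)
      assume "\<not> jump \<sigma> \<theta> \<le> \<eta>"
      then have f1: "f 1 > \<eta>" by (simp add: jump_def f_def)
      have "\<sigma> * (sin e)\<^sup>2 * (1 - 0) \<le> -1 * f 1 - -1 * f 0"
      proof (rule primitive_increment_ge[OF g])
        fix x :: real assume x: "x \<in> {0..1}"
        have "f x \<ge> e" using dec[of x 1] x f1 e by auto
        moreover have "f x \<le> pi - e" using dec[of 0 x] x f0 \<theta> e by auto
        ultimately have "sin e \<le> sin (f x)" using e by (intro sin_ge_sin_margin)
        then have "(sin e)\<^sup>2 \<le> (sin (f x))\<^sup>2" using e by (intro power_mono sin_ge_zero) auto
        then show "\<sigma> * (sin e)\<^sup>2 \<le> -1 * (- \<sigma> * (sin (f x))\<^sup>2)" using \<sigma>pos by (simp add: mult_left_mono)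
      qed auto
      also have "\<dots> < pi" using f1 f0 \<theta> assms by simp
      also have "pi = \<sigma>0 * (sin e)\<^sup>2" using se by (simp add: \<sigma>0_def)
      finally show False using \<sigma> se by (simp add: mult_less_cancel_right)
    qed
  qed
qed

lemma jump_polar:
  assumes "u = R * sin \<theta>" "p = R * cos \<theta>"
  obtains R' where "u = R' * sin (jump \<sigma> \<theta>)" "p + \<sigma> * u = R' * cos (jump \<sigma> \<theta>)" "R' = 0 \<longleftrightarrow> R = 0"
proof -
  interpret prufer_system "\<lambda>_. 0" "\<lambda>_. - \<sigma>" 0 1 by (rule jump_system)
  define P where "P = (\<lambda>x::real. p + integral {0..x} (\<lambda>t. - (- \<sigma> * u)))"
  have P: "primitive 0 1 P (\<lambda>t. - (- \<sigma> * u))"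
    unfolding P_def by (rule primitive_integral[OF bounded_measurable_const])
  have U: "primitive 0 1 (\<lambda>_. u) (\<lambda>t. 0 * P t)" using primitive_const by simp
  have P01: "P 0 = p" "P 1 = p + \<sigma> * u" by (simp_all add: P_def)
  show ?thesis
  proof (rule polar_coordinates[OF U P assms(1)])
    show "P 0 = R * cos \<theta>" using P01 assms by simp
    fix \<rho> assume *: "\<And>x. x \<in> {0..1} \<Longrightarrow>
      u = \<rho> x * sin (prufer_flow (\<lambda>_. 0) (\<lambda>_. - \<sigma>) 0 x \<theta>) \<and>
      P x = \<rho> x * cos (prufer_flow (\<lambda>_. 0) (\<lambda>_. - \<sigma>) 0 x \<theta>) \<and> (\<rho> x = 0 \<longleftrightarrow> R = 0)"
    have "u = \<rho> 1 * sin (jump \<sigma> \<theta>)" "P 1 = \<rho> 1 * cos (jump \<sigma> \<theta>)" "\<rho> 1 = 0 \<longleftrightarrow> R = 0"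
      using *[of 1] unfolding jump_def by auto
    then show thesis using that[of "\<rho> 1"] unfolding P01(2) by blast
  qed
qed

section \<open>The angle of a Sturm--Liouville equation\<close>

locale bounded_potential =
  fixes a :: real and q :: "real \<Rightarrow> real"
  assumes a_pos: "a > 0" and q_bm: "bounded_measurable 0 a q"
begin

abbreviation energy_flow :: "real \<Rightarrow> real \<Rightarrow> real \<Rightarrow> real \<Rightarrow> real" where
  "energy_flow l c d \<theta> \<equiv> prufer_flow (\<lambda>_. 1) (\<lambda>x. l - q x) c d \<theta>"

lemma energy_system: "0 \<le> c \<Longrightarrow> c \<le> d \<Longrightarrow> d \<le> a \<Longrightarrow> prufer_system (\<lambda>_. 1) (\<lambda>x. l - q x) c d"
  by unfold_locales (auto intro!: bounded_measurable_intros bounded_measurable_subset[OF q_bm])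

text \<open>
  The gain from raising the energy is the weighted integral of \<open>(l' - l) sin\<^sup>2 \<theta>\<close>.  If it vanished, \<open>sin \<theta>\<close>
  would vanish on the whole interval; but there the angular velocity is \<open>1\<close>.
\<close>

lemma energy_flow_strict_mono_energy:
  assumes "0 \<le> c" "c < d" "d \<le> a" "l < l'"
  shows "energy_flow l c d \<theta>0 < energy_flow l' c d \<theta>0"
proof -
  interpret s: prufer_system "\<lambda>_. 1" "\<lambda>x. l - q x" c d using assms by (intro energy_system) auto
  interpret s': prufer_system "\<lambda>_. 1" "\<lambda>x. l' - q x" c d using assms by (intro energy_system) auto
  define \<theta> where "\<theta> = (\<lambda>x. energy_flow l' c x \<theta>0)"
  have \<theta>: "primitive c d \<theta> (angular_velocity (\<lambda>_. 1) (\<lambda>x. l' - q x) \<theta>)"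
    using s'.flow_primitive[of \<theta>0] by (simp add: \<theta>_def)
  obtain K where K: "K \<ge> 0" "\<And>x. x \<in> {c..d} \<Longrightarrow> \<bar>(l - q x) - 1\<bar> \<le> K" using s.bound by blast
  obtain E where E: "continuous_on {c..d} E"
    "\<And>x. x \<in> {c..d} \<Longrightarrow> exp (- K * (x - c)) \<le> E x \<and> E x \<le> exp (K * (x - c))"
    "\<And>x. x \<in> {c..d} \<Longrightarrow> (energy_flow l' c x \<theta>0 - energy_flow l c x \<theta>0) * E x
       = \<theta>0 - \<theta>0 + integral {c..x} (\<lambda>t. ((l' - q t) - (l - q t)) * (sin (energy_flow l' c t \<theta>0))\<^sup>2 * E t)"
    using s.flow_difference[OF s'.B K(2)] by blast
  let ?h = "\<lambda>t. (l' - l) * (sin (\<theta> t))\<^sup>2 * E t"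
  have E0: "E x > 0" if "x \<in> {c..d}" for x using E(2)[OF that] by (auto intro: less_le_trans[OF exp_gt_zero])
  have hcont: "continuous_on {c..d} ?h"
    by (intro continuous_intros E(1) primitive_continuous_on[OF \<theta>])
  have hpos: "?h x \<ge> 0" if "x \<in> {c..d}" for x
    using E0[OF that] assms(4) by (intro mult_nonneg_nonneg) auto
  have "integral {c..d} ?h \<ge> 0"
    using hpos by (intro Henstock_Kurzweil_Integration.integral_nonneg integrable_continuous_interval hcont) auto
  moreover have "integral {c..d} ?h \<noteq> 0"
  proof
    assume "integral {c..d} ?h = 0"
    then have "\<forall>x\<in>{c..d}. ?h x = 0" using integral_eq_0_iff[OF hcont assms(2) hpos] by simp
    then have s0: "sin (\<theta> x) = 0" if "x \<in> {c..d}" for x using that assms(4) E0[OF that] by force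
    define e where "e = min 1 (d - c)"
    have e: "0 < e" "e < pi" "c + e \<le> d" using assms(2) pi_gt3 by (auto simp: e_def)
    have "\<theta> (c + e) = \<theta> c + integral {c..c + e} (angular_velocity (\<lambda>_. 1) (\<lambda>x. l' - q x) \<theta>)"
      by (rule primitive_eq[OF \<theta>]) (use e in auto)
    also have "integral {c..c + e} (angular_velocity (\<lambda>_. 1) (\<lambda>x. l' - q x) \<theta>) = integral {c..c + e} (\<lambda>_. 1)"
      using e by (intro Henstock_Kurzweil_Integration.integral_cong) (simp add: angular_velocity_def cos_squared_eq s0)
    finally have "\<theta> (c + e) = \<theta> c + e" using e by simp
    with s0[of "c + e"] s0[of c] e assms(2) have "cos (\<theta> c) * sin e = 0" by (simp add: sin_add)
    moreover have "cos (\<theta> c) \<noteq> 0" using s0[of c] assms(2) sin_cos_squared_add[of "\<theta> c"] by force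
    ultimately show False using sin_gt_zero[of e] e by simp
  qed
  ultimately have "(energy_flow l' c d \<theta>0 - energy_flow l c d \<theta>0) * E d > 0"
    using E(3)[of d] assms(2) by (simp add: \<theta>_def)
  then show ?thesis using E0[of d] assms(2) by (simp add: zero_less_mult_iff)
qed

lemma energy_flow_mono:
  assumes "0 \<le> c" "c \<le> d" "d \<le> a" "l \<le> l'" "\<theta> \<le> \<theta>'"
  shows "energy_flow l c d \<theta> \<le> energy_flow l' c d \<theta>'"
proof -
  interpret s: prufer_system "\<lambda>_. 1" "\<lambda>x. l - q x" c d using assms by (intro energy_system) auto
  interpret s': prufer_system "\<lambda>_. 1" "\<lambda>x. l' - q x" c d using assms by (intro energy_system) auto
  show ?thesis using assms by (intro s.flow_mono s'.B) auto
qed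

text \<open>
  At multiples of \<open>\<pi>\<close> the angular velocity is \<open>1\<close>, so they can only be crossed upwards: the constant
  angle \<open>0\<close> is a strict lower barrier, and shifting gives the other multiples.  This is why the angle
  counts zeros.
\<close>

lemma energy_flow_gt_of_int_pi:
  assumes "0 \<le> c" "c < d" "d \<le> a" "of_int k * pi \<le> \<theta>"
  shows "of_int k * pi < energy_flow l c d \<theta>"
proof -
  interpret s: prufer_system "\<lambda>_. 1" "\<lambda>x. l - q x" c d using assms by (intro energy_system) auto
  obtain K where K: "K \<ge> 0" "\<And>x. x \<in> {c..d} \<Longrightarrow> \<bar>(l - q x) - 1\<bar> \<le> K" using s.bound by blast
  have "0 < energy_flow l c d 0"
  proof (rule primitive_angle_difference[OF s.A s.B bounded_measurable_const[of c d 1]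
        primitive_const[of c d 0] s.flow_primitive[of 0] _ K(2)])
    fix E assume E: "continuous_on {c..d} E"
      "\<And>x. x \<in> {c..d} \<Longrightarrow> exp (- K * (x - c)) \<le> E x \<and> E x \<le> exp (K * (x - c))"
      "\<And>x. x \<in> {c..d} \<Longrightarrow> (energy_flow l c x 0 - 0) * E x
         = energy_flow l c c 0 - 0 + integral {c..x} (\<lambda>t. 1 * E t)"
    have E0: "E x > 0" if "x \<in> {c..d}" for x using E(2)[OF that] by (auto intro: less_le_trans[OF exp_gt_zero])
    have "integral {c..d} E \<ge> 0"
      using E0 by (intro Henstock_Kurzweil_Integration.integral_nonneg integrable_continuous_interval E(1)) (auto intro: less_imp_le)
    moreover have "integral {c..d} E = 0 \<longleftrightarrow> (\<forall>x\<in>{c..d}. E x = 0)"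
      by (rule integral_eq_0_iff[OF E(1) assms(2) less_imp_le[OF E0]])
    then have "integral {c..d} E \<noteq> 0" using E0[of c] assms(2) by auto
    ultimately have "energy_flow l c d 0 * E d > 0" using E(3)[of d] assms(2) by simp
    then show ?thesis using E0[of d] assms(2) by (simp add: zero_less_mult_iff)
  qed (auto simp: angular_velocity_def)
  then have "of_int k * pi < energy_flow l c d (0 + of_int k * pi)" unfolding s.flow_shift by simp
  also have "\<dots> \<le> energy_flow l c d \<theta>" using assms by (intro energy_flow_mono) auto
  finally show ?thesis .
qed

text \<open>
  For \<open>l \<le> q\<close> the velocity at \<open>\<pi> / 2\<close> is nonpositive, so this constant is an upper barrier: below the
  infimum of the potential there are no eigenvalues.
\<close>

lemma energy_flow_le_half_pi:
  assumes "0 \<le> c" "c \<le> d" "d \<le> a" "\<theta> \<le> pi / 2" and l: "\<And>x. x \<in> {0..a} \<Longrightarrow> l \<le> q x"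
  shows "energy_flow l c d \<theta> \<le> pi / 2"
proof -
  interpret s: prufer_system "\<lambda>_. 1" "\<lambda>x. l - q x" c d using assms by (intro energy_system) auto
  obtain K where K: "K \<ge> 0" "\<And>x. x \<in> {c..d} \<Longrightarrow> \<bar>(l - q x) - 1\<bar> \<le> K" using s.bound by blast
  show ?thesis
  proof (rule primitive_angle_difference[OF s.A s.B bounded_measurable_minus[OF s.B]
        s.flow_primitive[of \<theta>] primitive_const[of c d "pi / 2"] _ K(2)])
    fix E assume E: "continuous_on {c..d} E"
      "\<And>x. x \<in> {c..d} \<Longrightarrow> exp (- K * (x - c)) \<le> E x \<and> E x \<le> exp (K * (x - c))"
      "\<And>x. x \<in> {c..d} \<Longrightarrow> (pi / 2 - energy_flow l c x \<theta>) * E x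
         = pi / 2 - energy_flow l c c \<theta> + integral {c..x} (\<lambda>t. - (l - q t) * E t)"
    have E0: "E x > 0" if "x \<in> {c..d}" for x using E(2)[OF that] by (auto intro: less_le_trans[OF exp_gt_zero])
    have "integral {c..d} (\<lambda>t. - (l - q t) * E t) \<ge> 0"
    proof (intro Henstock_Kurzweil_Integration.integral_nonneg bounded_measurable_integrable[of c d])
      show "bounded_measurable c d (\<lambda>t. - (l - q t) * E t)"
        by (rule bounded_measurable_mult[OF bounded_measurable_minus[OF s.B] bounded_measurable_continuous[OF E(1)]])
      show "0 \<le> - (l - q x) * E x" if "x \<in> {c..d}" for x
        using l[of x] E0[OF that] that assms by (intro mult_nonneg_nonneg) auto
    qed simp
    then have "(pi / 2 - energy_flow l c d \<theta>) * E d \<ge> 0" using E(3)[of d] assms by simp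
    then show ?thesis using E0[of d] assms(2) by (simp add: zero_le_mult_iff)
  qed (auto simp: angular_velocity_def)
qed

text \<open>
  Once \<open>l \<ge> Q + 1\<close>, with \<open>Q\<close> a bound for the potential, the velocity is at least \<open>1\<close>.  If the angle
  stayed below \<open>\<pi>\<close> it would therefore lie in \<open>{e..pi - e}\<close> except within distance \<open>e\<close> of the end
  points; there it grows at rate \<open>(l - Q) sin\<^sup>2 e\<close>, which is too fast for large \<open>l\<close>.
\<close>

lemma energy_flow_ge_pi:
  assumes "0 \<le> c" "c < d" "d \<le> a"
  shows "\<exists>L. \<forall>l\<ge>L. pi \<le> energy_flow l c d 0"
proof -
  obtain Q where Q: "Q \<ge> 0" "\<And>x. x \<in> {0..a} \<Longrightarrow> \<bar>q x\<bar> \<le> Q" using bounded_measurable_bound[OF q_bm] by blast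
  define e where "e = min ((d - c) / 4) (pi / 4)"
  have e: "e > 0" "4 * e \<le> d - c" "e < pi" using assms pi_gt_zero by (auto simp: e_def min_def)
  have se: "(sin e)\<^sup>2 > 0" using sin_gt_zero[of e] e by auto
  define L where "L = Q + 1 + pi / (2 * e * (sin e)\<^sup>2)"
  show ?thesis
  proof (intro exI[of _ L] allI impI)
    fix l assume l: "L \<le> l"
    have "pi / (2 * e * (sin e)\<^sup>2) \<ge> 0" using se e by simp
    then have lQ: "l - Q \<ge> 1" using l unfolding L_def by linarith
    interpret s: prufer_system "\<lambda>_. 1" "\<lambda>x. l - q x" c d using assms by (intro energy_system) auto
    define \<theta> where "\<theta> = (\<lambda>x. energy_flow l c x 0)"
    have \<theta>: "primitive c d \<theta> (angular_velocity (\<lambda>_. 1) (\<lambda>x. l - q x) \<theta>)" and \<theta>c: "\<theta> c = 0"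
      using s.flow_primitive[of 0] by (auto simp: \<theta>_def)
    have v: "angular_velocity (\<lambda>_. 1) (\<lambda>x. l - q x) \<theta> x \<ge> (l - Q) * (sin (\<theta> x))\<^sup>2 + (cos (\<theta> x))\<^sup>2"
      if "x \<in> {c..d}" for x
    proof -
      have "l - Q \<le> l - q x" using Q(2)[of x] that assms by auto
      then show ?thesis unfolding angular_velocity_def by (simp add: mult_right_mono)
    qed
    have v1: "angular_velocity (\<lambda>_. 1) (\<lambda>x. l - q x) \<theta> x \<ge> 1" if "x \<in> {c..d}" for x
    proof -
      have "1 * (sin (\<theta> x))\<^sup>2 \<le> (l - Q) * (sin (\<theta> x))\<^sup>2" using lQ by (intro mult_right_mono) auto
      then show ?thesis using v[OF that] sin_cos_squared_add[of "\<theta> x"] by linarith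
    qed
    show "pi \<le> energy_flow l c d 0"
    proof (rule ccontr)
      assume "\<not> ?thesis"
      then have d: "\<theta> d < pi" by (simp add: \<theta>_def)
      have "((l - Q) * (sin e)\<^sup>2) * ((d - e) - (c + e)) \<le> \<theta> (d - e) - \<theta> (c + e)"
      proof (rule primitive_increment_ge[OF \<theta>])
        fix x assume x: "x \<in> {c + e..d - e}"
        then have xcd: "x \<in> {c..d}" using e by auto
        have "1 * (x - c) \<le> \<theta> x - \<theta> c" "1 * (d - x) \<le> \<theta> d - \<theta> x"
          using xcd v1 primitive_increment_ge[OF \<theta>, of c x 1] primitive_increment_ge[OF \<theta>, of x d 1]
          by auto
        then have "sin e \<le> sin (\<theta> x)" using x d \<theta>c e(1) by (intro sin_ge_sin_margin) auto
        then have "(sin e)\<^sup>2 \<le> (sin (\<theta> x))\<^sup>2" using e by (intro power_mono sin_ge_zero) auto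
        then have "(l - Q) * (sin e)\<^sup>2 \<le> (l - Q) * (sin (\<theta> x))\<^sup>2" using lQ by (intro mult_left_mono) auto
        then show "(l - Q) * (sin e)\<^sup>2 \<le> angular_velocity (\<lambda>_. 1) (\<lambda>x. l - q x) \<theta> x"
          using v[OF xcd] zero_le_power2[of "cos (\<theta> x)"] by linarith
      qed (use e in auto)
      moreover have "1 * (d - (d - e)) \<le> \<theta> d - \<theta> (d - e)" "1 * ((c + e) - c) \<le> \<theta> (c + e) - \<theta> c"
        by (rule primitive_increment_ge[OF \<theta>]; use e v1 in auto)+
      then have "\<theta> (d - e) \<le> \<theta> d" "\<theta> c \<le> \<theta> (c + e)" using e by auto
      moreover have "((l - Q) * (sin e)\<^sup>2) * (2 * e) \<le> ((l - Q) * (sin e)\<^sup>2) * ((d - e) - (c + e))"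
        using e lQ by (intro mult_left_mono) auto
      ultimately have "((l - Q) * (sin e)\<^sup>2) * (2 * e) < pi" using d \<theta>c by linarith
      moreover have "pi = (pi / (2 * e * (sin e)\<^sup>2)) * ((sin e)\<^sup>2 * (2 * e))" using e se by simp
      moreover have "pi / (2 * e * (sin e)\<^sup>2) \<le> l - Q" using l unfolding L_def by linarith
      then have "(pi / (2 * e * (sin e)\<^sup>2)) * ((sin e)\<^sup>2 * (2 * e)) \<le> (l - Q) * ((sin e)\<^sup>2 * (2 * e))"
        using e se by (intro mult_right_mono) auto
      ultimately show False by (simp add: mult.assoc)
    qed
  qed
qed

text \<open>
  Halving the interval: each further piece contributes another \<open>\<pi>\<close> at sufficiently high energy.
\<close>

lemma energy_flow_unbounded:
  assumes "0 \<le> c" "c < d" "d \<le> a"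
  shows "\<exists>L. \<forall>l\<ge>L. real k * pi \<le> energy_flow l c d 0"
  using assms
proof (induction k arbitrary: d)
  case 0
  have "0 \<le> energy_flow l c d 0" for l using energy_flow_gt_of_int_pi[OF 0, of 0 0 l] by simp
  then show ?case by simp
next
  case (Suc k)
  define e where "e = (c + d) / 2"
  have e: "c < e" "e < d" using Suc.prems by (auto simp: e_def)
  obtain L1 where L1: "\<And>l. l \<ge> L1 \<Longrightarrow> real k * pi \<le> energy_flow l c e 0"
    using Suc.IH[of e] Suc.prems e by auto
  obtain L2 where L2: "\<And>l. l \<ge> L2 \<Longrightarrow> pi \<le> energy_flow l e d 0"
    using energy_flow_ge_pi[of e d] Suc.prems e by auto
  show ?case
  proof (intro exI[of _ "max L1 L2"] allI impI)
    fix l assume l: "max L1 L2 \<le> l"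
    interpret s: prufer_system "\<lambda>_. 1" "\<lambda>x. l - q x" c d using Suc.prems by (intro energy_system) auto
    interpret s': prufer_system "\<lambda>_. 1" "\<lambda>x. l - q x" e d using Suc.prems e by (intro energy_system) auto
    have "real (Suc k) * pi \<le> energy_flow l e d 0 + of_int (int k) * pi"
      using L2[of l] l by (simp add: algebra_simps)
    also have "\<dots> = energy_flow l e d (0 + of_int (int k) * pi)" by (rule s'.flow_shift[symmetric])
    also have "\<dots> \<le> energy_flow l e d (energy_flow l c e 0)"
      using L1[of l] l Suc.prems e by (intro energy_flow_mono) auto
    also have "\<dots> = energy_flow l c d 0" using e by (intro s.flow_compose) auto
    finally show "real (Suc k) * pi \<le> energy_flow l c d 0" .
  qed
qed

lemma energy_flow_continuous:
  assumes "0 \<le> c" "c \<le> d" "d \<le> a" and g: "isCont g l"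
  shows "isCont (\<lambda>l. energy_flow l c d (g l)) l"
proof -
  interpret s: prufer_system "\<lambda>_. 1" "\<lambda>x. l - q x" c d using assms by (intro energy_system) auto
  obtain K where K: "K \<ge> 0" "\<And>x. x \<in> {c..d} \<Longrightarrow> \<bar>(l - q x) - 1\<bar> \<le> K" using s.bound by blast
  let ?K = "exp (K * (d - c))"
  have "norm (energy_flow l' c d (g l') - energy_flow l c d (g l)) \<le> ?K * (\<bar>g l' - g l\<bar> + \<bar>l' - l\<bar> * ?K * (d - c))" for l'
  proof -
    interpret s': prufer_system "\<lambda>_. 1" "\<lambda>x. l' - q x" c d using assms by (intro energy_system) auto
    show ?thesis unfolding real_norm_def by (rule s.flow_lipschitz[OF s'.B _ K(2)]) auto
  qed
  moreover have "((\<lambda>l'. ?K * (\<bar>g l' - g l\<bar> + \<bar>l' - l\<bar> * ?K * (d - c))) \<longlongrightarrow> 0) (at l)"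
    using g unfolding isCont_def by (auto intro!: tendsto_eq_intros)
  ultimately have "((\<lambda>l'. energy_flow l' c d (g l') - energy_flow l c d (g l)) \<longlongrightarrow> 0) (at l)"
    by (rule Lim_null_comparison[OF always_eventually[OF allI]])
  then show ?thesis unfolding isCont_def by (rule LIM_zero_cancel)
qed

text \<open>
  The angle at \<open>a\<close> of the solution of \<open>- u'' + q u = l u\<close> with angle \<open>\<theta>\<close> at \<open>c\<close> and point interactions of
  strength \<open>\<sigma>\<close> at the points \<open>zs\<close>, listed in increasing order.
\<close>

fun total_angle :: "real \<Rightarrow> real \<Rightarrow> real list \<Rightarrow> real \<Rightarrow> real \<Rightarrow> real" where
  "total_angle l \<sigma> [] c \<theta> = energy_flow l c a \<theta>"
| "total_angle l \<sigma> (z # zs) c \<theta> = total_angle l \<sigma> zs z (jump \<sigma> (energy_flow l c z \<theta>))"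

definition nodes :: "real \<Rightarrow> real list \<Rightarrow> bool" where
  "nodes c zs \<longleftrightarrow> 0 \<le> c \<and> sorted_wrt (<) (c # zs @ [a])"

lemma nodes_Nil [simp]: "nodes c [] \<longleftrightarrow> 0 \<le> c \<and> c < a"
  by (simp add: nodes_def)

lemma nodes_Cons [simp]: "nodes c (z # zs) \<longleftrightarrow> 0 \<le> c \<and> c < z \<and> nodes z zs"
  unfolding nodes_def by (auto intro: less_trans)

lemma nodes_less: "nodes c zs \<Longrightarrow> c < a" "nodes c zs \<Longrightarrow> z \<in> set zs \<Longrightarrow> c < z" "nodes c zs \<Longrightarrow> z \<in> set zs \<Longrightarrow> z < a"
  "nodes c zs \<Longrightarrow> 0 \<le> c"
  unfolding nodes_def by (auto simp: sorted_wrt_append)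

text \<open>
  The total angle is a composition of energy flows and jumps, so the properties that both kinds of
  maps have are inherited by induction over the interaction points.
\<close>

lemma total_angle_mono:
  assumes "nodes c zs" "l \<le> l'" "\<theta> \<le> \<theta>'"
  shows "total_angle l \<sigma> zs c \<theta> \<le> total_angle l' \<sigma> zs c \<theta>'"
  using assms
proof (induction zs arbitrary: c \<theta> \<theta>')
  case Nil then show ?case by (auto intro: energy_flow_mono)
next
  case (Cons z zs)
  then show ?case using nodes_less(1)[of z zs]
    by (auto intro!: Cons.IH jump_mono energy_flow_mono)
qed

lemma total_angle_strict_mono:
  assumes "nodes c zs" "l < l'"
  shows "total_angle l \<sigma> zs c \<theta> < total_angle l' \<sigma> zs c \<theta>"
  using assms
proof (induction zs arbitrary: c \<theta>)
  case Nil then show ?case by (auto intro: energy_flow_strict_mono_energy)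
next
  case (Cons z zs)
  have "total_angle l \<sigma> zs z (jump \<sigma> (energy_flow l c z \<theta>)) < total_angle l' \<sigma> zs z (jump \<sigma> (energy_flow l c z \<theta>))"
    using Cons by auto
  also have "\<dots> \<le> total_angle l' \<sigma> zs z (jump \<sigma> (energy_flow l' c z \<theta>))"
    using Cons.prems nodes_less(1)[of z zs] by (intro total_angle_mono jump_mono energy_flow_mono) auto
  finally show ?case by simp
qed

lemma total_angle_gt_of_int_pi:
  assumes "nodes c zs" "of_int k * pi \<le> \<theta>"
  shows "of_int k * pi < total_angle l \<sigma> zs c \<theta>"
  using assms
proof (induction zs arbitrary: c \<theta>)
  case Nil then show ?case by (auto intro: energy_flow_gt_of_int_pi)
next
  case (Cons z zs)
  then have "of_int k * pi < energy_flow l c z \<theta>"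
    using nodes_less(1)[of z zs] by (intro energy_flow_gt_of_int_pi) auto
  then have "of_int k * pi \<le> jump \<sigma> (energy_flow l c z \<theta>)"
    using jump_mono[of "of_int k * pi" _ \<sigma>] by simp
  then show ?case using Cons by auto
qed

lemma total_angle_shift:
  assumes "nodes c zs"
  shows "total_angle l \<sigma> zs c (\<theta> + of_int k * pi) = total_angle l \<sigma> zs c \<theta> + of_int k * pi"
  using assms
proof (induction zs arbitrary: c \<theta>)
  case Nil
  then interpret s: prufer_system "\<lambda>_. 1" "\<lambda>x. l - q x" c a by (intro energy_system) auto
  show ?case by (simp add: s.flow_shift)
next
  case (Cons z zs)
  then interpret s: prufer_system "\<lambda>_. 1" "\<lambda>x. l - q x" c z
    using nodes_less(1)[of z zs] by (intro energy_system) auto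
  show ?case using Cons by (simp add: s.flow_shift jump_shift)
qed

lemma total_angle_continuous:
  assumes "nodes c zs" "isCont g l"
  shows "isCont (\<lambda>l. total_angle l \<sigma> zs c (g l)) l"
  using assms
proof (induction zs arbitrary: c g)
  case Nil then show ?case by (auto intro: energy_flow_continuous)
next
  case (Cons z zs)
  have "isCont (\<lambda>l. energy_flow l c z (g l)) l"
    using Cons.prems nodes_less(1)[of z zs] by (intro energy_flow_continuous) auto
  then have "isCont (\<lambda>l. jump \<sigma> (energy_flow l c z (g l))) l"
    by (rule isCont_o2[OF _ jump_continuous])
  then show ?case using Cons by auto
qed

lemma total_angle_le_half_pi:
  assumes "nodes c zs" "\<theta> \<le> pi / 2" "\<sigma> \<ge> 0" and l: "\<And>x. x \<in> {0..a} \<Longrightarrow> l \<le> q x"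
  shows "total_angle l \<sigma> zs c \<theta> \<le> pi / 2"
  using assms(1,2)
proof (induction zs arbitrary: c \<theta>)
  case Nil then show ?case using l energy_flow_le_half_pi[of c a \<theta> l] by simp
next
  case (Cons z zs)
  then have "energy_flow l c z \<theta> \<le> pi / 2"
    using l nodes_less(1)[of z zs] by (intro energy_flow_le_half_pi) auto
  then have "jump \<sigma> (energy_flow l c z \<theta>) \<le> pi / 2"
    using jump_le[OF assms(3)] order.trans by blast
  then show ?case using Cons by auto
qed

text \<open>
  The growth on the first interval suffices: jumps and later flows never take the angle back below a
  multiple of \<open>\<pi>\<close> that it has reached.
\<close>

lemma total_angle_unbounded:
  assumes "nodes c zs"
  shows "\<exists>l. real k * pi \<le> total_angle l \<sigma> zs c 0"
proof (cases zs)
  case Nil then show ?thesis using energy_flow_unbounded[of c a k] assms by auto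
next
  case (Cons z zs')
  then obtain L where "real k * pi \<le> energy_flow L c z 0"
    using energy_flow_unbounded[of c z k] assms nodes_less(1)[of z zs'] by auto
  then have "of_int (int k) * pi \<le> jump \<sigma> (energy_flow L c z 0)"
    using jump_mono[of "of_int (int k) * pi" "energy_flow L c z 0" \<sigma>] unfolding jump_of_int_pi by simp
  then have "of_int (int k) * pi < total_angle L \<sigma> zs' z (jump \<sigma> (energy_flow L c z 0))"
    using assms Cons by (intro total_angle_gt_of_int_pi) auto
  then show ?thesis using Cons by (auto intro!: exI[of _ L])
qed

text \<open>
  Repulsive interactions turn the angle back, hence can only raise eigenvalues.
\<close>

lemma total_angle_le_free:
  assumes "nodes c zs" "\<sigma> \<ge> 0"
  shows "total_angle l \<sigma> zs c \<theta> \<le> energy_flow l c a \<theta>"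
  using assms(1)
proof (induction zs arbitrary: c \<theta>)
  case (Cons z zs)
  then have za: "z < a" "0 \<le> c" "c < z" using nodes_less(1)[of z zs] by auto
  interpret s: prufer_system "\<lambda>_. 1" "\<lambda>x. l - q x" c a using za by (intro energy_system) auto
  have "total_angle l \<sigma> zs z (jump \<sigma> (energy_flow l c z \<theta>)) \<le> energy_flow l z a (jump \<sigma> (energy_flow l c z \<theta>))"
    using Cons by auto
  also have "\<dots> \<le> energy_flow l z a (energy_flow l c z \<theta>)"
    using za assms(2) by (intro energy_flow_mono jump_le) auto
  also have "\<dots> = energy_flow l c a \<theta>" using za by (intro s.flow_compose) auto
  finally show ?case by simp
qed simp

lemma total_angle_zero:
  assumes "nodes c zs"
  shows "total_angle l 0 zs c \<theta> = energy_flow l c a \<theta>"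
  using assms
proof (induction zs arbitrary: c \<theta>)
  case (Cons z zs)
  then have za: "z < a" "0 \<le> c" "c < z" using nodes_less(1)[of z zs] by auto
  interpret s: prufer_system "\<lambda>_. 1" "\<lambda>x. l - q x" c a using za by (intro energy_system) auto
  show ?case using Cons za s.flow_compose[of z \<theta>] by (auto simp: jump_zero)
qed simp

end

section \<open>Eigenfunctions and the total angle\<close>

lemma primitive_has_derivative:
  assumes "primitive c d F f" "continuous_on {c..d} f" "x \<in> {c<..<d}"
  shows "(F has_real_derivative f x) (at x)"
proof -
  have "((\<lambda>y. F c + integral {c..y} f) has_real_derivative 0 + f x) (at x within {c..d})"
    using assms by (intro DERIV_add DERIV_const integral_has_real_derivative) auto
  then have "(F has_real_derivative 0 + f x) (at x within {c..d})"
    by (rule has_field_derivative_transform_within[where d = 1])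
       (use assms in \<open>auto simp flip: primitive_eq[OF assms(1)]\<close>)
  then show ?thesis using assms(3) by (simp add: at_within_Icc_at)
qed

context bounded_potential begin

definition solution :: "real \<Rightarrow> real \<Rightarrow> real \<Rightarrow> (real \<Rightarrow> real) \<Rightarrow> (real \<Rightarrow> real) \<Rightarrow> bool" where
  "solution l c d u P \<longleftrightarrow> primitive c d u P \<and> primitive c d P (\<lambda>x. (q x - l) * u x)"

lemma solution_polar:
  assumes "solution l c d u P" "0 \<le> c" "c \<le> d" "d \<le> a" "u c = R * sin \<theta>" "P c = R * cos \<theta>"
  obtains \<rho> where "\<And>x. x \<in> {c..d} \<Longrightarrow> u x = \<rho> x * sin (energy_flow l c x \<theta>) \<and>
    P x = \<rho> x * cos (energy_flow l c x \<theta>) \<and> (\<rho> x = 0 \<longleftrightarrow> R = 0)"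
proof -
  interpret s: prufer_system "\<lambda>_. 1" "\<lambda>x. l - q x" c d using assms by (intro energy_system) auto
  have eq: "(\<lambda>t. 1 * P t) = P" "(\<lambda>t. - ((l - q t) * u t)) = (\<lambda>x. (q x - l) * u x)"
    by (auto simp: algebra_simps)
  show ?thesis
    using s.polar_coordinates[of u P R \<theta>] assms(1,5,6) that unfolding eq solution_def by blast
qed

lemma solution_exists:
  assumes "0 \<le> c" "c \<le> d" "d \<le> a"
  obtains u P where "solution l c d u P" "u c = u0" "P c = p0"
proof -
  interpret s: prufer_system "\<lambda>_. 1" "\<lambda>x. l - q x" c d using assms by (intro energy_system) auto
  obtain u P where "primitive c d u (\<lambda>t. 1 * P t)" "primitive c d P (\<lambda>t. - ((l - q t) * u t))" "u c = u0" "P c = p0"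
    using s.system_solution_exists .
  moreover have "(\<lambda>t. 1 * P t) = P" "(\<lambda>t. - ((l - q t) * u t)) = (\<lambda>x. (q x - l) * u x)"
    by (auto simp: algebra_simps)
  ultimately show ?thesis using that[of u P] by (simp add: solution_def)
qed

lemma solution_cong:
  assumes "solution l c d u P" "\<And>x. x \<in> {c..d} \<Longrightarrow> u x = w x"
  shows "solution l c d w P"
proof -
  have "primitive c d u P = primitive c d w P"
    by (rule primitive_cong) (simp_all add: assms(2))
  moreover have "primitive c d P (\<lambda>x. (q x - l) * u x) = primitive c d P (\<lambda>x. (q x - l) * w x)"
    by (rule primitive_cong) (simp_all add: assms(2))
  ultimately show ?thesis using assms(1) by (simp add: solution_def)
qed

text \<open>
  The boundary value problem in first order form: the function \<open>u\<close> solves the equation between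
  consecutive points, \<open>v\<close> is its right derivative at \<open>c\<close>, and the interaction at \<open>z\<close> prescribes the
  right derivative with which the next interval starts.
\<close>

fun shoot :: "real \<Rightarrow> real \<Rightarrow> real list \<Rightarrow> real \<Rightarrow> (real \<Rightarrow> real) \<Rightarrow> real \<Rightarrow> bool" where
  "shoot l \<sigma> [] c u v \<longleftrightarrow> (\<exists>P. solution l c a u P \<and> P c = v)"
| "shoot l \<sigma> (z # zs) c u v \<longleftrightarrow>
     (\<exists>P. solution l c z u P \<and> P c = v \<and> shoot l \<sigma> zs z u (P z + \<sigma> * u z))"

lemma shoot_cong:
  assumes "nodes c zs" "shoot l \<sigma> zs c u v" "\<And>x. x \<in> {c..a} \<Longrightarrow> u x = w x"
  shows "shoot l \<sigma> zs c w v"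
  using assms
proof (induction zs arbitrary: c v)
  case Nil
  then obtain P where "solution l c a u P" "P c = v" by auto
  then show ?case using solution_cong[of l c a u P w] Nil.prems(3) by auto
next
  case (Cons z zs)
  then have za: "z < a" "0 \<le> c" "c < z" using nodes_less(1)[of z zs] by auto
  obtain P where P: "solution l c z u P" "P c = v" "shoot l \<sigma> zs z u (P z + \<sigma> * u z)"
    using Cons.prems(2) by auto
  have "solution l c z w P" using solution_cong[OF P(1)] Cons.prems(3) za by auto
  moreover have "shoot l \<sigma> zs z w (P z + \<sigma> * u z)"
    using Cons.IH[OF _ P(3)] Cons.prems za by auto
  moreover have "u z = w z" using Cons.prems(3) za by auto
  ultimately show ?case using P(2) by auto
qed

text \<open>
  The angle of \<open>(u, u')\<close> is transported by \<open>solution_polar\<close> across intervals and by \<open>jump_polar\<close> across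
  interaction points.  The statement about \<open>R = 0\<close> is uniqueness of the trivial solution; it turns
  nontriviality of \<open>u\<close> into a nonzero initial slope.
\<close>

lemma shoot_polar:
  assumes "nodes c zs" "shoot l \<sigma> zs c u v" "u c = R * sin \<theta>" "v = R * cos \<theta>"
  shows "\<exists>R'. u a = R' * sin (total_angle l \<sigma> zs c \<theta>) \<and> (R' = 0 \<longleftrightarrow> R = 0) \<and> (R = 0 \<longrightarrow> (\<forall>x\<in>{c..a}. u x = 0))"
  using assms
proof (induction zs arbitrary: c v R \<theta>)
  case Nil
  then obtain P where P: "solution l c a u P" "P c = v" by auto
  obtain \<rho> where \<rho>: "\<And>x. x \<in> {c..a} \<Longrightarrow> u x = \<rho> x * sin (energy_flow l c x \<theta>) \<and>
    P x = \<rho> x * cos (energy_flow l c x \<theta>) \<and> (\<rho> x = 0 \<longleftrightarrow> R = 0)"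
    using solution_polar[OF P(1), of R \<theta>] Nil P by auto
  show ?case using \<rho>[of a] \<rho> Nil by (intro exI[of _ "\<rho> a"]) auto
next
  case (Cons z zs)
  then have za: "z < a" "0 \<le> c" "c < z" using nodes_less(1)[of z zs] by auto
  obtain P where P: "solution l c z u P" "P c = v" "shoot l \<sigma> zs z u (P z + \<sigma> * u z)"
    using Cons.prems(2) by auto
  obtain \<rho> where \<rho>: "\<And>x. x \<in> {c..z} \<Longrightarrow> u x = \<rho> x * sin (energy_flow l c x \<theta>) \<and>
    P x = \<rho> x * cos (energy_flow l c x \<theta>) \<and> (\<rho> x = 0 \<longleftrightarrow> R = 0)"
    using solution_polar[OF P(1), of R \<theta>] Cons.prems P za by auto
  obtain R1 where R1: "u z = R1 * sin (jump \<sigma> (energy_flow l c z \<theta>))"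
     "P z + \<sigma> * u z = R1 * cos (jump \<sigma> (energy_flow l c z \<theta>))" "R1 = 0 \<longleftrightarrow> \<rho> z = 0"
    using jump_polar[of "u z" "\<rho> z" "energy_flow l c z \<theta>" "P z" \<sigma>] \<rho>[of z] za by auto
  obtain R' where R': "u a = R' * sin (total_angle l \<sigma> zs z (jump \<sigma> (energy_flow l c z \<theta>)))"
    "R' = 0 \<longleftrightarrow> R1 = 0" "R1 = 0 \<longrightarrow> (\<forall>x\<in>{z..a}. u x = 0)"
    using Cons.IH[OF _ P(3) R1(1,2)] Cons.prems(1) by auto
  have iff: "\<rho> z = 0 \<longleftrightarrow> R = 0" using \<rho>[of z] za by simp
  have "u x = 0" if "R = 0" "x \<in> {c..a}" for x
  proof (cases "x \<le> z")
    case True then show ?thesis using \<rho>[of x] that by auto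
  next
    case False then show ?thesis using R'(3) R1(3) iff that by auto
  qed
  then show ?case using R' R1(3) iff by (intro exI[of _ R']) auto
qed

lemma shoot_exists:
  assumes "nodes c zs"
  shows "\<exists>u. shoot l \<sigma> zs c u v \<and> u c = u0"
  using assms
proof (induction zs arbitrary: c u0 v)
  case Nil
  then obtain u P where "solution l c a u P" "u c = u0" "P c = v"
    using solution_exists[of c a l u0 v] by (metis nodes_Nil order_refl less_imp_le)
  then show ?case by auto
next
  case (Cons z zs)
  then have za: "z < a" "0 \<le> c" "c < z" using nodes_less(1)[of z zs] by auto
  obtain u P where u: "solution l c z u P" "u c = u0" "P c = v"
    using solution_exists[of c z l u0 v] za by (metis less_imp_le)
  obtain w where w: "shoot l \<sigma> zs z w (P z + \<sigma> * u z)" "w z = u z"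
    using Cons by (metis nodes_Cons)
  define y where "y = (\<lambda>x. if x \<le> z then u x else w x)"
  have "solution l c z y P" by (rule solution_cong[OF u(1)]) (simp add: y_def)
  moreover have "shoot l \<sigma> zs z y (P z + \<sigma> * u z)"
  proof (rule shoot_cong[OF _ w(1)])
    show "w x = y x" if "x \<in> {z..a}" for x using that w(2) by (cases "x = z") (auto simp: y_def)
  qed (use Cons.prems in auto)
  moreover have "y z = u z" by (simp add: y_def)
  ultimately show ?case using u za by (intro exI[of _ y]) (auto simp: y_def)
qed

text \<open>
  Between two interaction points the given derivative \<open>u'\<close> agrees with a function \<open>P\<close> that is continuous
  up to the end points, namely an indefinite integral of the bounded function \<open>(q - l) u\<close>, which equals
  \<open>u''\<close> almost everywhere.  This supplies the one-sided limits of \<open>u'\<close> at both ends, including the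
  boundary points \<open>0\<close> and \<open>a\<close>.
\<close>

lemma regular_piece:
  assumes cd: "0 \<le> c" "c < d" "d \<le> a" and cont: "continuous_on {c..d} u"
    and der: "\<And>x. x \<in> {c<..<d} \<Longrightarrow> (u has_real_derivative u' x) (at x)"
    and int: "integrable (lebesgue_on {0..a}) u''"
    and inc: "\<And>s t. s \<le> t \<Longrightarrow> {s..t} \<subseteq> {c<..<d} \<Longrightarrow> u' t - u' s = (\<integral>x. u'' x \<partial>lebesgue_on {s..t})"
    and eq: "AE x in lebesgue_on {0..a}. - u'' x + q x * u x = l * u x"
  obtains P where "solution l c d u P" "(u' \<longlongrightarrow> P c) (at_right c)" "(u' \<longlongrightarrow> P d) (at_left d)"
proof -
  define g where "g = (\<lambda>x. (q x - l) * u x)"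
  have g: "bounded_measurable c d g"
    unfolding g_def using cd
    by (intro bounded_measurable_intros bounded_measurable_continuous cont bounded_measurable_subset[OF q_bm])
  have inc': "u' t - u' s = integral {s..t} g" if "s \<le> t" "{s..t} \<subseteq> {c<..<d}" for s t
  proof -
    have sub: "{s..t} \<subseteq> {0..a}" using that cd by auto
    have gst: "bounded_measurable s t g"
      using that by (intro bounded_measurable_subset[OF g]) auto
    have "AE x in lebesgue_on {s..t}. u'' x = g x"
    proof -
      have "AE x in lebesgue. x \<in> {0..a} \<longrightarrow> - u'' x + q x * u x = l * u x"
        using eq by (simp add: AE_restrict_space_iff)
      then have "AE x in lebesgue. x \<in> {s..t} \<longrightarrow> u'' x = g x"
        by eventually_elim (use sub in \<open>auto simp: g_def algebra_simps\<close>)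
      then show ?thesis by (simp add: AE_restrict_space_iff)
    qed
    then have "(\<integral>x. u'' x \<partial>lebesgue_on {s..t}) = (\<integral>x. g x \<partial>lebesgue_on {s..t})"
      using measurable_restrict_mono[OF borel_measurable_integrable[OF int] sub] gst
      by (intro integral_cong_AE) (auto simp: bounded_measurable_def)
    also have "\<dots> = integral {s..t} g"
      by (intro lebesgue_integral_eq_integral bounded_measurable_lebesgue_integrable gst) auto
    finally show ?thesis using inc[OF that] by simp
  qed
  define m where "m = (c + d) / 2"
  have m: "c < m" "m < d" using cd by (auto simp: m_def)
  \<comment> \<open>The constant makes \<open>P\<close> agree with \<open>u'\<close> at the midpoint.\<close>
  define P where "P = (\<lambda>x. (u' m - integral {c..m} g) + integral {c..x} g)"
  have P: "primitive c d P g" unfolding P_def by (rule primitive_integral[OF g])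
  have Pu': "P x = u' x" if "x \<in> {c<..<d}" for x
  proof (cases "x \<le> m")
    case True
    then have "{x..m} \<subseteq> {c<..<d}" using m that by auto
    then have "P m - P x = u' m - u' x"
      using primitive_diff[OF P, of x m] inc'[of x m] m that True by auto
    then show ?thesis by (simp add: P_def)
  next
    case False
    then have "{m..x} \<subseteq> {c<..<d}" using m that by auto
    then have "P x - P m = u' x - u' m"
      using primitive_diff[OF P, of m x] inc'[of m x] m that False by auto
    then show ?thesis by (simp add: P_def)
  qed
  have Pc: "continuous_on {c..d} P" by (rule primitive_continuous_on[OF P])
  have "primitive c d u P"
  proof (rule primitiveI[OF bounded_measurable_continuous[OF Pc]])
    fix x assume x: "x \<in> {c..d}"
    have "(P has_integral (u x - u c)) {c..x}"
    proof (rule fundamental_theorem_of_calculus_interior)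
      show "continuous_on {c..x} u" using cont x by (auto intro: continuous_on_subset)
      show "(u has_vector_derivative P y) (at y)" if "y \<in> {c<..<x}" for y
        using der[of y] Pu'[of y] that x by (simp add: has_real_derivative_iff_has_vector_derivative)
    qed (use x in auto)
    then show "u x = u c + integral {c..x} P" by (simp add: integral_unique)
  qed
  then have "solution l c d u P" using P by (simp add: solution_def g_def)
  moreover have "(u' \<longlongrightarrow> P c) (at_right c)"
    using continuous_on_Icc_at_rightD[OF Pc cd(2)]
    by (rule Lim_transform_eventually) (use Pu' eventually_at_right_real[OF cd(2)] in \<open>auto elim: eventually_mono\<close>)
  moreover have "(u' \<longlongrightarrow> P d) (at_left d)"
    using continuous_on_Icc_at_leftD[OF Pc cd(2)]
    by (rule Lim_transform_eventually) (use Pu' eventually_at_left_real[OF cd(2)] in \<open>auto elim: eventually_mono\<close>)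
  ultimately show ?thesis using that by blast
qed

lemma shoot_if_regular:
  assumes "nodes c zs" and cont: "continuous_on {0..a} u"
    and der: "\<And>x. x \<in> {c<..<a} - set zs \<Longrightarrow> (u has_real_derivative u' x) (at x)"
    and int: "integrable (lebesgue_on {0..a}) u''"
    and inc: "\<And>s t. s \<le> t \<Longrightarrow> {s..t} \<subseteq> {c<..<a} - set zs \<Longrightarrow> u' t - u' s = (\<integral>x. u'' x \<partial>lebesgue_on {s..t})"
    and eq: "AE x in lebesgue_on {0..a}. - u'' x + q x * u x = l * u x"
    and jumps: "\<And>z. z \<in> set zs \<Longrightarrow> \<exists>l r. (u' \<longlongrightarrow> l) (at_left z) \<and> (u' \<longlongrightarrow> r) (at_right z) \<and> r - l = \<sigma> * u z"
  shows "\<exists>v. (u' \<longlongrightarrow> v) (at_right c) \<and> shoot l \<sigma> zs c u v"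
  using assms(1) der inc jumps
proof (induction zs arbitrary: c)
  case Nil
  obtain P where "solution l c a u P" "(u' \<longlongrightarrow> P c) (at_right c)" "(u' \<longlongrightarrow> P a) (at_left a)"
  proof (rule regular_piece[of c a u u' u'' l])
    show "continuous_on {c..a} u" using cont Nil.prems(1) by (auto intro: continuous_on_subset)
  qed (use Nil.prems int eq in auto)
  then show ?case by auto
next
  case (Cons z zs)
  then have za: "z < a" "0 \<le> c" "c < z" using nodes_less(1)[of z zs] by auto
  have zs: "z < z'" if "z' \<in> set zs" for z' using nodes_less(2)[of z zs] Cons.prems(1) that by auto
  obtain v where v: "(u' \<longlongrightarrow> v) (at_right z)" "shoot l \<sigma> zs z u v"
  proof -
    have "\<exists>v. (u' \<longlongrightarrow> v) (at_right z) \<and> shoot l \<sigma> zs z u v"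
    proof (rule Cons.IH)
      show "nodes z zs" using Cons.prems(1) by simp
      show "(u has_real_derivative u' x) (at x)" if "x \<in> {z<..<a} - set zs" for x
        using that za by (intro Cons.prems(2)) auto
      show "u' t - u' s = (\<integral>x. u'' x \<partial>lebesgue_on {s..t})" if "s \<le> t" "{s..t} \<subseteq> {z<..<a} - set zs" for s t
        using that za by (intro Cons.prems(3)) auto
    qed (use Cons.prems(4) in auto)
    then show ?thesis using that by blast
  qed
  obtain P where P: "solution l c z u P" "(u' \<longlongrightarrow> P c) (at_right c)" "(u' \<longlongrightarrow> P z) (at_left z)"
  proof (rule regular_piece[of c z u u' u'' l])
    show "continuous_on {c..z} u" using cont za by (auto intro: continuous_on_subset)
    show "(u has_real_derivative u' x) (at x)" if "x \<in> {c<..<z}" for x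
      using that za zs by (intro Cons.prems(2)) force
    show "u' t - u' s = (\<integral>x. u'' x \<partial>lebesgue_on {s..t})" if "s \<le> t" "{s..t} \<subseteq> {c<..<z}" for s t
      using that za zs by (intro Cons.prems(3)) force+
  qed (use za int eq in auto)
  obtain l0 r where "(u' \<longlongrightarrow> l0) (at_left z)" "(u' \<longlongrightarrow> r) (at_right z)" "r - l0 = \<sigma> * u z"
    using Cons.prems(4)[of z] by auto
  moreover from this have "l0 = P z" "r = v"
    using P(3) v(1) by (auto intro: tendsto_unique[OF trivial_limit_at_left_real] tendsto_unique[OF trivial_limit_at_right_real])
  ultimately have "v = P z + \<sigma> * u z" by simp
  then show ?case using v P by auto
qed

lemma regular_if_shoot:
  assumes "nodes c zs" "shoot l \<sigma> zs c u v"
  shows "\<exists>u'. continuous_on {c..a} u \<and>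
    (\<forall>x\<in>{c<..<a} - set zs. (u has_real_derivative u' x) (at x)) \<and>
    (\<forall>s t. s \<le> t \<and> {s..t} \<subseteq> {c<..<a} - set zs \<longrightarrow> u' t - u' s = integral {s..t} (\<lambda>x. (q x - l) * u x)) \<and>
    (\<forall>z\<in>set zs. \<exists>l r. (u' \<longlongrightarrow> l) (at_left z) \<and> (u' \<longlongrightarrow> r) (at_right z) \<and> r - l = \<sigma> * u z) \<and>
    (u' \<longlongrightarrow> v) (at_right c)"
  using assms
proof (induction zs arbitrary: c v)
  case Nil
  then obtain P where P: "primitive c a u P" "primitive c a P (\<lambda>x. (q x - l) * u x)" "P c = v"
    by (auto simp: solution_def)
  have Pc: "continuous_on {c..a} P" by (rule primitive_continuous_on[OF P(2)])
  show ?case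
  proof (intro exI[of _ P] conjI ballI allI impI)
    show "(P \<longlongrightarrow> v) (at_right c)" using continuous_on_Icc_at_rightD[OF Pc] Nil P(3) by auto
    show "P t - P s = integral {s..t} (\<lambda>x. (q x - l) * u x)" if "s \<le> t \<and> {s..t} \<subseteq> {c<..<a} - set []" for s t
    proof -
      have "s \<in> {c<..<a}" "t \<in> {c<..<a}"
        using subsetD[OF conjunct2[OF that], of s] subsetD[OF conjunct2[OF that], of t] that by auto
      then show ?thesis using primitive_diff[OF P(2), of s t] that by auto
    qed
  qed (use primitive_continuous_on[OF P(1)] primitive_has_derivative[OF P(1) Pc] in auto)
next
  case (Cons z zs)
  then have za: "z < a" "0 \<le> c" "c < z" using nodes_less(1)[of z zs] by auto
  have zs: "z < z'" if "z' \<in> set zs" for z' using nodes_less(2)[of z zs] Cons.prems(1) that by auto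
  obtain P where P: "primitive c z u P" "primitive c z P (\<lambda>x. (q x - l) * u x)" "P c = v"
    and sh: "shoot l \<sigma> zs z u (P z + \<sigma> * u z)"
    using Cons.prems(2) by (auto simp: solution_def)
  have Pc: "continuous_on {c..z} P" by (rule primitive_continuous_on[OF P(2)])
  obtain w where w: "continuous_on {z..a} u"
    "\<And>x. x \<in> {z<..<a} - set zs \<Longrightarrow> (u has_real_derivative w x) (at x)"
    "\<And>s t. s \<le> t \<Longrightarrow> {s..t} \<subseteq> {z<..<a} - set zs \<Longrightarrow> w t - w s = integral {s..t} (\<lambda>x. (q x - l) * u x)"
    "\<And>z. z \<in> set zs \<Longrightarrow> \<exists>l r. (w \<longlongrightarrow> l) (at_left z) \<and> (w \<longlongrightarrow> r) (at_right z) \<and> r - l = \<sigma> * u z"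
    "(w \<longlongrightarrow> P z + \<sigma> * u z) (at_right z)"
  proof -
    have "nodes z zs" using Cons.prems(1) by simp
    from Cons.IH[OF this sh] show ?thesis using that by blast
  qed
  define u' where "u' = (\<lambda>x. if x < z then P x else w x)"
  have right: "(u' \<longlongrightarrow> r) (at_right y)" if "z \<le> y" "(w \<longlongrightarrow> r) (at_right y)" for y r
    using that(2) by (rule Lim_transform_eventually)
      (use that(1) in \<open>auto simp: u'_def eventually_at_filter\<close>)
  have left: "(u' \<longlongrightarrow> r) (at_left y)" if "z < y" "(w \<longlongrightarrow> r) (at_left y)" for y r
    using that(2) by (rule Lim_transform_eventually)
      (use eventually_at_left_real[OF that(1)] in \<open>auto simp: u'_def elim!: eventually_mono\<close>)
  show ?case
  proof (intro exI[of _ u'] conjI ballI allI impI)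
    have "continuous_on ({c..z} \<union> {z..a}) u"
      by (intro continuous_on_closed_Un w(1) primitive_continuous_on[OF P(1)]) auto
    moreover have "{c..z} \<union> {z..a} = {c..a}" using za by auto
    ultimately show "continuous_on {c..a} u" by simp
    show "(u has_real_derivative u' x) (at x)" if x: "x \<in> {c<..<a} - set (z # zs)" for x
      using w(2)[of x] primitive_has_derivative[OF P(1) Pc, of x] x by (cases "x < z") (auto simp: u'_def)
    show "u' t - u' s = integral {s..t} (\<lambda>x. (q x - l) * u x)"
      if st: "s \<le> t \<and> {s..t} \<subseteq> {c<..<a} - set (z # zs)" for s t
    proof -
      have ends: "s \<in> {c<..<a}" "t \<in> {c<..<a}" using st by auto
      have "z \<notin> {s..t}" using st by auto
      then consider "t < z" | "z < s" by force
      then show ?thesis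
      proof cases
        case 1
        then show ?thesis using primitive_diff[OF P(2), of s t] st ends by (simp add: u'_def)
      next
        case 2
        then have "{s..t} \<subseteq> {z<..<a} - set zs" using st by auto
        then show ?thesis using w(3)[of s t] st 2 by (simp add: u'_def)
      qed
    qed
    show "(u' \<longlongrightarrow> v) (at_right c)"
      using continuous_on_Icc_at_rightD[OF Pc za(3)] unfolding P(3)
      by (rule Lim_transform_eventually)
         (use eventually_at_right_real[OF za(3)] in \<open>auto simp: u'_def elim!: eventually_mono\<close>)
    show "\<exists>l r. (u' \<longlongrightarrow> l) (at_left y) \<and> (u' \<longlongrightarrow> r) (at_right y) \<and> r - l = \<sigma> * u y" if "y \<in> set (z # zs)" for y
    proof (cases "y = z")
      case True
      have "(u' \<longlongrightarrow> P z) (at_left z)"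
        using continuous_on_Icc_at_leftD[OF Pc za(3)]
        by (rule Lim_transform_eventually)
           (use eventually_at_left_real[OF za(3)] in \<open>auto simp: u'_def elim!: eventually_mono\<close>)
      then show ?thesis using right[OF _ w(5)] True by (intro exI[of _ "P z"] exI[of _ "P z + \<sigma> * u z"]) auto
    next
      case False
      then have y: "y \<in> set zs" "z < y" using that zs by auto
      then obtain l0 r0 where "(w \<longlongrightarrow> l0) (at_left y)" "(w \<longlongrightarrow> r0) (at_right y)" "r0 - l0 = \<sigma> * u y"
        using w(4) by blast
      then show ?thesis using left[OF y(2)] right[of y] y(2) by (intro exI[of _ l0] exI[of _ r0]) auto
    qed
  qed
qed

lemma SL_operator_iff_shoot:
  assumes "nodes 0 zs"
  shows "SL_operator a q (set zs) \<sigma> u (\<lambda>x. l * u x) \<longleftrightarrow> u 0 = 0 \<and> u a = 0 \<and> (\<exists>v. shoot l \<sigma> zs 0 u v)"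
proof
  assume "SL_operator a q (set zs) \<sigma> u (\<lambda>x. l * u x)"
  then obtain u' u'' where *: "continuous_on {0..a} u" "u 0 = 0" "u a = 0"
    "\<And>x. x \<in> {0<..<a} - set zs \<Longrightarrow> (u has_real_derivative u' x) (at x)"
    "integrable (lebesgue_on {0..a}) u''"
    "\<And>s t. s \<le> t \<Longrightarrow> {s..t} \<subseteq> {0<..<a} - set zs \<Longrightarrow> u' t - u' s = (\<integral>x. u'' x \<partial>lebesgue_on {s..t})"
    "AE x in lebesgue_on {0..a}. - u'' x + q x * u x = l * u x"
    "\<And>z. z \<in> set zs \<Longrightarrow> \<exists>l r. (u' \<longlongrightarrow> l) (at_left z) \<and> (u' \<longlongrightarrow> r) (at_right z) \<and> r - l = \<sigma> * u z"
    unfolding SL_operator_def by blast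
  show "u 0 = 0 \<and> u a = 0 \<and> (\<exists>v. shoot l \<sigma> zs 0 u v)"
    using shoot_if_regular[OF assms *(1,4,5,6,7,8)] *(2,3) by blast
next
  assume R: "u 0 = 0 \<and> u a = 0 \<and> (\<exists>v. shoot l \<sigma> zs 0 u v)"
  let ?g = "\<lambda>x. (q x - l) * u x"
  from R obtain v where "shoot l \<sigma> zs 0 u v" by blast
  from regular_if_shoot[OF assms this] obtain u' where u': "continuous_on {0..a} u"
    "\<And>x. x \<in> {0<..<a} - set zs \<Longrightarrow> (u has_real_derivative u' x) (at x)"
    "\<And>s t. s \<le> t \<Longrightarrow> {s..t} \<subseteq> {0<..<a} - set zs \<Longrightarrow> u' t - u' s = integral {s..t} ?g"
    "\<And>z. z \<in> set zs \<Longrightarrow> \<exists>l r. (u' \<longlongrightarrow> l) (at_left z) \<and> (u' \<longlongrightarrow> r) (at_right z) \<and> r - l = \<sigma> * u z"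
    by blast
  have g: "bounded_measurable 0 a ?g"
    by (intro bounded_measurable_intros q_bm bounded_measurable_continuous u'(1))
  have L2: "L2_on {0..a} (\<lambda>x. l * u x)"
  proof -
    have "bounded_measurable 0 a (\<lambda>x. l * u x)" "bounded_measurable 0 a (\<lambda>x. (l * u x)\<^sup>2)"
      by (auto intro!: bounded_measurable_continuous continuous_intros u'(1))
    then show ?thesis
      using bounded_measurable_lebesgue_integrable unfolding L2_on_def bounded_measurable_def by blast
  qed
  have seg: "u' t - u' s = (\<integral>x. ?g x \<partial>lebesgue_on {s..t})" if "s \<le> t" "{s..t} \<subseteq> {0<..<a} - set zs" for s t
  proof -
    have "s \<in> {0<..<a}" "t \<in> {0<..<a}" using that by auto
    then have "bounded_measurable s t ?g" by (intro bounded_measurable_subset[OF g]) auto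
    then show ?thesis using u'(3)[OF that]
      by (subst lebesgue_integral_eq_integral) (auto intro: bounded_measurable_lebesgue_integrable)
  qed
  have ae: "AE x in lebesgue_on {0..a}. - ?g x + q x * u x = l * u x" by (simp add: algebra_simps)
  show "SL_operator a q (set zs) \<sigma> u (\<lambda>x. l * u x)"
    unfolding SL_operator_def
    by (intro conjI u'(1) L2 R[THEN conjunct1] R[THEN conjunct2, THEN conjunct1],
        rule exI[of _ u'], rule exI[of _ ?g],
        intro conjI ballI allI impI u'(2,4) ae bounded_measurable_lebesgue_integrable[OF g])
      (auto intro!: seg)
qed

lemma shoot_nontrivial:
  assumes "nodes 0 zs" "shoot l \<sigma> zs 0 u 1" "u 0 = 0"
  shows "\<exists>x\<in>{0..a}. u x \<noteq> 0"
proof (rule ccontr)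
  assume "\<not> ?thesis"
  then have u0: "u x = 0" if "x \<in> {0..a}" for x using that by auto
  obtain d P where d: "0 < d" "d \<le> a" and P: "primitive 0 d u P" "primitive 0 d P (\<lambda>x. (q x - l) * u x)" "P 0 = 1"
  proof (cases zs)
    case Nil then show ?thesis using that[of a] assms by (auto simp: solution_def)
  next
    case (Cons z zs')
    then show ?thesis using that[of z] assms nodes_less(1)[of z zs'] by (auto simp: solution_def)
  qed
  have P1: "P x = 1" if "x \<in> {0..d}" for x
  proof -
    have "integral {0..x} (\<lambda>x. (q x - l) * u x) = integral {0..x} (\<lambda>_. 0)"
      using that d u0 by (intro Henstock_Kurzweil_Integration.integral_cong) auto
    then show ?thesis using primitive_eq[OF P(2) that] P(3) by simp
  qed
  have "integral {0..d} P = integral {0..d} (\<lambda>_. 1)"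
    using P1 by (intro Henstock_Kurzweil_Integration.integral_cong) auto
  then have "u d = u 0 + d" using primitive_eq[OF P(1), of d] d by simp
  then show False using u0 d by simp
qed

text \<open>
  The shooting method: the solution with initial angle \<open>0\<close> satisfies the left boundary condition, and the
  right one holds iff its final angle is a multiple of \<open>\<pi>\<close>.
\<close>

theorem SL_spectrum_iff:
  assumes "nodes 0 zs"
  shows "l \<in> SL_spectrum a q (set zs) \<sigma> \<longleftrightarrow> (\<exists>k::int. total_angle l \<sigma> zs 0 0 = of_int k * pi)"
proof
  assume "l \<in> SL_spectrum a q (set zs) \<sigma>"
  then obtain u v where u: "u 0 = 0" "u a = 0" "shoot l \<sigma> zs 0 u v" "\<exists>x\<in>{0..a}. u x \<noteq> 0"
    unfolding SL_spectrum_def SL_eigenfunction_def using SL_operator_iff_shoot[OF assms] by blast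
  obtain R where R: "u a = R * sin (total_angle l \<sigma> zs 0 0)" "R = 0 \<longleftrightarrow> v = 0" "v = 0 \<longrightarrow> (\<forall>x\<in>{0..a}. u x = 0)"
    using shoot_polar[OF assms u(3), of v 0] u(1) by auto
  then have "sin (total_angle l \<sigma> zs 0 0) = 0" using u by auto
  then show "\<exists>k::int. total_angle l \<sigma> zs 0 0 = of_int k * pi" by (simp add: sin_zero_iff_int2)
next
  assume "\<exists>k::int. total_angle l \<sigma> zs 0 0 = of_int k * pi"
  then have s: "sin (total_angle l \<sigma> zs 0 0) = 0" by (simp add: sin_zero_iff_int2)
  obtain u where u: "shoot l \<sigma> zs 0 u 1" "u 0 = 0" using shoot_exists[OF assms] by blast
  have "u a = 0" using shoot_polar[OF assms u(1), of 1 0] u(2) s by auto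
  then have "SL_eigenfunction a q (set zs) \<sigma> l u"
    unfolding SL_eigenfunction_def
    using SL_operator_iff_shoot[OF assms] u shoot_nontrivial[OF assms u] by blast
  then show "l \<in> SL_spectrum a q (set zs) \<sigma>" by (auto simp: SL_spectrum_def)
qed

lemma Dirichlet_eigenfunction_zero_iff:
  assumes "Dirichlet_eigenfunction a q l u" "x \<in> {0..a}"
  shows "u x = 0 \<longleftrightarrow> (\<exists>k::int. energy_flow l 0 x 0 = of_int k * pi)"
proof -
  have n: "nodes 0 []" using a_pos by simp
  obtain v where u: "u 0 = 0" "shoot l 0 [] 0 u v" "\<exists>x\<in>{0..a}. u x \<noteq> 0"
    using assms(1) SL_operator_iff_shoot[OF n, of 0 u l] unfolding SL_eigenfunction_def by auto
  then obtain P where P: "solution l 0 a u P" "P 0 = v" by auto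
  obtain \<rho> where \<rho>: "\<And>x. x \<in> {0..a} \<Longrightarrow> u x = \<rho> x * sin (energy_flow l 0 x 0) \<and>
    P x = \<rho> x * cos (energy_flow l 0 x 0) \<and> (\<rho> x = 0 \<longleftrightarrow> v = 0)"
    using solution_polar[OF P(1), of v 0] u P a_pos by auto
  have "v \<noteq> 0" using \<rho> u(3) by auto
  then have "u x = 0 \<longleftrightarrow> sin (energy_flow l 0 x 0) = 0" using \<rho>[OF assms(2)] by auto
  then show ?thesis by (simp add: sin_zero_iff_int2)
qed

end

text \<open>
  Changing the potential on a null set does not affect the operators, so it may be assumed to be bounded
  everywhere; at the end points, where it is not given, it is set to \<open>0\<close>.
\<close>

lemma Linf_on_representative:
  assumes "Linf_on {0<..<a} q"
  obtains q' where "bounded_measurable 0 a q'" "AE x in lebesgue_on {0..a}. q x = q' x"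
proof -
  obtain C where C: "AE x in lebesgue_on {0<..<a}. \<bar>q x\<bar> \<le> C" using assms by (auto simp: Linf_on_def)
  define q' where "q' = (\<lambda>x. if x \<in> {0<..<a} then (if \<bar>q x\<bar> \<le> C then q x else 0) else 0)"
  have [measurable]: "q \<in> borel_measurable (lebesgue_on {0<..<a})" using assms by (simp add: Linf_on_def)
  have "(\<lambda>x. if \<bar>q x\<bar> \<le> C then q x else 0) \<in> borel_measurable (lebesgue_on {0<..<a})" by measurable
  then have "q' \<in> borel_measurable lebesgue" unfolding q'_def by (rule borel_measurable_if_I) simp
  then have "q' \<in> borel_measurable (lebesgue_on {0..a})" by (rule measurable_restrict_space1)
  moreover have "\<bar>q' x\<bar> \<le> \<bar>C\<bar>" for x by (auto simp: q'_def)
  ultimately have "bounded_measurable 0 a q'" by (auto simp: bounded_measurable_def)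
  moreover have "AE x in lebesgue_on {0..a}. q x = q' x"
  proof -
    have "AE x in lebesgue. x \<in> {0<..<a} \<longrightarrow> \<bar>q x\<bar> \<le> C" using C by (simp add: AE_restrict_space_iff)
    moreover have "AE x in lebesgue. x \<noteq> 0" "AE x in lebesgue. x \<noteq> a"
      using AE_lborel_singleton by (auto intro: AE_completion)
    ultimately have "AE x in lebesgue. x \<in> {0..a} \<longrightarrow> q x = q' x"
      by eventually_elim (auto simp: q'_def)
    then show ?thesis by (simp add: AE_restrict_space_iff)
  qed
  ultimately show ?thesis using that by blast
qed

lemma SL_operator_cong_AE:
  assumes "AE x in lebesgue_on {0..a}. q x = q' x"
  shows "SL_operator a q = SL_operator a q'"
proof -
  have "(AE x in lebesgue_on {0..a}. - u'' x + q x * u x = f x) \<longleftrightarrow>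
        (AE x in lebesgue_on {0..a}. - u'' x + q' x * u x = f x)" for u'' u f :: "real \<Rightarrow> real"
    by (intro eventually_subst, use assms in eventually_elim) simp
  then show ?thesis unfolding SL_operator_def[abs_def] by (simp only: cong: conj_cong)
qed

section \<open>Enumeration of the eigenvalues\<close>

context bounded_potential begin

lemma total_angle_le_iff:
  "nodes c zs \<Longrightarrow> total_angle l \<sigma> zs c \<theta> \<le> total_angle l' \<sigma> zs c \<theta> \<longleftrightarrow> l \<le> l'"
  using total_angle_strict_mono[of c zs l' l \<sigma> \<theta>] total_angle_mono[of c zs l l' \<theta> \<theta> \<sigma>]
  by (cases "l \<le> l'") auto

lemma total_angle_eq_iff:
  "nodes c zs \<Longrightarrow> total_angle l \<sigma> zs c \<theta> = total_angle l' \<sigma> zs c \<theta> \<longleftrightarrow> l = l'"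
  using total_angle_le_iff[of c zs l \<sigma> \<theta> l'] total_angle_le_iff[of c zs l' \<sigma> \<theta> l] by auto

lemma total_angle_attains:
  assumes "nodes 0 zs" "\<sigma> \<ge> 0" "m \<ge> 1"
  shows "\<exists>l. total_angle l \<sigma> zs 0 0 = real m * pi"
proof -
  obtain Q where Q: "\<And>x. x \<in> {0..a} \<Longrightarrow> \<bar>q x\<bar> \<le> Q" using bounded_measurable_bound[OF q_bm] by blast
  obtain l1 where l1: "real m * pi \<le> total_angle l1 \<sigma> zs 0 0" using total_angle_unbounded[OF assms(1)] by blast
  have "- Q \<le> q x" if "x \<in> {0..a}" for x using Q[OF that] by auto
  then have "total_angle (- Q) \<sigma> zs 0 0 \<le> pi / 2"
    using assms by (intro total_angle_le_half_pi) auto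
  also have "\<dots> \<le> 1 * pi" by simp
  also have "\<dots> \<le> real m * pi" using assms(3) by (intro mult_right_mono) auto
  finally have l0: "total_angle (- Q) \<sigma> zs 0 0 \<le> real m * pi" .
  then have "- Q \<le> l1" using l1 total_angle_le_iff[OF assms(1)] order.trans by blast
  then show ?thesis
    using IVT[of "\<lambda>l. total_angle l \<sigma> zs 0 0" "- Q" "real m * pi" l1] l0 l1
      total_angle_continuous[OF assms(1), where g = "\<lambda>_. 0"] by auto
qed

text \<open>
  Sturm's oscillation theorem.  The total angle is positive, continuous, strictly increasing and unbounded
  in the energy, and it is at most \<open>\<pi> / 2\<close> at low energies; so it takes each value \<open>j \<pi>\<close>, \<open>j \<ge> 1\<close>, at
  exactly one energy \<open>e j\<close>.  These energies form the spectrum, and \<open>e 1, \<dots>, e (m - 1)\<close> are the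
  ones below \<open>e m\<close>.
\<close>

lemma SL_eigenvalue_eqI:
  assumes n: "nodes 0 zs" and "\<sigma> \<ge> 0" "m \<ge> 1" and l: "total_angle l \<sigma> zs 0 0 = real m * pi"
  shows "SL_eigenvalue a q (set zs) \<sigma> m = l"
proof -
  let ?T = "\<lambda>l. total_angle l \<sigma> zs 0 0"
  let ?S = "SL_spectrum a q (set zs) \<sigma>"
  obtain e where e: "\<And>j. j \<ge> 1 \<Longrightarrow> ?T (e j) = real j * pi"
    using total_angle_attains[OF n assms(2)] by metis
  have spec: "l' \<in> ?S \<longleftrightarrow> (\<exists>j\<ge>1. ?T l' = real j * pi)" for l'
  proof
    assume "l' \<in> ?S"
    then obtain k :: int where k: "?T l' = of_int k * pi" using SL_spectrum_iff[OF n] by auto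
    have "?T l' > of_int 0 * pi" by (rule total_angle_gt_of_int_pi[OF n]) simp
    then have "k > 0" using k by (simp add: zero_less_mult_iff)
    then show "\<exists>j\<ge>1. ?T l' = real j * pi" using k by (intro exI[of _ "nat k"]) auto
  next
    assume "\<exists>j\<ge>1. ?T l' = real j * pi"
    then obtain j where "?T l' = of_int (int j) * pi" by auto
    then show "l' \<in> ?S" using SL_spectrum_iff[OF n] by blast
  qed
  have less: "l1 < l2 \<longleftrightarrow> ?T l1 < ?T l2" for l1 l2
    using total_angle_le_iff[OF n, of l2 \<sigma> 0 l1] by (simp add: not_le[symmetric])
  have below: "finite {l'' \<in> ?S. l'' < l'} \<and> card {l'' \<in> ?S. l'' < l'} + 1 = j"
    if j: "j \<ge> 1" "?T l' = real j * pi" for l' j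
  proof -
    have eq: "{l'' \<in> ?S. l'' < l'} = e ` {1..<j}"
    proof (intro set_eqI iffI)
      fix x assume "x \<in> {l'' \<in> ?S. l'' < l'}"
      then obtain i where i: "i \<ge> 1" "?T x = real i * pi" "x < l'" using spec by auto
      then have "i < j" using less[of x l'] j by simp
      moreover have "x = e i" using total_angle_eq_iff[OF n, of x \<sigma> 0 "e i"] i e[of i] by simp
      ultimately show "x \<in> e ` {1..<j}" using i by auto
    next
      fix x assume "x \<in> e ` {1..<j}"
      then obtain i where "1 \<le> i" "i < j" "x = e i" by auto
      then show "x \<in> {l'' \<in> ?S. l'' < l'}" using spec e[of i] less[of x l'] j by auto
    qed
    have "inj_on e {1..<j}"
    proof (rule inj_onI)
      fix x y assume xy: "x \<in> {1..<j}" "y \<in> {1..<j}" "e x = e y"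
      then have "real x * pi = ?T (e x)" by (intro e[symmetric]) auto
      also have "\<dots> = real y * pi" unfolding xy(3) using xy(2) by (intro e) auto
      finally show "x = y" by simp
    qed
    then show ?thesis unfolding eq using j by (simp add: card_image)
  qed
  show ?thesis
    unfolding SL_eigenvalue_def
  proof (rule the_equality)
    show "l \<in> ?S \<and> finite {l' \<in> ?S. l' < l} \<and> card {l' \<in> ?S. l' < l} + 1 = m"
      using spec below[OF assms(3) l] l assms(3) by blast
    fix l' assume l': "l' \<in> ?S \<and> finite {l'' \<in> ?S. l'' < l'} \<and> card {l'' \<in> ?S. l'' < l'} + 1 = m"
    then obtain j where j: "j \<ge> 1" "?T l' = real j * pi" using spec by auto
    then have "j = m" using below l' by auto
    then show "l' = l" using j l total_angle_eq_iff[OF n] by metis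
  qed
qed

lemma total_angle_SL_eigenvalue:
  assumes "nodes 0 zs" "\<sigma> \<ge> 0" "m \<ge> 1"
  shows "total_angle (SL_eigenvalue a q (set zs) \<sigma> m) \<sigma> zs 0 0 = real m * pi"
  using total_angle_attains[OF assms] SL_eigenvalue_eqI[OF assms] by auto

lemma energy_flow_Dirichlet_eigenvalue:
  assumes "m \<ge> 1"
  shows "energy_flow (Dirichlet_eigenvalue a q m) 0 a 0 = real m * pi"
  using total_angle_SL_eigenvalue[of "[]" 0 m] assms a_pos by simp

lemma Dirichlet_eigenvalue_strict_mono:
  assumes "1 \<le> m" "m < n"
  shows "Dirichlet_eigenvalue a q m < Dirichlet_eigenvalue a q n"
proof (rule ccontr)
  assume "\<not> ?thesis"
  then have "energy_flow (Dirichlet_eigenvalue a q n) 0 a 0 \<le> energy_flow (Dirichlet_eigenvalue a q m) 0 a 0"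
    using a_pos by (intro energy_flow_mono) auto
  then have "real n * pi \<le> real m * pi" using energy_flow_Dirichlet_eigenvalue[of m] energy_flow_Dirichlet_eigenvalue[of n] assms by simp
  then show False using assms by simp
qed

lemma finite_Dirichlet_eigenvalues_below: "finite {m. m \<ge> 1 \<and> Dirichlet_eigenvalue a q m \<le> C}"
proof (rule finite_subset)
  show "{m. m \<ge> 1 \<and> Dirichlet_eigenvalue a q m \<le> C} \<subseteq> {..nat \<lceil>energy_flow C 0 a 0 / pi\<rceil>}"
  proof safe
    fix m :: nat assume m: "m \<ge> 1" "Dirichlet_eigenvalue a q m \<le> C"
    then have "real m * pi \<le> energy_flow C 0 a 0"
      using energy_flow_mono[of 0 a "Dirichlet_eigenvalue a q m" C 0 0] energy_flow_Dirichlet_eigenvalue[of m] a_pos by simp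
    then have "real m \<le> energy_flow C 0 a 0 / pi" by (simp add: le_divide_eq)
    then show "m \<le> nat \<lceil>energy_flow C 0 a 0 / pi\<rceil>" by linarith
  qed
qed simp

text \<open>
  At the perturbed eigenvalue the unperturbed angle has already reached \<open>m \<pi>\<close>.
\<close>

lemma Dirichlet_eigenvalue_le:
  assumes "nodes 0 zs" "\<sigma> \<ge> 0" "m \<ge> 1"
  shows "Dirichlet_eigenvalue a q m \<le> SL_eigenvalue a q (set zs) \<sigma> m"
proof -
  let ?l = "SL_eigenvalue a q (set zs) \<sigma> m"
  have "total_angle (Dirichlet_eigenvalue a q m) 0 [] 0 0 = total_angle ?l \<sigma> zs 0 0"
    using total_angle_SL_eigenvalue[OF assms] energy_flow_Dirichlet_eigenvalue[OF assms(3)] by simp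
  also have "\<dots> \<le> total_angle ?l 0 [] 0 0" using total_angle_le_free[OF assms(1,2)] by simp
  finally show ?thesis using total_angle_le_iff[of 0 "[]"] a_pos by simp
qed

lemma SL_eigenvalue_zero:
  assumes "nodes 0 zs" "m \<ge> 1"
  shows "SL_eigenvalue a q (set zs) 0 m = Dirichlet_eigenvalue a q m"
  using assms energy_flow_Dirichlet_eigenvalue[of m] by (intro SL_eigenvalue_eqI) (auto simp: total_angle_zero)

section \<open>Strong interactions\<close>

text \<open>
  The condition \<open>P\<close> holds on every interval into which the points \<open>zs\<close> divide the interval from \<open>c\<close> to \<open>a\<close>.
\<close>

fun all_pieces :: "(real \<Rightarrow> real \<Rightarrow> bool) \<Rightarrow> real \<Rightarrow> real list \<Rightarrow> bool" where
  "all_pieces P c [] \<longleftrightarrow> P c a"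
| "all_pieces P c (z # zs) \<longleftrightarrow> P c z \<and> all_pieces P z zs"

lemma all_pieces_mono:
  assumes "nodes c zs" "all_pieces P c zs" "\<And>c d. 0 \<le> c \<Longrightarrow> c < d \<Longrightarrow> d \<le> a \<Longrightarrow> P c d \<Longrightarrow> Q c d"
  shows "all_pieces Q c zs"
  using assms(1,2)
proof (induction zs arbitrary: c)
  case Nil then show ?case using assms(3)[of c a] by auto
next
  case (Cons z zs) then show ?case using assms(3)[of c z] nodes_less(1)[of z zs] by auto
qed

lemma eventually_all_pieces:
  assumes "all_pieces (\<lambda>c d. eventually (\<lambda>l. P l c d) F) c zs"
  shows "eventually (\<lambda>l. all_pieces (P l) c zs) F"
  using assms by (induction zs arbitrary: c) (auto intro: eventually_conj)

lemma energy_flow_less_nearby: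
  assumes "0 \<le> c" "c \<le> d" "d \<le> a" "energy_flow l c d 0 < B"
  obtains \<eta> where "\<eta> > 0" "energy_flow l c d \<eta> < B"
proof -
  interpret s: prufer_system "\<lambda>_. 1" "\<lambda>x. l - q x" c d using assms by (intro energy_system) auto
  obtain K where K: "K \<ge> 0" "\<And>x. x \<in> {c..d} \<Longrightarrow> \<bar>(l - q x) - 1\<bar> \<le> K" using s.bound by blast
  define \<eta> where "\<eta> = (B - energy_flow l c d 0) / (2 * exp (K * (d - c)))"
  have \<eta>: "\<eta> > 0" using assms(4) by (simp add: \<eta>_def)
  have "\<bar>energy_flow l c d \<eta> - energy_flow l c d 0\<bar> \<le> exp (K * (d - c)) * (\<bar>\<eta> - 0\<bar> + 0 * exp (K * (d - c)) * (d - c))"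
    by (rule s.flow_lipschitz[OF s.B _ K(2)]) auto
  also have "\<dots> = (B - energy_flow l c d 0) / 2" using assms(4) by (simp add: \<eta>_def)
  finally have "energy_flow l c d \<eta> - energy_flow l c d 0 \<le> (B - energy_flow l c d 0) / 2"
    by (rule abs_le_D1)
  then have "energy_flow l c d \<eta> < B" using assms(4) by argo
  then show ?thesis using that \<eta> by blast
qed

text \<open>
  Suppose that the energy \<open>l\<close> lies below the \<open>k + 1\<close>-st Dirichlet eigenvalue of every piece.  For large
  \<open>\<sigma>\<close> the pieces decouple: starting slightly above \<open>0\<close>, the angle stays below \<open>(k + 1) \<pi>\<close> on a piece,
  and the jump presses it to slightly above \<open>k \<pi>\<close> or lower before the next piece begins.  So each
  piece contributes at most \<open>k \<pi>\<close> up to small errors, and the last one less than \<open>(k + 1) \<pi>\<close>.  Only the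
  values \<open>k = 0\<close> (energies below the mode) and \<open>k = 1\<close> (slightly above it) occur below.
  
  The induction goes through because the margin \<open>\<eta>\<close> is chosen from right to left: the margin
  demanded by the remaining pieces determines how large \<open>\<sigma>\<close> must be.
\<close>

lemma total_angle_strong_interaction:
  assumes "nodes c zs" "all_pieces (\<lambda>c d. energy_flow l c d 0 < real (k + 1) * pi) c zs"
  shows "\<exists>\<eta>>0. \<exists>\<sigma>0\<ge>0. \<forall>\<sigma>\<ge>\<sigma>0. \<forall>\<theta>\<le>\<eta>. total_angle l \<sigma> zs c \<theta> < real (k * (length zs + 1) + 1) * pi"
  using assms
proof (induction zs arbitrary: c)
  case Nil
  then obtain \<eta> where "\<eta> > 0" "energy_flow l c a \<eta> < real (k + 1) * pi"
    using energy_flow_less_nearby[of c a l "real (k + 1) * pi"] by auto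
  moreover from this have "energy_flow l c a \<theta> < real (k + 1) * pi" if "\<theta> \<le> \<eta>" for \<theta>
    using energy_flow_mono[of c a l l \<theta> \<eta>] that Nil by auto
  ultimately show ?case by (intro exI[of _ \<eta>] conjI exI[of _ 0]) auto
next
  case (Cons z zs)
  then have za: "z < a" "0 \<le> c" "c < z" and n: "nodes z zs" using nodes_less(1)[of z zs] by auto
  obtain \<eta>1 \<sigma>1 where 1: "\<eta>1 > 0" "\<sigma>1 \<ge> 0"
    "\<And>\<sigma> \<theta>. \<sigma> \<ge> \<sigma>1 \<Longrightarrow> \<theta> \<le> \<eta>1 \<Longrightarrow> total_angle l \<sigma> zs z \<theta> < real (k * (length zs + 1) + 1) * pi"
    using Cons.IH[of z] Cons.prems by auto
  obtain \<eta> where \<eta>: "\<eta> > 0" "energy_flow l c z \<eta> < real (k + 1) * pi"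
    using energy_flow_less_nearby[of c z l "real (k + 1) * pi"] Cons.prems(2) za by auto
  define \<delta> where "\<delta> = real (k + 1) * pi - energy_flow l c z \<eta>"
  have "\<delta> > 0" using \<eta> by (simp add: \<delta>_def)
  from jump_large[OF 1(1) this] obtain \<sigma>2 where 2: "\<sigma>2 \<ge> 0"
    "\<And>\<sigma> \<theta>. \<sigma> \<ge> \<sigma>2 \<Longrightarrow> \<theta> \<le> pi - \<delta> \<Longrightarrow> jump \<sigma> \<theta> \<le> \<eta>1" by blast
  show ?case
  proof (rule exI[of _ \<eta>], rule conjI[OF \<eta>(1)], rule exI[of _ "max \<sigma>1 \<sigma>2"], intro conjI allI impI)
    fix \<sigma> \<theta> assume \<sigma>: "max \<sigma>1 \<sigma>2 \<le> \<sigma>" and \<theta>: "\<theta> \<le> \<eta>"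
    have "energy_flow l c z \<theta> \<le> energy_flow l c z \<eta>" using za \<theta> by (intro energy_flow_mono) auto
    then have "energy_flow l c z \<theta> - real k * pi \<le> pi - \<delta>" by (simp add: \<delta>_def algebra_simps)
    then have "jump \<sigma> (energy_flow l c z \<theta> - real k * pi) \<le> \<eta>1" using 2(2) \<sigma> by simp
    then have "jump \<sigma> (energy_flow l c z \<theta>) \<le> \<eta>1 + of_int (int k) * pi"
      using jump_shift[of \<sigma> "energy_flow l c z \<theta> - real k * pi" "int k"] by simp
    then have "total_angle l \<sigma> (z # zs) c \<theta> \<le> total_angle l \<sigma> zs z (\<eta>1 + of_int (int k) * pi)"
      using total_angle_mono[OF n order_refl] by simp
    also have "\<dots> = total_angle l \<sigma> zs z \<eta>1 + of_int (int k) * pi" by (rule total_angle_shift[OF n])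
    also have "\<dots> < real (k * (length zs + 1) + 1) * pi + real k * pi" using 1(3)[of \<sigma> \<eta>1] \<sigma> by simp
    also have "\<dots> = real (k * (length (z # zs) + 1) + 1) * pi" by (simp add: algebra_simps)
    finally show "total_angle l \<sigma> (z # zs) c \<theta> < real (k * (length (z # zs) + 1) + 1) * pi" .
  qed (use 1(2) in auto)
qed

end

section \<open>Interactions at the zeros of an eigenfunction\<close>

locale Dirichlet_mode = bounded_potential +
  fixes ms :: nat and u :: "real \<Rightarrow> real"
  assumes ms: "ms \<ge> 1" and u: "Dirichlet_eigenfunction a q (Dirichlet_eigenvalue a q ms) u"
begin

abbreviation lam :: real where "lam \<equiv> Dirichlet_eigenvalue a q ms"

abbreviation mode_angle :: "real \<Rightarrow> real" where "mode_angle x \<equiv> energy_flow lam 0 x 0"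

lemma mode_angle_end: "mode_angle a = real ms * pi"
  using energy_flow_Dirichlet_eigenvalue ms by simp

lemma mode_angle_compose:
  assumes "0 \<le> x" "x \<le> y" "y \<le> a"
  shows "energy_flow lam x y (mode_angle x) = mode_angle y"
proof -
  interpret s: prufer_system "\<lambda>_. 1" "\<lambda>x. lam - q x" 0 y using assms by (intro energy_system) auto
  show ?thesis using assms by (intro s.flow_compose) auto
qed

lemma mode_angle_start [simp]: "mode_angle 0 = 0"
proof -
  interpret s: prufer_system "\<lambda>_. 1" "\<lambda>x. lam - q x" 0 a using a_pos by (intro energy_system) auto
  show ?thesis by simp
qed

lemma mode_angle_continuous_on: "continuous_on {0..a} mode_angle"
proof -
  interpret s: prufer_system "\<lambda>_. 1" "\<lambda>x. lam - q x" 0 a using a_pos by (intro energy_system) auto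
  show ?thesis by (rule s.flow_continuous_on)
qed

lemma mode_angle_crosses:
  assumes "0 \<le> x" "x < y" "y \<le> a" "of_int k * pi \<le> mode_angle x"
  shows "of_int k * pi < mode_angle y"
  using energy_flow_gt_of_int_pi[of x y k "mode_angle x" lam] mode_angle_compose[of x y] assms by simp

lemma interior_zeros_eq: "interior_zeros a u = {x \<in> {0<..<a}. \<exists>k::int. mode_angle x = of_int k * pi}"
  using Dirichlet_eigenfunction_zero_iff[OF u] unfolding interior_zeros_def by auto

lemma finite_interior_zeros: "finite (interior_zeros a u)"
proof (rule inj_on_finite)
  show "inj_on mode_angle (interior_zeros a u)"
  proof (rule linorder_inj_onI)
    fix x y assume xy: "x < y" "x \<in> interior_zeros a u" "y \<in> interior_zeros a u"
    then obtain k :: int where "mode_angle x = of_int k * pi" unfolding interior_zeros_eq by auto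
    with mode_angle_crosses[of x y k] xy show "mode_angle x \<noteq> mode_angle y"
      unfolding interior_zeros_eq by auto
  qed (simp add: linorder_linear)
  show "mode_angle ` interior_zeros a u \<subseteq> (\<lambda>k::int. of_int k * pi) ` {0..int ms}"
  proof safe
    fix x assume "x \<in> interior_zeros a u"
    then obtain k :: int where k: "mode_angle x = of_int k * pi" and x: "0 < x" "x < a"
      unfolding interior_zeros_eq by auto
    have "of_int 0 * pi < mode_angle x" using x by (intro mode_angle_crosses[of 0]) auto
    moreover have "of_int k * pi < mode_angle a" using x k by (intro mode_angle_crosses[of x]) auto
    ultimately have "0 * pi < real_of_int k * pi" "real_of_int k * pi < real ms * pi"
      unfolding k mode_angle_end by simp_all
    then have "0 < real_of_int k" "real_of_int k < real ms"
      unfolding mult_less_cancel_right_pos[OF pi_gt_zero] .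
    then have "0 < k" "k < int ms" by linarith+
    then show "mode_angle x \<in> (\<lambda>k::int. of_int k * pi) ` {0..int ms}" using k by auto
  qed
qed simp

definition zeros :: "real list" where "zeros = sorted_list_of_set (interior_zeros a u)"

lemma set_zeros: "set zeros = interior_zeros a u"
  by (simp add: zeros_def finite_interior_zeros)

lemma nodes_zeros: "nodes 0 zeros"
proof -
  have "sorted_wrt (<) zeros" by (simp add: zeros_def)
  moreover have "\<forall>x\<in>set zeros. 0 < x \<and> x < a" by (simp add: set_zeros interior_zeros_def)
  ultimately show ?thesis using a_pos by (auto simp: nodes_def sorted_wrt_append)
qed

text \<open>
  All interaction points are zeros of the mode, where jumps act trivially; so its angle is that of the
  problem without interactions, whatever \<open>\<sigma>\<close>.
\<close>

lemma total_angle_mode: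
  assumes "nodes c zs" "\<And>z. z \<in> set zs \<Longrightarrow> \<exists>k::int. mode_angle z = of_int k * pi"
  shows "total_angle lam \<sigma> zs c (mode_angle c) = mode_angle a"
  using assms
proof (induction zs arbitrary: c)
  case Nil then show ?case by (simp add: mode_angle_compose)
next
  case (Cons z zs)
  then have za: "z < a" "0 \<le> c" "c < z" using nodes_less(1)[of z zs] by auto
  obtain k :: int where k: "mode_angle z = of_int k * pi" using Cons.prems(2)[of z] by auto
  have "energy_flow lam c z (mode_angle c) = mode_angle z" using za by (intro mode_angle_compose) auto
  then have "jump \<sigma> (energy_flow lam c z (mode_angle c)) = mode_angle z" using k by simp
  then show ?case using Cons by simp
qed

text \<open>
  The mode remains an eigenfunction for all \<open>\<sigma>\<close>, and it keeps its number.
\<close>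

lemma SL_eigenvalue_mode:
  assumes "\<sigma> \<ge> 0"
  shows "SL_eigenvalue a q (interior_zeros a u) \<sigma> ms = lam"
proof -
  have "total_angle lam \<sigma> zeros 0 0 = real ms * pi"
    using total_angle_mode[OF nodes_zeros, of \<sigma>] mode_angle_end
    unfolding set_zeros interior_zeros_eq by auto
  then show ?thesis using SL_eigenvalue_eqI[OF nodes_zeros assms ms] by (simp add: set_zeros)
qed

lemma SL_eigenvalue_le_mode:
  assumes "\<sigma> \<ge> 0" "1 \<le> m" "m \<le> ms"
  shows "SL_eigenvalue a q (interior_zeros a u) \<sigma> m \<le> lam"
proof -
  have "real m * pi \<le> real ms * pi" using assms(3) by (intro mult_right_mono) auto
  then show ?thesis
    using total_angle_le_iff[OF nodes_zeros] total_angle_SL_eigenvalue[OF nodes_zeros assms(1,2)]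
      total_angle_SL_eigenvalue[OF nodes_zeros assms(1) ms] SL_eigenvalue_mode[OF assms(1)]
    by (metis set_zeros)
qed

lemma energy_flow_nodal_interval:
  assumes "0 \<le> c" "c < d" "d \<le> a" "mode_angle c = of_int k * pi" "mode_angle d = of_int j * pi"
    and "\<And>x i. c < x \<Longrightarrow> x < d \<Longrightarrow> mode_angle x \<noteq> of_int i * pi"
  shows "j = k + 1 \<and> energy_flow lam c d 0 = pi"
proof -
  interpret s: prufer_system "\<lambda>_. 1" "\<lambda>x. lam - q x" c d using assms by (intro energy_system) auto
  have "of_int k * pi < of_int j * pi" using mode_angle_crosses[OF assms(1-3), of k] assms(4,5) by simp
  then have kj: "k < j" by (simp add: mult_less_cancel_right)
  have j: "j = k + 1"
  proof (rule ccontr)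
    assume "j \<noteq> k + 1"
    then have "k + 1 < j" using kj by simp
    then have lt: "of_int (k + 1) * pi < mode_angle d" "mode_angle c < of_int (k + 1) * pi"
      unfolding assms(4,5) by (intro mult_strict_right_mono; simp)+
    moreover have "continuous_on {c..d} mode_angle"
      using assms by (intro continuous_on_subset[OF mode_angle_continuous_on]) auto
    ultimately obtain x where x: "c \<le> x" "x \<le> d" "mode_angle x = of_int (k + 1) * pi"
      using IVT'[of mode_angle c "of_int (k + 1) * pi" d] assms(2) by auto
    then have "c < x" "x < d" using lt by (auto simp: order.order_iff_strict)
    then show False using assms(6) x(3) by blast
  qed
  have "energy_flow lam c d (0 + of_int k * pi) = of_int j * pi"
    using mode_angle_compose[of c d] assms by simp
  then show ?thesis unfolding s.flow_shift j by (simp add: algebra_simps)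
qed

text \<open>
  Between consecutive zeros the angle of the mode increases by exactly \<open>\<pi>\<close>: the mode is the ground state
  of each of its nodal intervals, and there are \<open>ms\<close> of them.
\<close>

lemma nodal_intervals:
  assumes "nodes c zs" "set zs = {x \<in> {c<..<a}. \<exists>k::int. mode_angle x = of_int k * pi}"
    "mode_angle c = of_int k * pi"
  shows "all_pieces (\<lambda>c d. energy_flow lam c d 0 = pi) c zs \<and> int ms = k + int (length zs) + 1"
  using assms
proof (induction zs arbitrary: c k)
  case Nil
  then have "int ms = k + 1 \<and> energy_flow lam c a 0 = pi"
    using mode_angle_end by (intro energy_flow_nodal_interval) auto
  then show ?case by simp
next
  case (Cons z zs)
  then have za: "z < a" "0 \<le> c" "c < z" and n: "nodes z zs" using nodes_less(1)[of z zs] by auto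
  have zs: "z < x" if "x \<in> set zs" for x using nodes_less(2)[OF n that] .
  obtain j :: int where j: "mode_angle z = of_int j * pi" using Cons.prems(2) by auto
  have "j = k + 1 \<and> energy_flow lam c z 0 = pi"
  proof (rule energy_flow_nodal_interval[OF za(2,3) _ Cons.prems(3) j])
    fix x and i :: int assume x: "c < x" "x < z"
    then have "x \<notin> set (z # zs)" using zs[of x] by auto
    then show "mode_angle x \<noteq> of_int i * pi" unfolding Cons.prems(2) using x za by auto
  qed (use za in auto)
  moreover have "set zs = {x \<in> {z<..<a}. \<exists>k::int. mode_angle x = of_int k * pi}"
  proof -
    have "set zs = set (z # zs) \<inter> {z<..<a}" using zs nodes_less(3)[OF n] by auto
    moreover have "{x \<in> {c<..<a}. Q x} \<inter> {z<..<a} = {x \<in> {z<..<a}. Q x}" for Q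
      using za by auto
    ultimately show ?thesis by (simp only: Cons.prems(2))
  qed
  ultimately show ?case using Cons.IH[OF n _ j] by auto
qed

lemma mode_pieces: "all_pieces (\<lambda>c d. energy_flow lam c d 0 = pi) 0 zeros" "length zeros + 1 = ms"
  using nodal_intervals[OF nodes_zeros, of 0] unfolding set_zeros interior_zeros_eq by auto

text \<open>
  Strictly monotone dependence on the energy turns the increment \<open>\<pi>\<close> of the mode on every nodal interval
  into an increment less than \<open>\<pi>\<close> at energy \<open>lam - \<delta>\<close>; for large \<open>\<sigma>\<close> the total angle is then less
  than \<open>\<pi>\<close>, and no eigenvalue has been reached yet.
\<close>

lemma eventually_ge_below_mode:
  assumes "\<delta> > 0"
  shows "\<exists>\<sigma>0\<ge>0. \<forall>\<sigma>\<ge>\<sigma>0. \<forall>m\<ge>1. lam - \<delta> \<le> SL_eigenvalue a q (interior_zeros a u) \<sigma> m"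
proof -
  have "all_pieces (\<lambda>c d. energy_flow (lam - \<delta>) c d 0 < real (0 + 1) * pi) 0 zeros"
    using mode_pieces(1)
  proof (rule all_pieces_mono[OF nodes_zeros])
    fix c d assume cd: "0 \<le> c" "c < d" "d \<le> a" and eq: "energy_flow lam c d 0 = pi"
    then show "energy_flow (lam - \<delta>) c d 0 < real (0 + 1) * pi"
      using energy_flow_strict_mono_energy[OF cd, of "lam - \<delta>" lam 0] assms by simp
  qed
  from total_angle_strong_interaction[OF nodes_zeros this]
  obtain \<eta> \<sigma>0 where *: "\<eta> > 0" "\<sigma>0 \<ge> 0"
    "\<And>\<sigma> \<theta>. \<sigma> \<ge> \<sigma>0 \<Longrightarrow> \<theta> \<le> \<eta> \<Longrightarrow> total_angle (lam - \<delta>) \<sigma> zeros 0 \<theta> < real (0 * (length zeros + 1) + 1) * pi"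
    by blast
  have "lam - \<delta> \<le> SL_eigenvalue a q (interior_zeros a u) \<sigma> m" if "\<sigma> \<ge> \<sigma>0" "m \<ge> 1" for \<sigma> m
  proof -
    have "total_angle (lam - \<delta>) \<sigma> zeros 0 0 < pi" using *(3)[OF that(1), of 0] *(1) by simp
    also have "pi \<le> real m * pi" using that(2) by simp
    also have "\<dots> = total_angle (SL_eigenvalue a q (set zeros) \<sigma> m) \<sigma> zeros 0 0"
      using that *(2) by (intro total_angle_SL_eigenvalue[OF nodes_zeros, symmetric]) auto
    finally show ?thesis
      unfolding set_zeros by (rule total_angle_le_iff[OF nodes_zeros, THEN iffD1, OF less_imp_le])
  qed
  then show ?thesis using *(2) by blast
qed

text \<open>
  At energies slightly above \<open>lam\<close> the increment on every nodal interval is still less than \<open>2 \<pi>\<close>, so for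
  large \<open>\<sigma>\<close> the total angle is less than \<open>(ms + 1) \<pi>\<close>: at most \<open>ms\<close> eigenvalues have been reached.
  The energy \<open>lam + \<delta>\<close> is chosen before \<open>\<sigma>\<close> and serves all \<open>m > ms\<close>.
\<close>

lemma eventually_ge_above_mode:
  "\<exists>\<delta>>0. \<exists>\<sigma>0\<ge>0. \<forall>\<sigma>\<ge>\<sigma>0. \<forall>m>ms. lam + \<delta> \<le> SL_eigenvalue a q (interior_zeros a u) \<sigma> m"
proof -
  have "all_pieces (\<lambda>c d. eventually (\<lambda>l. energy_flow l c d 0 < real (1 + 1) * pi) (at_right lam)) 0 zeros"
    using mode_pieces(1)
  proof (rule all_pieces_mono[OF nodes_zeros])
    fix c d assume cd: "0 \<le> c" "c < d" "d \<le> a" and eq: "energy_flow lam c d 0 = pi"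
    have "isCont (\<lambda>l. energy_flow l c d 0) lam" using cd by (intro energy_flow_continuous) auto
    then have "((\<lambda>l. energy_flow l c d 0) \<longlongrightarrow> pi) (at_right lam)"
      unfolding isCont_def eq by (rule filterlim_at_split[THEN iffD1, THEN conjunct2])
    then show "eventually (\<lambda>l. energy_flow l c d 0 < real (1 + 1) * pi) (at_right lam)"
      by (rule order_tendstoD) simp
  qed
  then have "eventually (\<lambda>l. all_pieces (\<lambda>c d. energy_flow l c d 0 < real (1 + 1) * pi) 0 zeros) (at_right lam)"
    by (rule eventually_all_pieces)
  then have "eventually (\<lambda>l. lam < l \<and> all_pieces (\<lambda>c d. energy_flow l c d 0 < real (1 + 1) * pi) 0 zeros) (at_right lam)"
    by (intro eventually_conj) (auto simp: eventually_at_filter)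
  then obtain l1 where l1: "lam < l1" "all_pieces (\<lambda>c d. energy_flow l1 c d 0 < real (1 + 1) * pi) 0 zeros"
    using eventually_happens'[OF trivial_limit_at_right_real] by blast
  from total_angle_strong_interaction[OF nodes_zeros l1(2)]
  obtain \<eta> \<sigma>0 where *: "\<eta> > 0" "\<sigma>0 \<ge> 0"
    "\<And>\<sigma> \<theta>. \<sigma> \<ge> \<sigma>0 \<Longrightarrow> \<theta> \<le> \<eta> \<Longrightarrow> total_angle l1 \<sigma> zeros 0 \<theta> < real (1 * (length zeros + 1) + 1) * pi"
    by blast
  have "l1 \<le> SL_eigenvalue a q (interior_zeros a u) \<sigma> m" if "\<sigma> \<ge> \<sigma>0" "m > ms" for \<sigma> m
  proof -
    have "total_angle l1 \<sigma> zeros 0 0 < real (ms + 1) * pi" 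
      using *(3)[OF that(1), of 0] *(1) unfolding mode_pieces(2) by simp
    also have "\<dots> \<le> real m * pi" using that(2) by (intro mult_right_mono) auto
    also have "\<dots> = total_angle (SL_eigenvalue a q (set zeros) \<sigma> m) \<sigma> zeros 0 0"
      using that *(2) by (intro total_angle_SL_eigenvalue[OF nodes_zeros, symmetric]) auto
    finally show ?thesis
      unfolding set_zeros by (rule total_angle_le_iff[OF nodes_zeros, THEN iffD1, OF less_imp_le])
  qed
  then show ?thesis using *(2) l1(1) by (intro exI[of _ "l1 - lam"]) auto
qed

end

text \<open>
  All that the two-dimensional problem needs to know about its one-dimensional factors.
\<close>

lemma nodal_interaction_eigenvalues:
  fixes a :: real and q u :: "real \<Rightarrow> real" and ms :: nat
  assumes "a > 0" "Linf_on {0<..<a} q" "ms \<ge> 1"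
    and "Dirichlet_eigenfunction a q (Dirichlet_eigenvalue a q ms) u"
  defines "D \<equiv> Dirichlet_eigenvalue a q" and "E \<equiv> SL_eigenvalue a q (interior_zeros a u)"
  shows "\<And>m. m \<ge> 1 \<Longrightarrow> E 0 m = D m"
    and "\<And>\<sigma> m. \<sigma> \<ge> 0 \<Longrightarrow> m \<ge> 1 \<Longrightarrow> D m \<le> E \<sigma> m"
    and "\<And>\<sigma> m. \<sigma> \<ge> 0 \<Longrightarrow> 1 \<le> m \<Longrightarrow> m \<le> ms \<Longrightarrow> E \<sigma> m \<le> D ms"
    and "\<And>\<delta>. \<delta> > 0 \<Longrightarrow> \<exists>\<sigma>0\<ge>0. \<forall>\<sigma>\<ge>\<sigma>0. \<forall>m\<ge>1. D ms - \<delta> \<le> E \<sigma> m"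
    and "\<exists>\<delta>>0. \<exists>\<sigma>0\<ge>0. \<forall>\<sigma>\<ge>\<sigma>0. \<forall>m>ms. D ms + \<delta> \<le> E \<sigma> m"
    and "\<And>m n. 1 \<le> m \<Longrightarrow> m < n \<Longrightarrow> D m < D n"
    and "\<And>C. finite {m. m \<ge> 1 \<and> D m \<le> C}"
proof -
  obtain q' where q': "bounded_measurable 0 a q'" "AE x in lebesgue_on {0..a}. q x = q' x"
    using Linf_on_representative[OF assms(2)] by blast
  have op: "SL_operator a q = SL_operator a q'" by (rule SL_operator_cong_AE[OF q'(2)])
  then have ef: "SL_eigenfunction a q = SL_eigenfunction a q'" by (simp add: SL_eigenfunction_def[abs_def])
  then have "SL_spectrum a q = SL_spectrum a q'" by (simp add: SL_spectrum_def[abs_def])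
  then have ev: "SL_eigenvalue a q = SL_eigenvalue a q'" by (simp add: SL_eigenvalue_def[abs_def])
  interpret Dirichlet_mode a q' ms u
    using assms(1,3,4) q'(1) unfolding ef ev by unfold_locales
  note n = nodes_zeros
  show "E 0 m = D m" if "m \<ge> 1" for m
    using SL_eigenvalue_zero[OF n that] by (simp add: E_def D_def ev set_zeros)
  show "D m \<le> E \<sigma> m" if "\<sigma> \<ge> 0" "m \<ge> 1" for \<sigma> m
    using Dirichlet_eigenvalue_le[OF n that] by (simp add: E_def D_def ev set_zeros)
  show "E \<sigma> m \<le> D ms" if "\<sigma> \<ge> 0" "1 \<le> m" "m \<le> ms" for \<sigma> m
    using SL_eigenvalue_le_mode[OF that] by (simp add: E_def D_def ev)
  show "\<exists>\<sigma>0\<ge>0. \<forall>\<sigma>\<ge>\<sigma>0. \<forall>m\<ge>1. D ms - \<delta> \<le> E \<sigma> m" if "\<delta> > 0" for \<delta>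
    using eventually_ge_below_mode[OF that] by (simp add: E_def D_def ev)
  show "\<exists>\<delta>>0. \<exists>\<sigma>0\<ge>0. \<forall>\<sigma>\<ge>\<sigma>0. \<forall>m>ms. D ms + \<delta> \<le> E \<sigma> m"
    using eventually_ge_above_mode by (simp add: E_def D_def ev)
  show "D m < D n" if "1 \<le> m" "m < n" for m n
    using Dirichlet_eigenvalue_strict_mono[OF that] by (simp add: D_def ev)
  show "finite {m. m \<ge> 1 \<and> D m \<le> C}" for C
    using finite_Dirichlet_eigenvalues_below by (simp add: D_def ev)
qed

section \<open>Eigenvalue curves on the rectangle\<close>

lemma analytic_curve_continuous_on:
  assumes "analytic_curve g"
  shows "continuous_on {0..} g"
proof -
  obtain G where G: "G analytic_on (complex_of_real ` {0..})"
    "\<And>\<sigma>. \<sigma> \<ge> 0 \<Longrightarrow> G (complex_of_real \<sigma>) = complex_of_real (g \<sigma>)"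
    using assms by (auto simp: analytic_curve_def)
  have "continuous_on (complex_of_real ` {0..}) G"
    using G(1) by (intro holomorphic_on_imp_continuous_on analytic_imp_holomorphic)
  then have "continuous_on {0..} (\<lambda>\<sigma>. G (complex_of_real \<sigma>))"
    by (rule continuous_on_compose2) (auto intro!: continuous_intros)
  then have "continuous_on {0..} (\<lambda>\<sigma>. Re (G (complex_of_real \<sigma>)))"
    by (rule continuous_on_Re)
  then show ?thesis by (rule continuous_on_cong[THEN iffD1, rotated 2]) (use G(2) in auto)
qed

text \<open>
  The curve ends above \<open>L + \<delta> / 2\<close>: the factor \<open>f\<close> gains \<open>\<delta>\<close> over its reference value \<open>A\<close>, and for the
  other factor it is enough to fall short of \<open>B\<close> by at most \<open>\<delta> / 2\<close>.
\<close>

lemma curve_crosses: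
  fixes f g :: "real \<Rightarrow> real"
  assumes cont: "continuous_on {0..} (\<lambda>\<sigma>. f \<sigma> + g \<sigma>)" and start: "f 0 + g 0 \<le> L" and \<epsilon>: "0 < \<epsilon>" "\<epsilon> \<le> \<delta> / 2"
    and f: "\<exists>\<sigma>0\<ge>0. \<forall>\<sigma>\<ge>\<sigma>0. A + \<delta> \<le> f \<sigma>" and g: "\<exists>\<sigma>0\<ge>0. \<forall>\<sigma>\<ge>\<sigma>0. B - \<delta> / 2 \<le> g \<sigma>" and "L = A + B"
  shows "\<exists>\<sigma>>0. f \<sigma> + g \<sigma> = L + \<epsilon>"
proof -
  obtain s1 s2 where s: "s1 \<ge> 0" "\<And>\<sigma>. \<sigma> \<ge> s1 \<Longrightarrow> A + \<delta> \<le> f \<sigma>" "s2 \<ge> 0" "\<And>\<sigma>. \<sigma> \<ge> s2 \<Longrightarrow> B - \<delta> / 2 \<le> g \<sigma>"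
    using f g by auto
  define s where "s = max s1 s2"
  have "A + \<delta> \<le> f s" "B - \<delta> / 2 \<le> g s" by (intro s(2) s(4); simp add: s_def)+
  then have "L + \<epsilon> \<le> f s + g s" using \<epsilon> assms(7) by simp
  moreover have "f 0 + g 0 \<le> L + \<epsilon>" using start \<epsilon> by simp
  moreover have "0 \<le> s" using s by (simp add: s_def)
  ultimately obtain x where x: "0 \<le> x" "f x + g x = L + \<epsilon>"
    using IVT'[of "\<lambda>\<sigma>. f \<sigma> + g \<sigma>" 0 "L + \<epsilon>" s] continuous_on_subset[OF cont, of "{0..s}"] by auto
  then have "x \<noteq> 0" using start \<epsilon> by auto
  then show ?thesis using x by (intro exI[of _ x]) auto
qed

theorem theorem1:
  fixes \<alpha> :: real
    and q r :: "real \<Rightarrow> real"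
    and ms ns :: nat
    and u v :: "real \<Rightarrow> real"
    and \<gamma> :: "nat \<Rightarrow> real \<Rightarrow> real"
    and k :: "nat \<Rightarrow> nat \<Rightarrow> nat"
  assumes "\<alpha> > 0"
    and "Linf_on {0<..<\<alpha> * pi} q"
    and "Linf_on {0<..<pi} r"
    and "ms \<ge> 1" and "ns \<ge> 1"
    and "Dirichlet_eigenfunction (\<alpha> * pi) q (Dirichlet_eigenvalue (\<alpha> * pi) q ms) u"
    and "Dirichlet_eigenfunction pi r (Dirichlet_eigenvalue pi r ns) v"
    and "eigenvalue_curves (\<alpha> * pi) pi q r
           (interior_zeros (\<alpha> * pi) u) (interior_zeros pi v) \<gamma>"
    and "curve_index (\<alpha> * pi) pi q r
           (interior_zeros (\<alpha> * pi) u) (interior_zeros pi v) \<gamma> k"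
  shows "\<exists>\<epsilon>\<^sub>0>0. \<forall>\<epsilon>. 0 < \<epsilon> \<and> \<epsilon> < \<epsilon>\<^sub>0 \<longrightarrow>
           (\<forall>m\<ge>1. \<forall>n\<ge>1.
              point_gives_rise \<gamma> k (rect_eigenvalue (\<alpha> * pi) pi q r ms ns) \<epsilon> m n \<longleftrightarrow>
              rect_eigenvalue (\<alpha> * pi) pi q r m n
                \<le> rect_eigenvalue (\<alpha> * pi) pi q r ms ns \<and>
              (m > ms \<or> n > ns))"
proof -
  define D where "D = Dirichlet_eigenvalue (\<alpha> * pi) q"
  define E where "E = SL_eigenvalue (\<alpha> * pi) q (interior_zeros (\<alpha> * pi) u)"
  define D' where "D' = Dirichlet_eigenvalue pi r"
  define E' where "E' = SL_eigenvalue pi r (interior_zeros pi v)"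
  have a: "\<alpha> * pi > 0" using assms(1) by simp
  note x = nodal_interaction_eigenvalues[OF a assms(2,4,6), folded D_def E_def]
  note y = nodal_interaction_eigenvalues[OF pi_gt_zero assms(3,5,7), folded D'_def E'_def]
  define L where "L = D ms + D' ns"
  have rect: "rect_eigenvalue (\<alpha> * pi) pi q r m n = D m + D' n" for m n
    by (simp add: rect_eigenvalue_def D_def D'_def)
  have curve: "\<gamma> (k m n) \<sigma> = E \<sigma> m + E' \<sigma> n" if "m \<ge> 1" "n \<ge> 1" "\<sigma> \<ge> 0" for m n \<sigma>
    using assms(9) that unfolding curve_index_def E_def E'_def by blast
  have cont: "continuous_on {0..} (\<lambda>\<sigma>. E \<sigma> m + E' \<sigma> n)" if "m \<ge> 1" "n \<ge> 1" for m n
  proof -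
    have "k m n \<ge> 1" using assms(9) that unfolding curve_index_def by blast
    then have "continuous_on {0..} (\<gamma> (k m n))"
      using assms(8) analytic_curve_continuous_on unfolding eigenvalue_curves_def by blast
    then show ?thesis by (rule continuous_on_cong[THEN iffD1, rotated 2]) (use curve that in auto)
  qed
  have rise: "point_gives_rise \<gamma> k L \<epsilon> m n \<longleftrightarrow> (\<exists>\<sigma>>0. E \<sigma> m + E' \<sigma> n = L + \<epsilon>)" if "m \<ge> 1" "n \<ge> 1" for \<epsilon> m n
    unfolding point_gives_rise_def curve_gives_rise_def using curve[OF that] by (metis less_imp_le)

  \<comment> \<open>Discreteness of the spectrum: a uniform gap above \<open>L\<close>, with \<open>1\<close> as default if no eigenvalue lies in \<open>(L, L + 1]\<close>.\<close>
  obtain \<epsilon>1 where \<epsilon>1: "\<epsilon>1 > 0" "\<And>m n. m \<ge> 1 \<Longrightarrow> n \<ge> 1 \<Longrightarrow> D m + D' n > L \<Longrightarrow> L + \<epsilon>1 \<le> D m + D' n"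
  proof -
    let ?S = "{(m, n). m \<ge> 1 \<and> n \<ge> 1 \<and> D m + D' n \<le> L + 1 \<and> D m + D' n > L}"
    have min: "D 1 \<le> D m" "D' 1 \<le> D' m" if "m \<ge> 1" for m
      using x(6)[of 1 m] y(6)[of 1 m] that by (cases "m = 1"; auto)+
    have "?S \<subseteq> {m. m \<ge> 1 \<and> D m \<le> L + 1 - D' 1} \<times> {n. n \<ge> 1 \<and> D' n \<le> L + 1 - D 1}"
      using min by (force simp: algebra_simps)
    then have fin: "finite ?S" by (rule finite_subset) (intro finite_cartesian_product x(7) y(7))
    let ?V = "insert 1 ((\<lambda>(m, n). D m + D' n - L) ` ?S)"
    have finV: "finite ?V" using fin by simp
    show thesis
    proof (rule that[of "Min ?V"])
      show "Min ?V > 0" using finV by (subst Min_gr_iff) auto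
      fix m n :: nat assume mn: "m \<ge> 1" "n \<ge> 1" "D m + D' n > L"
      show "L + Min ?V \<le> D m + D' n"
      proof (cases "D m + D' n \<le> L + 1")
        case True
        then have "(m, n) \<in> ?S" using mn by simp
        then have "D m + D' n - L \<in> ?V" by (intro insertI2 image_eqI[of _ _ "(m, n)"]) auto
        then have "Min ?V \<le> D m + D' n - L" by (rule Min_le[OF finV])
        then show ?thesis by simp
      next
        case False
        then show ?thesis using Min_le[OF finV, of 1] by simp
      qed
    qed
  qed
  obtain \<delta>x where \<delta>x: "\<delta>x > 0" "\<exists>\<sigma>0\<ge>0. \<forall>\<sigma>\<ge>\<sigma>0. \<forall>m>ms. D ms + \<delta>x \<le> E \<sigma> m" using x(5) by blast
  obtain \<delta>y where \<delta>y: "\<delta>y > 0" "\<exists>\<sigma>0\<ge>0. \<forall>\<sigma>\<ge>\<sigma>0. \<forall>n>ns. D' ns + \<delta>y \<le> E' \<sigma> n" using y(5) by blast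
  show ?thesis
    unfolding rect L_def[symmetric]
  proof (intro exI[of _ "min \<epsilon>1 (min (\<delta>x / 2) (\<delta>y / 2))"] conjI allI impI)
    show "0 < min \<epsilon>1 (min (\<delta>x / 2) (\<delta>y / 2))" using \<epsilon>1 \<delta>x \<delta>y by simp
    fix \<epsilon> :: real and m n :: nat
    assume \<epsilon>: "0 < \<epsilon> \<and> \<epsilon> < min \<epsilon>1 (min (\<delta>x / 2) (\<delta>y / 2))" and m: "1 \<le> m" and n: "1 \<le> n"
    show "point_gives_rise \<gamma> k L \<epsilon> m n \<longleftrightarrow> D m + D' n \<le> L \<and> (ms < m \<or> ns < n)"
      unfolding rise[OF m n]
    proof
      assume "\<exists>\<sigma>>0. E \<sigma> m + E' \<sigma> n = L + \<epsilon>"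
      then obtain \<sigma> where \<sigma>: "\<sigma> > 0" "E \<sigma> m + E' \<sigma> n = L + \<epsilon>" by blast
      have "D m + D' n \<le> L"
      proof (rule ccontr)
        assume "\<not> ?thesis"
        then have "L + \<epsilon>1 \<le> D m + D' n" using \<epsilon>1(2)[OF m n] by simp
        then show False using x(2)[of \<sigma> m] y(2)[of \<sigma> n] \<sigma> \<epsilon> m n by simp
      qed
      moreover have "ms < m \<or> ns < n"
      proof (rule ccontr)
        assume "\<not> ?thesis"
        then show False using x(3)[of \<sigma> m] y(3)[of \<sigma> n] \<sigma> \<epsilon> m n by (simp add: L_def)
      qed
      ultimately show "D m + D' n \<le> L \<and> (ms < m \<or> ns < n)" by blast
    next
      assume R: "D m + D' n \<le> L \<and> (ms < m \<or> ns < n)"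
      have start: "E 0 m + E' 0 n \<le> L" using R x(1)[OF m] y(1)[OF n] by simp
      show "\<exists>\<sigma>>0. E \<sigma> m + E' \<sigma> n = L + \<epsilon>"
      proof (cases "ms < m")
        case True
        show ?thesis
        proof (rule curve_crosses[where \<delta> = \<delta>x and A = "D ms" and B = "D' ns"])
          show "\<exists>\<sigma>0\<ge>0. \<forall>\<sigma>\<ge>\<sigma>0. D ms + \<delta>x \<le> E \<sigma> m" using \<delta>x(2) True by blast
          show "\<exists>\<sigma>0\<ge>0. \<forall>\<sigma>\<ge>\<sigma>0. D' ns - \<delta>x / 2 \<le> E' \<sigma> n" using y(4)[of "\<delta>x / 2"] \<delta>x(1) n by fastforce
        qed (use cont[OF m n] start \<epsilon> in \<open>auto simp: L_def\<close>)
      next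
        case False
        then have n': "ns < n" using R by simp
        have "\<exists>\<sigma>>0. E' \<sigma> n + E \<sigma> m = L + \<epsilon>"
        proof (rule curve_crosses[where \<delta> = \<delta>y and A = "D' ns" and B = "D ms"])
          show "\<exists>\<sigma>0\<ge>0. \<forall>\<sigma>\<ge>\<sigma>0. D' ns + \<delta>y \<le> E' \<sigma> n" using \<delta>y(2) n' by blast
          show "\<exists>\<sigma>0\<ge>0. \<forall>\<sigma>\<ge>\<sigma>0. D ms - \<delta>y / 2 \<le> E \<sigma> m" using x(4)[of "\<delta>y / 2"] \<delta>y(1) m by fastforce
        qed (use cont[OF m n] start \<epsilon> in \<open>auto simp: L_def add.commute\<close>)
        then show ?thesis by (simp add: add.commute)
      qed
    qed
  qed
qed

end
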